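(* Assume that $\sigma^2:=\operatorname{Var}\xi\in(0,\infty)$ and put $\mu:=\mathbb{E}\xi<\infty$. Then $$C\left(\left(\frac{Y(t)-\mu^{-1}\int_0^t \mathbb{P}\{\eta\le y\}\,dy}{(2\sigma^2\mu^{-3}\,t\log\log t)^{1/2}}\,:\,t>e\right)\right)=[-1,1]\quad\text{almost surely.}$$
   Context: Let $(\xi_k,\eta_k)_{k\ge1}$ be independent copies of a random vector $(\xi,\eta)$ with positive, arbitrarily dependent components (the distribution of $\eta$ is arbitrary on $(0,\infty)$). Put $S_0:=0$, $S_k:=\xi_1+\dots+\xi_k$ for $k\ge1$, and $T_k:=S_{k-1}+\eta_k$ for $k\ge1$. The counting process is $Y(t):=\sum_{k\ge1}\mathbf{1}_{\{T_k\le t\}}$ for $t\ge0$. Here $t$ is a real parameter. For a family $(x_t)$ of real numbers indexed by real $t>e$, $C((x_t))$ denotes the set of its limit points as $t\to\infty$, that is, the set of all $x\in\mathbb{R}$ for which there is a sequence $t_n\to\infty$ with $x_{t_n}\to x$. *)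

theory Defs
  imports "HOL-Probability.Probability"
begin

definition walk :: "(nat \<Rightarrow> 'a \<Rightarrow> real) \<Rightarrow> nat \<Rightarrow> 'a \<Rightarrow> real" where
  "walk X k \<omega> = (\<Sum>i=1..k. X i \<omega>)"

(* Used for k >= 1 only. *)
definition perturbed_walk ::
  "(nat \<Rightarrow> 'a \<Rightarrow> real) \<Rightarrow> (nat \<Rightarrow> 'a \<Rightarrow> real) \<Rightarrow> nat \<Rightarrow> 'a \<Rightarrow> real" where
  "perturbed_walk X H k \<omega> = walk X (k - 1) \<omega> + H k \<omega>"

(* The infinite sum is a junk value (0) if infinitely many terms are 1.  For i.i.d. positive
   X k and positive H k this happens, for some t, only on a null set, because then
   perturbed_walk X H k \<ge> walk X (k - 1) tends to infinity almost surely. *)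
definition counting_process ::
  "(nat \<Rightarrow> 'a \<Rightarrow> real) \<Rightarrow> (nat \<Rightarrow> 'a \<Rightarrow> real) \<Rightarrow> real \<Rightarrow> 'a \<Rightarrow> real" where
  "counting_process X H t \<omega> = (\<Sum>\<^sub>\<infinity>k\<in>{1..}. of_bool (perturbed_walk X H k \<omega> \<le> t))"

(* Real limit points, as t tends to infinity, of a family x indexed by the reals t > a. *)
definition limit_points :: "real \<Rightarrow> (real \<Rightarrow> real) \<Rightarrow> real set" where
  "limit_points a x = {c. \<exists>s :: nat \<Rightarrow> real.
     (\<forall>n. s n > a) \<and> filterlim s at_top sequentially \<and> (\<lambda>n. x (s n)) \<longlonglongrightarrow> c}"

end

theory Submission
  imports Defs "HOL-Real_Asymp.Real_Asymp"
begin

text \<open>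
  Let \<open>S\<^sub>n\<close> be the random walk with steps \<open>\<xi>\<close>, \<open>N(t)\<close> the number of \<open>n \<ge> 0\<close> with \<open>S\<^sub>n \<le> t\<close>,
  \<open>D(t) = N(t) - max 0 t / \<mu>\<close>, and \<open>F\<close> the distribution function of \<open>\<eta>\<close>. For a fixed path of the walk and an
  independent copy of \<open>\<eta>\<close>, the sum of \<open>F(t - S\<^sub>k)\<close> over all \<open>k\<close> is the mean of \<open>N(t - \<eta>)\<close>, while the
  integral of \<open>F\<close> over \<open>[0, t]\<close> is the mean of \<open>max 0 (t - \<eta>)\<close>. Hence
  \<open>Y(t) - \<mu>\<^sup>-\<^sup>1 \<integral>\<^sub>0\<^sup>t F = (Y(t) - \<Sum>\<^sub>k F(t - S\<^sub>k)) + (E D(t - \<eta>) - D(t)) + D(t)\<close>.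
  The first two terms are almost surely of smaller order than \<open>sqrt (t log log t)\<close>; the third one
  carries the law of the iterated logarithm.

  The third term. Since \<open>S\<close> overshoots \<open>t\<close> at the index \<open>N(t)\<close> by at most one step, \<open>\<mu> D(t)\<close> is
  \<open>- (S\<^sub>N\<^sub>(\<^sub>t\<^sub>) - N(t) \<mu>)\<close> up to a negligible error (\<open>renewal_path.D_approx\<close>). As \<open>N(t) \<sim> t / \<mu>\<close> and \<open>N\<close>
  takes every positive integer value, the cluster set is the one in the Hartman--Wintner law for
  the walk (\<open>standard_iid.lil_cluster\<close>). That law is proved here for steps with finite variance. Upper half
  (\<open>lil_upper\<close>): the \<open>i\<close>-th step is truncated at \<open>\<epsilon> sqrt (i / log log i)\<close>; the cut-off parts have a finite
  weighted expected sum, and the truncated walk is controlled by an exponential maximal inequality along a geometric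
  sequence. Lower half (\<open>lil_lower\<close>): a long stretch of steps is divided into about \<open>log k\<close>
  equal blocks, each of which exceeds a fixed high level with the probability given by the central limit theorem.
  The steps of the normalised walk tend to \<open>0\<close>, so it cannot jump over any value between its
  extreme limit points.

  The second term. A shift of \<open>t\<close> by a bounded amount changes \<open>D\<close> by at most a constant plus the number of renewals in a
  bounded window, which is of order at most \<open>sqrt t\<close> (\<open>window_count\<close>); the event that \<open>\<eta>\<close> is large has small probability, and on it
  the change of \<open>D\<close> is of the order of the scale.

  The first term (\<open>fluctuation_negligible\<close>). For fixed \<open>t\<close> it is a sum of bounded martingale
  differences with conditional variance \<open>o(t)\<close>, and a Bernstein inequality bounds a deviation of the order of
  the scale by any negative power of \<open>log t\<close>. This is summable only along a sparse sequence, namely \<open>t = exp (sqrt m)\<close>. The gaps of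
  this sequence have length at most \<open>t / log t\<close>, so the increments over them have so small a variance that the same inequality gives
  a negative power of \<open>t\<close>, which is summable over all integers. Between integers, monotonicity of
  \<open>Y\<close> and of the sum of \<open>F(t - S\<^sub>k)\<close> suffices.
\<close>

section \<open>Exponential supermartingales along independent sequences\<close>

text \<open>The past \<open>V\<^sub>0, \<dots>, V\<^sub>n\<^sub>-\<^sub>1\<close> is independent of \<open>V\<^sub>n\<close>, so by Fubini the integral may first be taken over
  \<open>V\<^sub>n\<close> with the past frozen. This replaces conditional expectations everywhere below.\<close>
lemma (in prob_space) nn_integral_past_mult_le:
  fixes V :: "nat \<Rightarrow> 'a \<Rightarrow> 'b" and u :: "(nat \<Rightarrow> 'b) \<Rightarrow> ennreal"
  assumes ind: "indep_vars (\<lambda>_. N) V UNIV"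
    and u[measurable]: "u \<in> borel_measurable (PiM {..<n} (\<lambda>_. N))"
    and g[measurable]: "g \<in> borel_measurable (PiM {..<n} (\<lambda>_. N) \<Otimes>\<^sub>M N)"
    and le: "\<And>w. w \<in> space (PiM {..<n} (\<lambda>_. N)) \<Longrightarrow> (\<integral>\<^sup>+\<omega>. g (w, V n \<omega>) \<partial>M) \<le> 1"
  shows "(\<integral>\<^sup>+\<omega>. u (\<lambda>i\<in>{..<n}. V i \<omega>) * g (\<lambda>i\<in>{..<n}. V i \<omega>, V n \<omega>) \<partial>M)
       \<le> (\<integral>\<^sup>+\<omega>. u (\<lambda>i\<in>{..<n}. V i \<omega>) \<partial>M)"
proof -
  let ?A = "PiM {..<n} (\<lambda>_. N)" and ?W = "\<lambda>\<omega>. \<lambda>i\<in>{..<n}. V i \<omega>"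
  let ?B = "PiM {n} (\<lambda>_. N)" and ?R = "\<lambda>\<omega>. \<lambda>i\<in>{n}. V i \<omega>"
  have iv: "indep_var ?A ?W ?B ?R"
    by (rule indep_var_restrict[OF ind]) auto
  then have W[measurable]: "random_variable ?A ?W" and R[measurable]: "random_variable ?B ?R"
    and eq: "distr M ?A ?W \<Otimes>\<^sub>M distr M ?B ?R = distr M (?A \<Otimes>\<^sub>M ?B) (\<lambda>\<omega>. (?W \<omega>, ?R \<omega>))"
    unfolding indep_var_distribution_eq by auto
  interpret P: prob_space "distr M ?B ?R" by (rule prob_space_distr) simp
  have [measurable]: "(\<lambda>p. g (fst p, snd p n)) \<in> borel_measurable (?A \<Otimes>\<^sub>M ?B)"
    by (intro measurable_compose[OF _ g] measurable_Pair measurable_fst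
        measurable_compose[OF measurable_snd measurable_component_singleton]) auto
  have "(\<integral>\<^sup>+\<omega>. u (?W \<omega>) * g (?W \<omega>, V n \<omega>) \<partial>M)
      = (\<integral>\<^sup>+p. u (fst p) * g (fst p, snd p n) \<partial>distr M (?A \<Otimes>\<^sub>M ?B) (\<lambda>\<omega>. (?W \<omega>, ?R \<omega>)))"
    by (subst nn_integral_distr) auto
  also have "\<dots> = (\<integral>\<^sup>+p. u (fst p) * g (fst p, snd p n) \<partial>(distr M ?A ?W \<Otimes>\<^sub>M distr M ?B ?R))"
    by (simp only: eq)
  also have "\<dots> = (\<integral>\<^sup>+w. (\<integral>\<^sup>+v. u w * g (w, v n) \<partial>distr M ?B ?R) \<partial>distr M ?A ?W)"
    by (subst P.nn_integral_fst[symmetric]) auto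
  also have "\<dots> \<le> (\<integral>\<^sup>+w. u w * 1 \<partial>distr M ?A ?W)"
  proof (intro nn_integral_mono)
    fix w assume w: "w \<in> space (distr M ?A ?W)"
    then have gw[measurable]: "(\<lambda>v. g (w, v n)) \<in> borel_measurable ?B"
      by (intro measurable_compose[OF _ g] measurable_Pair measurable_const measurable_component_singleton) auto
    have "(\<integral>\<^sup>+v. u w * g (w, v n) \<partial>distr M ?B ?R) = u w * (\<integral>\<^sup>+v. g (w, v n) \<partial>distr M ?B ?R)"
      by (intro nn_integral_cmult) simp
    also have "(\<integral>\<^sup>+v. g (w, v n) \<partial>distr M ?B ?R) = (\<integral>\<^sup>+\<omega>. g (w, V n \<omega>) \<partial>M)"
      by (subst nn_integral_distr) auto
    also have "u w * \<dots> \<le> u w * 1"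
      using le[of w] w by (intro mult_left_mono) auto
    finally show "(\<integral>\<^sup>+v. u w * g (w, v n) \<partial>distr M ?B ?R) \<le> u w * 1" .
  qed
  also have "\<dots> = (\<integral>\<^sup>+\<omega>. u (?W \<omega>) \<partial>M)"
    by (subst nn_integral_distr) auto
  finally show ?thesis .
qed

lemma borel_measurable_past:
  fixes f :: "nat \<Rightarrow> (nat \<Rightarrow> 'b) \<Rightarrow> 'b \<Rightarrow> real"
  assumes f: "(\<lambda>(w, v). f k w v) \<in> borel_measurable (PiM {..<k} (\<lambda>_. N) \<Otimes>\<^sub>M N)" and k: "k < n"
  shows "(\<lambda>w. f k (restrict w {..<k}) (w k)) \<in> borel_measurable (PiM {..<n} (\<lambda>_. N))"
proof -
  have m: "(\<lambda>w. (restrict w {..<k}, w k)) \<in> measurable (PiM {..<n} (\<lambda>_. N)) (PiM {..<k} (\<lambda>_. N) \<Otimes>\<^sub>M N)"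
    using k by (intro measurable_Pair measurable_restrict_subset measurable_component_singleton) auto
  show ?thesis using measurable_compose[OF m f] by simp
qed

text \<open>The increment \<open>f k\<close> may depend on the past. Its exponential has mean at most \<open>1\<close> for every frozen past, so the
  factors can be removed one at a time, starting from the last.\<close>
lemma (in prob_space) exp_supermartingale:
  fixes V :: "nat \<Rightarrow> 'a \<Rightarrow> 'b" and f :: "nat \<Rightarrow> (nat \<Rightarrow> 'b) \<Rightarrow> 'b \<Rightarrow> real"
  assumes ind: "indep_vars (\<lambda>_. N) V UNIV"
    and f: "\<And>k. (\<lambda>(w, v). f k w v) \<in> borel_measurable (PiM {..<k} (\<lambda>_. N) \<Otimes>\<^sub>M N)"
    and le: "\<And>k w. w \<in> space (PiM {..<k} (\<lambda>_. N)) \<Longrightarrow> (\<integral>\<^sup>+\<omega>. ennreal (exp (f k w (V k \<omega>))) \<partial>M) \<le> 1"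
  shows "(\<integral>\<^sup>+\<omega>. ennreal (exp (\<Sum>k<n. f k (\<lambda>i\<in>{..<k}. V i \<omega>) (V k \<omega>))) \<partial>M) \<le> 1"
proof (induction n)
  case 0
  then show ?case by (simp add: emeasure_space_1)
next
  case (Suc n)
  let ?W = "\<lambda>n \<omega>. \<lambda>i\<in>{..<n}. V i \<omega>"
  let ?z = "\<lambda>w. ennreal (exp (\<Sum>k<n. f k (restrict w {..<k}) (w k)))"
  note f[measurable]
  note fk = borel_measurable_past[OF f]
  have [measurable]: "?z \<in> borel_measurable (PiM {..<n} (\<lambda>_. N))"
    by (intro measurable_compose[OF _ measurable_ennreal] borel_measurable_exp borel_measurable_sum fk) auto
  have gm: "(\<lambda>p. ennreal (exp (f n (fst p) (snd p)))) \<in> borel_measurable (PiM {..<n} (\<lambda>_. N) \<Otimes>\<^sub>M N)"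
    using f[of n] by (simp add: case_prod_beta')
  have r: "restrict (?W n \<omega>) {..<k} = ?W k \<omega>" if "k < n" for k \<omega>
    using that by (auto simp: fun_eq_iff)
  have z: "?z (?W n \<omega>) = ennreal (exp (\<Sum>k<n. f k (?W k \<omega>) (V k \<omega>)))" for \<omega>
    by (intro arg_cong[where f="\<lambda>x. ennreal (exp x)"] sum.cong refl) (simp add: r del: restrict_restrict)
  have "(\<integral>\<^sup>+\<omega>. ennreal (exp (\<Sum>k<Suc n. f k (?W k \<omega>) (V k \<omega>))) \<partial>M)
      = (\<integral>\<^sup>+\<omega>. ?z (?W n \<omega>) * (\<lambda>p. ennreal (exp (f n (fst p) (snd p)))) (?W n \<omega>, V n \<omega>) \<partial>M)"
    unfolding z by (simp add: exp_add ennreal_mult')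
  also have "\<dots> \<le> (\<integral>\<^sup>+\<omega>. ?z (?W n \<omega>) \<partial>M)"
    by (rule nn_integral_past_mult_le[OF ind _ gm, where u="?z"]) (auto intro: le)
  also have "\<dots> \<le> 1" unfolding z using Suc .
  finally show ?case .
qed

lemma (in prob_space) prob_le_of_exp_moment:
  assumes [measurable]: "Z \<in> borel_measurable M"
    and le: "(\<integral>\<^sup>+\<omega>. ennreal (exp (Z \<omega>)) \<partial>M) \<le> 1"
  shows "prob {\<omega>\<in>space M. Z \<omega> \<ge> a} \<le> exp (- a)"
proof -
  have "emeasure M {\<omega>\<in>space M. Z \<omega> \<ge> a} \<le> emeasure M {\<omega>\<in>space M. ennreal (exp (- a)) * ennreal (exp (Z \<omega>)) \<ge> 1}"
    by (intro emeasure_mono) (auto simp: ennreal_mult'[symmetric] exp_add[symmetric] simp flip: ennreal_1 intro!: ennreal_leI)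
  also have "\<dots> \<le> ennreal (exp (- a)) * (\<integral>\<^sup>+\<omega>. ennreal (exp (Z \<omega>)) * indicator (space M) \<omega> \<partial>M)"
  proof -
    show ?thesis
      by (rule nn_integral_Markov_inequality) auto
  qed
  also have "(\<integral>\<^sup>+\<omega>. ennreal (exp (Z \<omega>)) * indicator (space M) \<omega> \<partial>M) = (\<integral>\<^sup>+\<omega>. ennreal (exp (Z \<omega>)) \<partial>M)"
    by (intro nn_integral_cong) auto
  also have "ennreal (exp (- a)) * \<dots> \<le> ennreal (exp (- a)) * 1"
    by (intro mult_left_mono le) auto
  finally show ?thesis
    by (simp add: emeasure_eq_measure)
qed

text \<open>Freezing the sum \<open>x\<close> once it has reached \<open>a\<close>: the frozen sum still exceeds \<open>a\<close> at the end,
  which turns a bound at one time into a bound for the maximum.\<close>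
lemma stopped_sum:
  fixes x y :: "nat \<Rightarrow> real"
  assumes y: "\<And>k. y k = (if \<exists>m\<le>k. a \<le> sum x {..<m} then 0 else x k)"
  shows "\<exists>m\<le>n. a \<le> sum x {..<m} \<Longrightarrow> a \<le> sum y {..<n}"
    and "\<not> (\<exists>m\<le>n. a \<le> sum x {..<m}) \<Longrightarrow> sum y {..<n} = sum x {..<n}"
proof (induction n)
  case (Suc n)
  {
    case 1
    show ?case
    proof (cases "\<exists>m\<le>n. a \<le> sum x {..<m}")
      case True
      then show ?thesis using Suc(1)[OF True] y[of n, unfolded if_P[OF True]] by simp
    next
      case False
      then have "a \<le> sum x {..<Suc n}" using 1 by (metis le_Suc_eq)
      then show ?thesis using Suc(2)[OF False] y[of n, unfolded if_not_P[OF False]] by simp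
    qed
  next
    case 2
    then have ne: "\<not> (\<exists>m\<le>n. a \<le> sum x {..<m})" by (meson le_SucI)
    show ?case using Suc(2)[OF ne] y[of n, unfolded if_not_P[OF ne]] by simp
  }
qed auto

text \<open>Ville's inequality. The increments are set to \<open>0\<close> as soon as the level has been reached; the exponential
  of the stopped sum has mean at most \<open>1\<close> as well, so Markov's inequality at time \<open>n\<close> suffices.\<close>
theorem (in prob_space) exp_maximal_inequality:
  fixes V :: "nat \<Rightarrow> 'a \<Rightarrow> 'b" and f :: "nat \<Rightarrow> (nat \<Rightarrow> 'b) \<Rightarrow> 'b \<Rightarrow> real"
  assumes ind: "indep_vars (\<lambda>_. N) V UNIV"
    and f: "\<And>k. (\<lambda>(w, v). f k w v) \<in> borel_measurable (PiM {..<k} (\<lambda>_. N) \<Otimes>\<^sub>M N)"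
    and le: "\<And>k w. w \<in> space (PiM {..<k} (\<lambda>_. N)) \<Longrightarrow> (\<integral>\<^sup>+\<omega>. ennreal (exp (f k w (V k \<omega>))) \<partial>M) \<le> 1"
  shows "prob {\<omega>\<in>space M. \<exists>m\<le>n. (\<Sum>k<m. f k (\<lambda>i\<in>{..<k}. V i \<omega>) (V k \<omega>)) \<ge> a} \<le> exp (- a)"
proof -
  let ?W = "\<lambda>n \<omega>. \<lambda>i\<in>{..<n}. V i \<omega>"
  have V[measurable]: "random_variable N (V i)" for i
    using ind unfolding indep_vars_def by auto
  define z where "z m w = (\<Sum>k<m. f k (restrict w {..<k}) (w k))" for m and w :: "nat \<Rightarrow> 'b"
  define f' where "f' k w v = (if \<exists>m\<le>k. z m w \<ge> a then 0 else f k w v)" for k and w :: "nat \<Rightarrow> 'b" and v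
  note fk = borel_measurable_past[OF f]
  have zm: "z m \<in> borel_measurable (PiM {..<k} (\<lambda>_. N))" if "m \<le> k" for m k
    unfolding z_def[abs_def] using that by (intro borel_measurable_sum fk) auto
  have f'm: "(\<lambda>(w, v). f' k w v) \<in> borel_measurable (PiM {..<k} (\<lambda>_. N) \<Otimes>\<^sub>M N)" for k
  proof -
    have 1: "{w \<in> space (PiM {..<k} (\<lambda>_. N)). z m w \<ge> a} \<in> sets (PiM {..<k} (\<lambda>_. N))" if "m \<le> k" for m
      using zm[OF that] by measurable
    have "{w \<in> space (PiM {..<k} (\<lambda>_. N)). \<exists>m\<le>k. z m w \<ge> a}
        = (\<Union>m\<in>{..k}. {w \<in> space (PiM {..<k} (\<lambda>_. N)). z m w \<ge> a})" by auto
    also have "\<dots> \<in> sets (PiM {..<k} (\<lambda>_. N))" using 1 by auto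
    finally have "Measurable.pred (PiM {..<k} (\<lambda>_. N)) (\<lambda>w. \<exists>m\<le>k. z m w \<ge> a)"
      unfolding pred_def .
    from measurable_compose[OF measurable_fst this]
    have 2: "{p \<in> space (PiM {..<k} (\<lambda>_. N) \<Otimes>\<^sub>M N). \<exists>m\<le>k. z m (fst p) \<ge> a}
        \<in> sets (PiM {..<k} (\<lambda>_. N) \<Otimes>\<^sub>M N)"
      unfolding pred_def .
    show ?thesis
      unfolding f'_def case_prod_beta'
      by (rule measurable_If[OF measurable_const _ 2]) (use f[of k] in \<open>simp_all add: case_prod_beta'\<close>)
  qed
  have le': "(\<integral>\<^sup>+\<omega>. ennreal (exp (f' k w (V k \<omega>))) \<partial>M) \<le> 1" if "w \<in> space (PiM {..<k} (\<lambda>_. N))" for k w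
    
  proof (cases "\<exists>m\<le>k. z m w \<ge> a")
    case True
    then have "f' k w = (\<lambda>v. 0)" unfolding f'_def[abs_def] by (auto simp: fun_eq_iff)
    then show ?thesis by (simp add: emeasure_space_1)
  next
    case False
    then have "f' k w = f k w" unfolding f'_def[abs_def] by (auto simp: fun_eq_iff)
    then show ?thesis using le[OF that] by simp
  qed
  have Wm: "(\<lambda>\<omega>. (?W k \<omega>, V k \<omega>)) \<in> measurable M (PiM {..<k} (\<lambda>_. N) \<Otimes>\<^sub>M N)" for k
    by measurable
  have m1: "(\<lambda>\<omega>. f' k (?W k \<omega>) (V k \<omega>)) \<in> borel_measurable M" for k
    using measurable_compose[OF Wm f'm] by simp
  have r: "restrict (?W n \<omega>) {..<k} = ?W k \<omega>" if "k < n" for k n \<omega>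
    using that by (auto simp: fun_eq_iff)
  have zW: "z m (?W k \<omega>) = (\<Sum>j<m. f j (?W j \<omega>) (V j \<omega>))" if "m \<le> k" for m k \<omega>
    unfolding z_def using that by (intro sum.cong) (auto simp: r simp del: restrict_restrict)
  have f'_eq: "f' k (?W k \<omega>) (V k \<omega>) = (if \<exists>m\<le>k. a \<le> (\<Sum>j<m. f j (?W j \<omega>) (V j \<omega>)) then 0
      else f k (?W k \<omega>) (V k \<omega>))" for k \<omega>
    unfolding f'_def using zW[of _ k \<omega>] by (intro if_cong ex_cong1 refl) (metis (no_types, lifting))
  have key: "(\<Sum>k<n. f' k (?W k \<omega>) (V k \<omega>)) \<ge> a"
    if "\<exists>m\<le>n. (\<Sum>k<m. f k (?W k \<omega>) (V k \<omega>)) \<ge> a" for \<omega>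
    using stopped_sum(1)[OF f'_eq that] .
  have "prob {\<omega>\<in>space M. \<exists>m\<le>n. (\<Sum>k<m. f k (?W k \<omega>) (V k \<omega>)) \<ge> a}
     \<le> prob {\<omega>\<in>space M. (\<Sum>k<n. f' k (?W k \<omega>) (V k \<omega>)) \<ge> a}"
    using m1 key by (intro finite_measure_mono) auto
  also have "\<dots> \<le> exp (- a)"
    by (intro prob_le_of_exp_moment exp_supermartingale[OF ind f'm] le' borel_measurable_sum m1)
  finally show ?thesis .
qed

section \<open>The iterated-logarithm scale\<close>

text \<open>The shift by \<open>27\<close> makes \<open>ln (x + 27) \<ge> 3\<close> and \<open>llog x \<ge> 1\<close> for all \<open>x \<ge> 0\<close>, which avoids case
  distinctions for small arguments; the ratio to \<open>ln (ln x)\<close> tends to \<open>1\<close>.\<close>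
definition llog :: "real \<Rightarrow> real" where
  "llog x = ln (ln (x + 27))"

definition lil_scale :: "real \<Rightarrow> real" where
  "lil_scale x = sqrt (2 * x * llog x)"

lemma ln_27_ge: "x \<ge> 0 \<Longrightarrow> ln (x + 27) \<ge> (3::real)"
proof -
  assume "x \<ge> 0"
  \<comment> \<open>As \<open>exp 1 \<le> 3\<close>, the number \<open>exp 3\<close> is at most \<open>27\<close>.\<close>
  have "exp (3::real) = exp 1 ^ 3"
    using exp_of_nat_mult[of 3 "1::real"] by simp
  also have "\<dots> \<le> 3 ^ 3"
    by (intro power_mono exp_le) auto
  also have "\<dots> \<le> x + 27" using \<open>x \<ge> 0\<close> by simp
  finally show ?thesis
    using \<open>x \<ge> 0\<close> by (subst ln_ge_iff) auto
qed

lemma llog_ge_1: "x \<ge> 0 \<Longrightarrow> llog x \<ge> 1"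
  unfolding llog_def using ln_27_ge[of x] exp_le
  by (subst ln_ge_iff) auto

lemma llog_mono: "0 \<le> x \<Longrightarrow> x \<le> y \<Longrightarrow> llog x \<le> llog y"
  unfolding llog_def using ln_27_ge[of x] ln_27_ge[of y] by simp

lemma llog_step:
  assumes "x \<ge> 0" shows "llog (x + 1) \<le> llog x + 1 / (3 * (x + 27))"
proof -
  have l: "ln (x + 27) \<ge> 3" "ln (x + 1 + 27) \<ge> 3" using ln_27_ge[of x] ln_27_ge[of "x + 1"] assms by auto
  have 1: "ln (x + 1 + 27) - ln (x + 27) \<le> 1 / (x + 27)"
    using ln_diff_le[of "x + 1 + 27" "x + 27"] assms by simp
  have "llog (x + 1) - llog x \<le> (ln (x + 1 + 27) - ln (x + 27)) / ln (x + 27)"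
    unfolding llog_def using l by (intro ln_diff_le) auto
  also have "\<dots> \<le> (1 / (x + 27)) / 3"
    using 1 l assms by (intro frac_le) auto
  finally show ?thesis by (simp add: field_simps)
qed

text \<open>The derivative of \<open>sqrt (x / llog x)\<close> is at least \<open>1 / (3 sqrt (x llog x))\<close> since \<open>x llog' x \<le> 1/3\<close>; this is
  the discrete form, which telescopes.\<close>
lemma sqrt_div_llog_step:
  fixes x :: real assumes "x \<ge> 0"
  shows "sqrt (x / llog x) + 1 / (3 * sqrt ((x + 1) * llog (x + 1))) \<le> sqrt ((x + 1) / llog (x + 1))"
proof -
  let ?l = "llog x" and ?m = "llog (x + 1)"
  have l: "?l \<ge> 1" "?m \<ge> 1" using llog_ge_1 assms by auto
  have "x * (x + 1) * ?m \<le> x * (x + 1) * (?l + 1 / (3 * (x + 27)))"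
    using llog_step[OF assms] assms by (intro mult_left_mono) auto
  also have "\<dots> \<le> x * (x + 1) * ?l + x / 3"
    using assms by (simp add: field_simps)
  also have "\<dots> \<le> x * (x + 1) * ?l + (x / 3) * ?l"
    using l assms mult_left_mono[of 1 ?l "x/3"] by simp
  also have "\<dots> \<le> (x + 2 / 3)\<^sup>2 * ?l"
    using l assms by (simp add: power2_eq_square algebra_simps)
  finally have "x * ((x + 1) * ?m) \<le> (x + 2 / 3)\<^sup>2 * ?l"
    by (simp add: mult.assoc)
  moreover have "(x + 1) * ?m > 0" using l assms by simp
  ultimately have "x / ?l \<le> (x + 2 / 3)\<^sup>2 / ((x + 1) * ?m)"
    using l by (subst pos_le_divide_eq) (auto simp: divide_le_eq mult.commute)
  then have "sqrt (x / ?l) \<le> sqrt ((x + 2 / 3)\<^sup>2 / ((x + 1) * ?m))"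
    by simp
  also have "\<dots> = (x + 2 / 3) / sqrt ((x + 1) * ?m)"
    using assms by (simp add: real_sqrt_divide)
  finally have le: "sqrt (x / ?l) \<le> (x + 2 / 3) / sqrt ((x + 1) * ?m)" .
  have "sqrt (x / ?l) + 1 / (3 * sqrt ((x + 1) * ?m)) \<le> (x + 1) / sqrt ((x + 1) * ?m)"
  proof -
    have D: "sqrt ((x + 1) * ?m) > 0" using assms l by simp
    have "sqrt (x / ?l) + 1 / (3 * D) \<le> (x + 1) / D"
      if "sqrt (x / ?l) \<le> (x + 2 / 3) / D" "D > 0" for D
    proof -
      have "(x + 2 / 3) / D + 1 / (3 * D) = (x + 1) / D" using that(2) by (simp add: field_simps)
      then show ?thesis using that(1) by linarith
    qed
    then show ?thesis using D le by blast
  qed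
  also have "\<dots> = sqrt ((x + 1)\<^sup>2) / sqrt ((x + 1) * ?m)"
    using assms by simp
  also have "\<dots> = sqrt ((x + 1)\<^sup>2 / ((x + 1) * ?m))"
    by (rule real_sqrt_divide[symmetric])
  also have "(x + 1)\<^sup>2 / ((x + 1) * ?m) = (x + 1) / ?m"
    using assms by (simp add: power2_eq_square)
  finally show ?thesis .
qed

lemma sum_inverse_sqrt_llog_le:
  "(\<Sum>i<n. 1 / sqrt ((real i + 1) * llog (real i + 1))) \<le> 3 * sqrt (real n / llog (real n))"
proof (induction n)
  case (Suc n)
  then show ?case
    using sqrt_div_llog_step[of "real n"] by (simp add: algebra_simps)
qed simp

lemma div_llog_mono:
  assumes "m \<le> n"
  shows "real m / llog (real m) \<le> real n / llog (real n)"
  using assms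
proof (induction n rule: dec_induct)
  case (step n)
  have "sqrt (real n / llog (real n)) \<le> sqrt (real (Suc n) / llog (real (Suc n)))"
  proof -
    have "0 \<le> 1 / (3 * sqrt ((real n + 1) * llog (real n + 1)))"
      using llog_ge_1[of "real n + 1"] by simp
    then show ?thesis
      using sqrt_div_llog_step[of "real n"] by (simp only: of_nat_Suc add.commute[of 1]) linarith
  qed
  then show ?case using step by (simp only: real_sqrt_le_iff)
qed simp

lemma lil_scale_at_top: "filterlim lil_scale at_top at_top"
  unfolding llog_def[abs_def] lil_scale_def[abs_def] by real_asymp

lemma lil_scale_mono: "0 \<le> x \<Longrightarrow> x \<le> y \<Longrightarrow> lil_scale x \<le> lil_scale y"
  unfolding lil_scale_def using llog_mono[of x y] llog_ge_1[of x]
  by (intro real_sqrt_le_mono mult_mono) auto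

lemma lil_scale_pos: "x > 0 \<Longrightarrow> lil_scale x > 0"
  unfolding lil_scale_def using llog_ge_1[of x] by simp

text \<open>Kronecker's lemma for nonnegative terms, where a split of the sum at a late index is enough.\<close>
lemma kronecker_nonneg:
  fixes r c :: "nat \<Rightarrow> real"
  assumes r: "\<And>i. r i \<ge> 0" and c: "\<And>i. c i > 0" "\<And>i j. i \<le> j \<Longrightarrow> c i \<le> c j"
    and lim: "filterlim c at_top sequentially" and sm: "summable (\<lambda>i. r i / c i)"
  shows "(\<lambda>n. (\<Sum>i<n. r i) / c n) \<longlonglongrightarrow> 0"
proof (rule LIMSEQ_I)
  fix e :: real assume "e > 0"
  have "\<exists>m. \<forall>a\<ge>m. \<forall>b. \<bar>\<Sum>i\<in>{a..<b}. r i / c i\<bar> < e / 2"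
    using sm[unfolded summable_Cauchy, rule_format, of "e / 2"] \<open>e > 0\<close> unfolding real_norm_def by fastforce
  then obtain m where m: "\<And>n. \<bar>\<Sum>i\<in>{m..<n}. r i / c i\<bar> < e / 2" by auto
  have "eventually (\<lambda>n. c n > 2 * (\<Sum>i<m. r i) / e) sequentially"
    using lim by (simp add: filterlim_at_top_dense)
  then obtain k where k: "\<And>n. n \<ge> k \<Longrightarrow> c n > 2 * (\<Sum>i<m. r i) / e"
    by (auto simp: eventually_sequentially)
  show "\<exists>no. \<forall>n\<ge>no. norm ((\<Sum>i<n. r i) / c n - 0) < e"
  proof (intro exI allI impI)
    fix n assume n: "n \<ge> max m k"
    have "(\<Sum>i<n. r i) = (\<Sum>i<m. r i) + (\<Sum>i\<in>{m..<n}. r i)"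
      using n sum.atLeastLessThan_concat[of 0 m n r] by (simp add: atLeast0LessThan)
    also have "(\<Sum>i\<in>{m..<n}. r i) \<le> (\<Sum>i\<in>{m..<n}. c n * (r i / c i))"
    proof (intro sum_mono)
      fix i assume "i \<in> {m..<n}"
      then have "r i * c i \<le> r i * c n" using c(2)[of i n] r by (intro mult_left_mono) auto
      then show "r i \<le> c n * (r i / c i)" using c(1)[of i] by (simp add: field_simps)
    qed
    also have "\<dots> = c n * (\<Sum>i\<in>{m..<n}. r i / c i)" by (simp add: sum_distrib_left)
    also have "\<dots> < c n * (e / 2)"
      using m[of n] c(1)[of n] by (intro mult_strict_left_mono) auto
    finally have "(\<Sum>i<n. r i) < c n * (e / 2) + (\<Sum>i<m. r i)" by simp
    also have "(\<Sum>i<m. r i) < c n * (e / 2)" using k[of n] n \<open>e > 0\<close> by (simp add: field_simps)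
    finally have "(\<Sum>i<n. r i) / c n < e" using c(1)[of n] by (simp add: field_simps)
    then show "norm ((\<Sum>i<n. r i) / c n - 0) < e"
      using c(1)[of n] sum_nonneg[of "{..<n}" r] r by simp
  qed
qed

section \<open>Truncation of a random walk with finite variance\<close>

lemma exp_le_quadratic: "exp (y::real) \<le> 1 + y + y\<^sup>2 / 2 * exp \<bar>y\<bar>"
proof -
  obtain t where t: "\<bar>t\<bar> \<le> \<bar>y\<bar>" "exp y = (\<Sum>m<2. y ^ m / fact m) + exp t / fact 2 * y ^ 2"
    using Maclaurin_exp_le[of y 2] by blast
  have "exp t * y\<^sup>2 \<le> exp \<bar>y\<bar> * y\<^sup>2" using t(1) by (intro mult_right_mono) auto
  with t(2) show ?thesis by (simp add: numeral_2_eq_2 field_simps)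
qed

locale standard_iid = prob_space M for M :: "'a measure" +
  fixes X :: "nat \<Rightarrow> 'a \<Rightarrow> real"
  assumes indep: "indep_vars (\<lambda>_. borel) X UNIV"
    and ident: "\<And>i. distr M borel (X i) = distr M borel (X 0)"
    and square_integrable: "integrable M (\<lambda>\<omega>. (X 0 \<omega>)\<^sup>2)"
    and mean_0: "expectation (X 0) = 0"
    and second_moment: "expectation (\<lambda>\<omega>. (X 0 \<omega>)\<^sup>2) = 1"
begin

lemma X_meas[measurable]: "X i \<in> borel_measurable M"
  using indep unfolding indep_vars_def by auto

lemma integrable_ident:
  assumes f: "f \<in> borel_measurable borel"
  shows "integrable M (\<lambda>\<omega>. f (X i \<omega>) :: real) \<longleftrightarrow> integrable M (\<lambda>\<omega>. f (X 0 \<omega>))"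
  using integrable_distr_eq[OF X_meas f, of i] integrable_distr_eq[OF X_meas f, of 0] ident[of i] by simp

lemma expectation_ident:
  assumes f: "f \<in> borel_measurable borel"
  shows "expectation (\<lambda>\<omega>. f (X i \<omega>) :: real) = expectation (\<lambda>\<omega>. f (X 0 \<omega>))"
  using integral_distr[OF X_meas f, of i] integral_distr[OF X_meas f, of 0] ident[of i] by simp

lemma integrable_X2: "integrable M (\<lambda>\<omega>. (X i \<omega>)\<^sup>2)"
  using integrable_ident[of "\<lambda>x. x\<^sup>2" i] square_integrable by simp

lemma integrable_X: "integrable M (X i)"
  by (rule square_integrable_imp_integrable[OF _ integrable_X2]) simp

lemma expectation_X: "expectation (X i) = 0"
  using expectation_ident[of "\<lambda>x. x" i] mean_0 by simp

lemma expectation_X2: "expectation (\<lambda>\<omega>. (X i \<omega>)\<^sup>2) = 1"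
  using expectation_ident[of "\<lambda>x. x\<^sup>2" i] second_moment by simp

lemma standard_iid_uminus: "standard_iid M (\<lambda>i \<omega>. - X i \<omega>)"
proof
  show "indep_vars (\<lambda>_. borel) (\<lambda>i \<omega>. - X i \<omega>) UNIV"
    by (rule indep_vars_compose2[OF indep]) auto
  show "distr M borel (\<lambda>\<omega>. - X i \<omega>) = distr M borel (\<lambda>\<omega>. - X 0 \<omega>)" for i
    using distr_distr[of uminus borel borel "X i" M] distr_distr[of uminus borel borel "X 0" M] ident[of i]
    by (simp add: comp_def)
qed (use square_integrable mean_0 second_moment integrable_X in auto)

text \<open>The truncation level \<open>e sqrt (n / llog n)\<close> for the \<open>n\<close>-th step, \<open>n = i + 1\<close>: the product with the
  optimal exponential parameter \<open>sqrt (2 llog n / n)\<close> is the small constant \<open>e sqrt 2\<close>, so exponential moments of the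
  truncated steps are almost Gaussian.\<close>
definition level :: "real \<Rightarrow> nat \<Rightarrow> real" where
  "level e i = e * sqrt ((real i + 1) / llog (real i + 1))"

definition tail_part :: "real \<Rightarrow> nat \<Rightarrow> real \<Rightarrow> real" where
  "tail_part e i x = (if \<bar>x\<bar> \<le> level e i then 0 else x)"

lemma tail_part_meas[measurable]: "tail_part e i \<in> borel_measurable borel"
  unfolding tail_part_def[abs_def] by measurable

lemma level_mono: "e \<ge> 0 \<Longrightarrow> i \<le> j \<Longrightarrow> level e i \<le> level e j"
  unfolding level_def using div_llog_mono[of "Suc i" "Suc j"]
  by (intro mult_left_mono) (auto simp: add.commute)

text \<open>Only indices with \<open>level e i < \<bar>x\<bar>\<close> contribute. If \<open>m\<close> is the largest of them, the weights sum
  to at most a multiple of \<open>sqrt (m / llog m)\<close>, which is again the level, hence at most a multiple of \<open>\<bar>x\<bar>\<close>. Taking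
  expectations, a second moment suffices to sum the cut-off parts.\<close>
lemma sum_tail_part_le:
  assumes "e > 0"
  shows "(\<Sum>i<n. \<bar>tail_part e i x\<bar> / lil_scale (real i + 1)) \<le> 3 / e * x\<^sup>2"
proof -
  let ?I = "{i. i < n \<and> level e i < \<bar>x\<bar>}"
  have l: "llog (real i + 1) \<ge> 1" for i by (rule llog_ge_1) simp
  have eq: "(\<Sum>i<n. \<bar>tail_part e i x\<bar> / lil_scale (real i + 1)) = (\<Sum>i\<in>?I. \<bar>x\<bar> / lil_scale (real i + 1))"
    by (rule sum.mono_neutral_cong_right) (auto simp: tail_part_def)
  show ?thesis
  proof (cases "?I = {}")
    case True
    show ?thesis unfolding eq using True assms by (simp only: sum.empty) simp
  next
    case False
    define m where "m = Max ?I"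
    have fin: "finite ?I" by simp
    have m: "m \<in> ?I" unfolding m_def using Max_in[OF fin False] .
    have "(\<Sum>i\<in>?I. \<bar>x\<bar> / lil_scale (real i + 1)) \<le> (\<Sum>i\<in>?I. \<bar>x\<bar> * (1 / sqrt ((real i + 1) * llog (real i + 1))))"
    proof (intro sum_mono)
      fix i
      have "sqrt ((real i + 1) * llog (real i + 1)) \<le> lil_scale (real i + 1)"
        unfolding lil_scale_def using l[of i] by (intro real_sqrt_le_mono) (simp add: mult.assoc)
      moreover have "sqrt ((real i + 1) * llog (real i + 1)) > 0" using l[of i] by simp
      ultimately show "\<bar>x\<bar> / lil_scale (real i + 1) \<le> \<bar>x\<bar> * (1 / sqrt ((real i + 1) * llog (real i + 1)))"
        by (simp add: frac_le)
    qed
    also have "\<dots> \<le> (\<Sum>i<Suc m. \<bar>x\<bar> * (1 / sqrt ((real i + 1) * llog (real i + 1))))"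
    proof (intro sum_mono2)
      show "?I \<subseteq> {..<Suc m}" unfolding m_def using Max_ge[OF fin] by (auto simp: less_Suc_eq_le)
      show "0 \<le> \<bar>x\<bar> * (1 / sqrt ((real i + 1) * llog (real i + 1)))" for i
        using l[of i] by (intro mult_nonneg_nonneg divide_nonneg_nonneg real_sqrt_ge_zero) auto
    qed simp
    also have "\<dots> = \<bar>x\<bar> * (\<Sum>i<Suc m. 1 / sqrt ((real i + 1) * llog (real i + 1)))"
      by (simp only: sum_distrib_left)
    also have "\<dots> \<le> \<bar>x\<bar> * (3 * sqrt (real (Suc m) / llog (real (Suc m))))"
      by (intro mult_left_mono sum_inverse_sqrt_llog_le) auto
    also have "\<dots> = \<bar>x\<bar> * (3 * (level e m / e))"
      using assms by (simp add: level_def add.commute)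
    also have "\<dots> \<le> \<bar>x\<bar> * (3 * (\<bar>x\<bar> / e))"
      using m assms by (intro mult_left_mono divide_right_mono) auto
    also have "\<dots> = 3 / e * x\<^sup>2" by (simp add: power2_eq_square)
    finally show ?thesis unfolding eq .
  qed
qed

abbreviation tail_mean :: "real \<Rightarrow> nat \<Rightarrow> real" where
  "tail_mean e i \<equiv> expectation (\<lambda>\<omega>. \<bar>tail_part e i (X i \<omega>)\<bar>)"

lemma integrable_tail_part: "integrable M (\<lambda>\<omega>. tail_part e i (X i \<omega>))"
  by (rule Bochner_Integration.integrable_bound[OF integrable_X[of i]]) (auto simp: tail_part_def)

lemma sum_expectation_tail_part_le:
  assumes "e > 0"
  shows "(\<Sum>i<n. tail_mean e i / lil_scale (real i + 1)) \<le> 3 / e"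
proof -
  have "tail_mean e i = expectation (\<lambda>\<omega>. \<bar>tail_part e i (X 0 \<omega>)\<bar>)" for i
    by (rule expectation_ident) simp
  moreover have int: "integrable M (\<lambda>\<omega>. \<bar>tail_part e i (X 0 \<omega>)\<bar>)" for i
    by (rule Bochner_Integration.integrable_bound[OF integrable_X[of 0]]) (auto simp: tail_part_def)
  ultimately have "(\<Sum>i<n. tail_mean e i / lil_scale (real i + 1))
      = expectation (\<lambda>\<omega>. \<Sum>i<n. \<bar>tail_part e i (X 0 \<omega>)\<bar> / lil_scale (real i + 1))"
    by (subst Bochner_Integration.integral_sum) auto
  also have "\<dots> \<le> expectation (\<lambda>\<omega>. 3 / e * (X 0 \<omega>)\<^sup>2)"
    using int integrable_X2[of 0]
    by (intro integral_mono Bochner_Integration.integrable_sum sum_tail_part_le[OF assms]) auto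
  also have "\<dots> = 3 / e" using second_moment by simp
  finally show ?thesis .
qed

lemma summable_expectation_tail_part:
  assumes "e > 0"
  shows "summable (\<lambda>i. tail_mean e i / lil_scale (real i + 1))"
  using sum_expectation_tail_part_le[OF assms] lil_scale_pos
  by (intro summableI_nonneg_bounded) (auto intro!: divide_nonneg_pos)

lemma AE_summable_tail_part:
  assumes "e > 0"
  shows "AE \<omega> in M. summable (\<lambda>i. \<bar>tail_part e i (X i \<omega>)\<bar> / lil_scale (real i + 1))"
proof -
  let ?f = "\<lambda>i \<omega>. \<bar>tail_part e i (X i \<omega>)\<bar> / lil_scale (real i + 1)"
  have nn: "?f i \<omega> \<ge> 0" for i \<omega> using lil_scale_pos[of "real i + 1"] by simp
  have "(\<integral>\<^sup>+\<omega>. (\<Sum>i. ennreal (?f i \<omega>)) \<partial>M) = (\<Sum>i. \<integral>\<^sup>+\<omega>. ennreal (?f i \<omega>) \<partial>M)"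
    by (rule nn_integral_suminf) measurable
  also have "\<dots> = (\<Sum>i. ennreal (expectation (?f i)))"
    using integrable_tail_part nn by (intro suminf_cong nn_integral_eq_integral) auto
  also have "\<dots> = ennreal (\<Sum>i. expectation (?f i))"
      proof (rule suminf_ennreal2)
    show "0 \<le> expectation (?f i)" for i using nn by (intro integral_nonneg_AE AE_I2)
  qed (use summable_expectation_tail_part[OF assms] in simp)
  also have "\<dots> < \<infinity>" by simp
  finally have "AE \<omega> in M. (\<Sum>i. ennreal (?f i \<omega>)) \<noteq> \<infinity>"
    by (intro nn_integral_noteq_infinite) auto
  then show ?thesis
  proof eventually_elim
    case (elim \<omega>)
    then show ?case using nn by (intro summable_suminf_not_top) auto
  qed
qed

lemma filterlim_lil_scale_Suc: "filterlim (\<lambda>n. lil_scale (real n + 1)) at_top sequentially"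
  by (rule filterlim_compose[OF lil_scale_at_top]) real_asymp

lemma expectation_tail_part_negligible:
  assumes "e > 0"
  shows "(\<lambda>n. (\<Sum>i<n. tail_mean e i) / lil_scale (real n + 1)) \<longlonglongrightarrow> 0"
  by (rule kronecker_nonneg[OF _ _ _ filterlim_lil_scale_Suc summable_expectation_tail_part[OF assms]])
     (auto intro: lil_scale_pos lil_scale_mono)

lemma AE_tail_part_negligible:
  assumes "e > 0"
  shows "AE \<omega> in M. (\<lambda>n. (\<Sum>i<n. \<bar>tail_part e i (X i \<omega>)\<bar>) / lil_scale (real n + 1)) \<longlonglongrightarrow> 0"
  using AE_summable_tail_part[OF assms]
proof eventually_elim
  case (elim \<omega>)
  show ?case
    by (rule kronecker_nonneg[OF _ _ _ filterlim_lil_scale_Suc elim])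
       (auto intro: lil_scale_pos lil_scale_mono)
qed

text \<open>A step is at most its level plus its cut-off part. The level is small on the scale, and the
  cut-off parts are summable after division by the scale.\<close>
lemma AE_increment_negligible: "AE \<omega> in M. (\<lambda>i. X i \<omega> / lil_scale (real i + 1)) \<longlonglongrightarrow> 0"
  using AE_summable_tail_part[of 1, simplified]
proof eventually_elim
  case (elim \<omega>)
  have 1: "(\<lambda>i. \<bar>tail_part 1 i (X i \<omega>)\<bar> / lil_scale (real i + 1)) \<longlonglongrightarrow> 0"
    by (rule summable_LIMSEQ_zero[OF elim])
  have 2: "(\<lambda>i. level 1 i / lil_scale (real i + 1)) \<longlonglongrightarrow> 0"
    unfolding level_def lil_scale_def llog_def by real_asymp
  show ?case
  proof (rule Lim_null_comparison[OF _ tendsto_add[OF 1 2, simplified]])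
    have "\<bar>X i \<omega>\<bar> \<le> \<bar>tail_part 1 i (X i \<omega>)\<bar> + level 1 i" for i
      using llog_ge_1[of "real i + 1"] unfolding tail_part_def by (auto simp: level_def)
    then show "\<forall>\<^sub>F i in sequentially. norm (X i \<omega> / lil_scale (real i + 1))
        \<le> \<bar>tail_part 1 i (X i \<omega>)\<bar> / lil_scale (real i + 1) + level 1 i / lil_scale (real i + 1)"
      using lil_scale_pos by (intro always_eventually allI) (simp add: add_divide_distrib[symmetric] divide_right_mono less_imp_le abs_of_pos)
  qed
qed

definition trunc :: "real \<Rightarrow> nat \<Rightarrow> real \<Rightarrow> real" where
  "trunc e i x = (if \<bar>x\<bar> \<le> level e i then x else 0)"

lemma trunc_meas[measurable]: "trunc e i \<in> borel_measurable borel"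
  unfolding trunc_def[abs_def] by measurable

lemma trunc_plus_tail_part: "trunc e i x + tail_part e i x = x"
  by (simp add: trunc_def tail_part_def)

text \<open>The truncated step is not recentred. Its mean is minus the mean of the cut-off part, so it costs at most
  the term with \<open>tail_mean\<close>, whose sum is negligible.\<close>
lemma exp_moment_trunc:
  assumes "e > 0" "l \<ge> 0"
  shows "(\<integral>\<^sup>+\<omega>. ennreal (exp (l * trunc e i (X i \<omega>) - (l * tail_mean e i
      + l\<^sup>2 / 2 * exp (l * level e i)))) \<partial>M) \<le> 1"
proof -
  let ?Y = "\<lambda>\<omega>. trunc e i (X i \<omega>)" and ?r = "tail_mean e i"
  let ?q = "l\<^sup>2 / 2 * exp (l * level e i)"
  have lev: "level e i \<ge> 0" using assms llog_ge_1[of "real i + 1"] by (simp add: level_def)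
  have Yb: "\<bar>?Y \<omega>\<bar> \<le> level e i" "\<bar>?Y \<omega>\<bar> \<le> \<bar>X i \<omega>\<bar>" for \<omega> using lev by (auto simp: trunc_def)
  have iY: "integrable M ?Y"
    by (rule Bochner_Integration.integrable_bound[OF integrable_X[of i]]) (use Yb in auto)
  have iE: "integrable M (\<lambda>\<omega>. exp (l * ?Y \<omega>))"
  proof (rule integrable_const_bound[of _ "exp (l * level e i)"])
    show "AE \<omega> in M. norm (exp (l * ?Y \<omega>)) \<le> exp (l * level e i)"
    proof (intro always_eventually allI)
      fix \<omega>
      have "l * ?Y \<omega> \<le> l * level e i"
        using abs_le_D1[OF Yb(1)[of \<omega>]] assms by (intro mult_left_mono) auto
      then show "norm (exp (l * ?Y \<omega>)) \<le> exp (l * level e i)" by simp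
    qed
  qed simp
  \<comment> \<open>In the quadratic term the truncated step may be replaced by the full one, which has second moment \<open>1\<close>.\<close>
  have "expectation (\<lambda>\<omega>. exp (l * ?Y \<omega>)) \<le> expectation (\<lambda>\<omega>. 1 + l * ?Y \<omega> + ?q * (X i \<omega>)\<^sup>2)"
  proof (intro integral_mono iE Bochner_Integration.integrable_add integrable_mult_right iY integrable_X2)
    fix \<omega>
    have "exp (l * ?Y \<omega>) \<le> 1 + l * ?Y \<omega> + (l * ?Y \<omega>)\<^sup>2 / 2 * exp \<bar>l * ?Y \<omega>\<bar>"
      by (rule exp_le_quadratic)
    also have "(l * ?Y \<omega>)\<^sup>2 / 2 * exp \<bar>l * ?Y \<omega>\<bar> \<le> (l * X i \<omega>)\<^sup>2 / 2 * exp (l * level e i)"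
    proof (intro mult_mono divide_right_mono)
      show "(l * ?Y \<omega>)\<^sup>2 \<le> (l * X i \<omega>)\<^sup>2"
        unfolding power_mult_distrib using Yb(2)[of \<omega>] by (intro mult_left_mono) (auto simp: abs_le_square_iff)
      show "exp \<bar>l * ?Y \<omega>\<bar> \<le> exp (l * level e i)"
        using Yb(1)[of \<omega>] assms by (auto simp: abs_mult intro: mult_left_mono)
    qed auto
    finally show "exp (l * ?Y \<omega>) \<le> 1 + l * ?Y \<omega> + ?q * (X i \<omega>)\<^sup>2"
      by (simp add: power_mult_distrib mult_ac)
  qed simp
  also have "\<dots> = 1 + l * expectation ?Y + ?q"
    using iY integrable_X2[of i] expectation_X2[of i]
    by (simp add: prob_space)
  also have "expectation ?Y = - expectation (\<lambda>\<omega>. tail_part e i (X i \<omega>))"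
  proof -
    have "expectation (\<lambda>\<omega>. ?Y \<omega> + tail_part e i (X i \<omega>)) = 0"
      using expectation_X[of i] by (simp add: trunc_plus_tail_part)
    then show ?thesis using iY integrable_tail_part[of e i] by simp
  qed
  also have "- expectation (\<lambda>\<omega>. tail_part e i (X i \<omega>)) \<le> ?r"
    using integral_abs_bound[of M "\<lambda>\<omega>. tail_part e i (X i \<omega>)"] by linarith
  finally have "expectation (\<lambda>\<omega>. exp (l * ?Y \<omega>)) \<le> 1 + (l * ?r + ?q)"
    using assms by (simp add: mult_left_mono)
  also have "\<dots> \<le> exp (l * ?r + ?q)" by (rule exp_ge_add_one_self)
  finally have le: "expectation (\<lambda>\<omega>. exp (l * ?Y \<omega>)) \<le> exp (l * ?r + ?q)" .
  have "(\<integral>\<^sup>+\<omega>. ennreal (exp (l * ?Y \<omega> - (l * ?r + ?q))) \<partial>M)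
      = (\<integral>\<^sup>+\<omega>. ennreal (exp (l * ?Y \<omega>)) * ennreal (exp (- (l * ?r + ?q))) \<partial>M)"
    by (simp add: ennreal_mult'[symmetric] exp_add[symmetric] algebra_simps)
  also have "\<dots> = ennreal (expectation (\<lambda>\<omega>. exp (l * ?Y \<omega>))) * ennreal (exp (- (l * ?r + ?q)))"
    using iE by (simp add: nn_integral_multc nn_integral_eq_integral)
  also have "\<dots> \<le> ennreal (exp (l * ?r + ?q)) * ennreal (exp (- (l * ?r + ?q)))"
    using le by (intro mult_right_mono ennreal_leI) auto
  also have "\<dots> = 1" by (simp add: ennreal_mult'[symmetric] exp_add[symmetric])
  finally show ?thesis .
qed

text \<open>The exponential parameter is \<open>l = sqrt (2 llog N / N)\<close>, the minimiser of the Gaussian exponent at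
  the level \<open>lil_scale N\<close>.\<close>
lemma prob_max_trunc_le:
  assumes e: "e > 0" and N: "N > 0"
  shows "prob {\<omega>\<in>space M. \<exists>m\<le>N. (\<Sum>k<m. trunc e k (X k \<omega>)) \<ge> \<alpha> * lil_scale N}
    \<le> exp (- llog N * (2 * \<alpha> - exp (e * sqrt 2)
         - 2 * ((\<Sum>k<N. tail_mean e k) / lil_scale N)))"
proof -
  let ?r = "\<lambda>k. tail_mean e k"
  define l where "l = sqrt (2 * llog N / N)"
  have L: "llog N \<ge> 1" by (rule llog_ge_1) simp
  have l0: "l \<ge> 0" unfolding l_def using L by simp
  have l2: "l\<^sup>2 = 2 * llog N / N" unfolding l_def using L by (subst real_sqrt_pow2) auto
  have lsc: "l * lil_scale N = 2 * llog N"
  proof -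
    have "l * lil_scale N = sqrt ((2 * llog N)\<^sup>2)"
      unfolding l_def lil_scale_def real_sqrt_mult[symmetric] using N by (simp add: power2_eq_square)
    then show ?thesis using L unfolding real_sqrt_abs by linarith
  qed
  have scp: "lil_scale N > 0" using N by (intro lil_scale_pos) simp
  have llev: "l * level e k \<le> e * sqrt 2" if "k < N" for k
  proof -
    have "l * level e k \<le> l * level e (N - 1)" using that e l0 by (intro mult_left_mono level_mono) auto
    also have "\<dots> = e * (l * sqrt (real N / llog N))" unfolding level_def using N by (simp add: of_nat_diff)
    also have "l * sqrt (real N / llog N) = sqrt 2"
      unfolding l_def real_sqrt_mult[symmetric] using N L by simp
    finally show ?thesis .
  qed
  define f where "f k = (\<lambda>(w::nat \<Rightarrow> real) v. l * trunc e k v - (l * ?r k + l\<^sup>2 / 2 * exp (l * level e k)))" for k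
  have V: "prob {\<omega>\<in>space M. \<exists>m\<le>N. (\<Sum>k<m. f k (\<lambda>i\<in>{..<k}. X i \<omega>) (X k \<omega>)) \<ge> a} \<le> exp (- a)" for a
  proof (rule exp_maximal_inequality[OF indep])
    show "(\<lambda>(w, v). f k w v) \<in> borel_measurable (PiM {..<k} (\<lambda>_. borel) \<Otimes>\<^sub>M borel)" for k
      unfolding f_def by measurable
    show "(\<integral>\<^sup>+\<omega>. ennreal (exp (f k w (X k \<omega>))) \<partial>M) \<le> 1" for k w
      unfolding f_def using exp_moment_trunc[OF e l0, of k] by simp
  qed
  let ?c = "l * (\<Sum>k<N. ?r k) + llog N * exp (e * sqrt 2)"
  have comp: "(\<Sum>k<m. l * ?r k + l\<^sup>2 / 2 * exp (l * level e k)) \<le> ?c" if "m \<le> N" for m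
  proof -
    have "(\<Sum>k<m. l * ?r k + l\<^sup>2 / 2 * exp (l * level e k)) \<le> (\<Sum>k<N. l * ?r k + l\<^sup>2 / 2 * exp (l * level e k))"
      using that l0 by (intro sum_mono2) auto
    also have "\<dots> \<le> (\<Sum>k<N. l * ?r k + l\<^sup>2 / 2 * exp (e * sqrt 2))"
      using llev by (intro sum_mono add_left_mono mult_left_mono) auto
    also have "\<dots> = ?c" using N by (simp add: sum.distrib sum_distrib_left l2)
    finally show ?thesis .
  qed
  have "prob {\<omega>\<in>space M. \<exists>m\<le>N. (\<Sum>k<m. trunc e k (X k \<omega>)) \<ge> \<alpha> * lil_scale N}
      \<le> prob {\<omega>\<in>space M. \<exists>m\<le>N. (\<Sum>k<m. f k (\<lambda>i\<in>{..<k}. X i \<omega>) (X k \<omega>)) \<ge> l * (\<alpha> * lil_scale N) - ?c}"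
  proof (intro finite_measure_mono subsetI)
    fix \<omega> assume "\<omega> \<in> {\<omega>\<in>space M. \<exists>m\<le>N. (\<Sum>k<m. trunc e k (X k \<omega>)) \<ge> \<alpha> * lil_scale N}"
    then obtain m where m: "\<omega> \<in> space M" "m \<le> N" "(\<Sum>k<m. trunc e k (X k \<omega>)) \<ge> \<alpha> * lil_scale N" by auto
    have "l * (\<alpha> * lil_scale N) - ?c \<le> l * (\<Sum>k<m. trunc e k (X k \<omega>)) - (\<Sum>k<m. l * ?r k + l\<^sup>2 / 2 * exp (l * level e k))"
      using mult_left_mono[OF m(3) l0] comp[OF m(2)] by linarith
    also have "\<dots> = (\<Sum>k<m. f k (\<lambda>i\<in>{..<k}. X i \<omega>) (X k \<omega>))"
      by (simp add: f_def sum_subtractf sum_distrib_left)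
    finally show "\<omega> \<in> {\<omega>\<in>space M. \<exists>m\<le>N. (\<Sum>k<m. f k (\<lambda>i\<in>{..<k}. X i \<omega>) (X k \<omega>)) \<ge> l * (\<alpha> * lil_scale N) - ?c}"
      using m by blast
  qed (simp add: f_def)
  also have "\<dots> \<le> exp (- (l * (\<alpha> * lil_scale N) - ?c))" by (rule V)
  also have "- (l * (\<alpha> * lil_scale N) - ?c) = - llog N * (2 * \<alpha> - exp (e * sqrt 2)
         - 2 * ((\<Sum>k<N. ?r k) / lil_scale N))"
  proof -
    have "l = 2 * llog N / lil_scale N" using lsc scp by (simp add: field_simps)
    then have 1: "l * (\<Sum>k<N. ?r k) = llog N * (2 * ((\<Sum>k<N. ?r k) / lil_scale N))" by simp
    have 2: "l * (\<alpha> * lil_scale N) = llog N * (2 * \<alpha>)"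
      using arg_cong[OF lsc, of "\<lambda>z. \<alpha> * z"] by (simp only: mult_ac)
    show ?thesis unfolding 1 2 by (simp add: algebra_simps)
  qed
  finally show ?thesis .
qed

end

section \<open>The upper half of the law of the iterated logarithm\<close>

context standard_iid
begin

text \<open>For small \<open>e\<close> the exponent in the maximal inequality is close to \<open>2 \<alpha> - 1\<close>, hence larger
  than \<open>\<alpha>\<close>; this leaves room for the negligible tail means.\<close>
lemma prob_max_trunc_eventually_le:
  assumes \<alpha>: "\<alpha> > 1"
  obtains e where "e > 0" "\<forall>\<^sub>F N in sequentially.
    prob {\<omega>\<in>space M. \<exists>m\<le>N. (\<Sum>k<m. trunc e k (X k \<omega>)) \<ge> \<alpha> * lil_scale N} \<le> ln (real N + 27) powr (- \<alpha>)"
proof -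
  \<comment> \<open>With this \<open>e\<close> the exponent is \<open>2 \<alpha> - (1 + \<kappa>) = \<alpha> + \<kappa>\<close> before the tail means, which cost at most \<open>\<kappa>\<close>.\<close>
  define \<kappa> where "\<kappa> = (\<alpha> - 1) / 2"
  have \<kappa>: "\<alpha> = 1 + 2 * \<kappa>" "\<kappa> > 0" using \<alpha> by (auto simp: \<kappa>_def field_simps)
  define e where "e = ln (1 + \<kappa>) / sqrt 2"
  have e: "e > 0" "exp (e * sqrt 2) = 1 + \<kappa>"
    using \<kappa> by (auto simp: e_def)
  define \<rho> where "\<rho> N = (\<Sum>k<N. tail_mean e k) / lil_scale (real N)" for N
  have "\<rho> \<longlonglongrightarrow> 0"
  proof -
    have "(\<lambda>n. lil_scale (real n + 1) / lil_scale (real n)) \<longlonglongrightarrow> 1"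
      unfolding lil_scale_def llog_def by real_asymp
    from tendsto_mult[OF expectation_tail_part_negligible[OF e(1)] this]
    have "(\<lambda>n. (\<Sum>i<n. tail_mean e i) / lil_scale (real n + 1) *
          (lil_scale (real n + 1) / lil_scale (real n))) \<longlonglongrightarrow> 0"
      by simp
    moreover have "(\<Sum>i<n. tail_mean e i) / lil_scale (real n + 1) *
          (lil_scale (real n + 1) / lil_scale (real n)) = \<rho> n" for n
      using lil_scale_pos[of "real n + 1"] by (simp add: \<rho>_def less_imp_neq[symmetric])
    ultimately show ?thesis by simp
  qed
  then have "\<forall>\<^sub>F N in sequentially. \<rho> N < \<kappa> / 2"
    using \<kappa>(2) by (intro order_tendstoD) auto
  then have "\<forall>\<^sub>F N in sequentially.
    prob {\<omega>\<in>space M. \<exists>m\<le>N. (\<Sum>k<m. trunc e k (X k \<omega>)) \<ge> \<alpha> * lil_scale N} \<le> ln (real N + 27) powr (- \<alpha>)"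
    using eventually_gt_at_top[of 0]
  proof eventually_elim
    case (elim N)
    have "prob {\<omega>\<in>space M. \<exists>m\<le>N. (\<Sum>k<m. trunc e k (X k \<omega>)) \<ge> \<alpha> * lil_scale N}
      \<le> exp (- llog N * (2 * \<alpha> - exp (e * sqrt 2) - 2 * \<rho> N))"
      unfolding \<rho>_def by (rule prob_max_trunc_le[OF e(1) elim(2)])
    also have "\<dots> \<le> exp (- llog N * \<alpha>)"
    proof -
      have "llog N * \<alpha> \<le> llog N * (2 * \<alpha> - exp (e * sqrt 2) - 2 * \<rho> N)"
        using elim e(2) \<kappa> llog_ge_1[of N] by (intro mult_left_mono) auto
      then show ?thesis by simp
    qed
    also have "\<dots> = ln (real N + 27) powr (- \<alpha>)"
      unfolding llog_def powr_def using ln_27_ge[of N] by (auto simp: mult.commute)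
    finally show ?case .
  qed
  with e(1) show ?thesis by (rule that)
qed

text \<open>Along \<open>n\<^sub>k \<approx> \<alpha>\<^sup>k\<close> the bound is of order \<open>k\<close> to the power \<open>- \<alpha>\<close>, which is summable. Between two such indices
  the scale grows by a factor of about \<open>sqrt \<alpha>\<close>, absorbed by the second factor \<open>\<alpha>\<close>.\<close>
lemma trunc_sum_upper:
  assumes \<alpha>: "\<alpha> > 1"
  obtains e where "e > 0" "AE \<omega> in M. \<forall>\<^sub>F m in sequentially. (\<Sum>k<m. trunc e k (X k \<omega>)) \<le> \<alpha>\<^sup>2 * lil_scale m"
proof -
  obtain e where e: "e > 0" "\<forall>\<^sub>F N in sequentially.
    prob {\<omega>\<in>space M. \<exists>m\<le>N. (\<Sum>k<m. trunc e k (X k \<omega>)) \<ge> \<alpha> * lil_scale (real N)} \<le> ln (real N + 27) powr (- \<alpha>)"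
    using prob_max_trunc_eventually_le[OF \<alpha>] by blast
  define n where "n k = nat \<lceil>\<alpha> ^ k\<rceil>" for k
  have n: "\<alpha> ^ k \<le> real (n k)" "real (n k) < \<alpha> ^ k + 1" for k
    using \<alpha> zero_le_power[of \<alpha> k] unfolding n_def by linarith+
  have n_lim: "filterlim n at_top sequentially"
  proof -
    have "filterlim (\<lambda>k. \<alpha> ^ k) at_top sequentially"
      using \<alpha> by real_asymp
    then have "filterlim (\<lambda>k. real (n k)) at_top sequentially"
      by (rule filterlim_at_top_mono) (use n in auto)
    then show ?thesis by (simp add: filterlim_sequentially_iff_filterlim_real)
  qed
  define A where "A k = {\<omega>\<in>space M. \<exists>m\<le>n k. (\<Sum>i<m. trunc e i (X i \<omega>)) \<ge> \<alpha> * lil_scale (real (n k))}" for k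
  have A_sets: "A k \<in> sets M" for k unfolding A_def by measurable
  have "\<forall>\<^sub>F k in sequentially. prob (A k) \<le> (ln \<alpha>) powr (- \<alpha>) * real k powr (- \<alpha>)"
    using filterlim_iff[THEN iffD1, OF n_lim, rule_format, OF e(2)] eventually_gt_at_top[of 0]
  proof eventually_elim
    case (elim k)
    have "prob (A k) \<le> ln (real (n k) + 27) powr (- \<alpha>)" using elim unfolding A_def by simp
    also have "\<dots> \<le> (real k * ln \<alpha>) powr (- \<alpha>)"
    proof -
      have "real k * ln \<alpha> = ln (\<alpha> ^ k)" using \<alpha> by (simp add: ln_realpow)
      also have "\<dots> \<le> ln (real (n k) + 27)"
        using \<alpha> n(1)[of k] by (intro ln_mono) (auto intro: less_le_trans[OF zero_less_power])
      finally show ?thesis using \<alpha> elim by (intro powr_mono2') auto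
    qed
    also have "\<dots> = (ln \<alpha>) powr (- \<alpha>) * real k powr (- \<alpha>)" using \<alpha> by (simp add: powr_mult)
    finally show ?case .
  qed
  then have ev: "\<forall>\<^sub>F k in sequentially. norm (prob (A k)) \<le> (ln \<alpha>) powr (- \<alpha>) * real k powr (- \<alpha>)"
    by simp
  have "summable (\<lambda>k. (ln \<alpha>) powr (- \<alpha>) * real k powr (- \<alpha>))"
    using \<alpha> by (intro summable_mult) (simp add: summable_real_powr_iff)
  then have "summable (\<lambda>k. prob (A k))"
    by (rule summable_comparison_test_ev[OF ev])
  then have ae: "AE \<omega> in M. \<forall>\<^sub>F k in sequentially. \<omega> \<in> space M - A k"
    using A_sets by (intro borel_cantelli_AE1) (auto simp: emeasure_eq_measure)
  have sc: "\<forall>\<^sub>F m in sequentially. lil_scale (\<alpha> * real m + 1) \<le> \<alpha> * lil_scale (real m)"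
  proof -
    have "(\<lambda>m. lil_scale (\<alpha> * real m + 1) / lil_scale (real m)) \<longlonglongrightarrow> (2 * \<alpha>) powr (1 / 2) * inverse (2 powr (1 / 2))"
      unfolding lil_scale_def llog_def using \<alpha> by real_asymp
    moreover have "(2 * \<alpha>) powr (1 / 2) * inverse (2 powr (1 / 2)) = sqrt \<alpha>"
      using \<alpha> by (simp add: powr_half_sqrt real_sqrt_mult)
    ultimately have "(\<lambda>m. lil_scale (\<alpha> * real m + 1) / lil_scale (real m)) \<longlonglongrightarrow> sqrt \<alpha>"
      by simp
    moreover have "sqrt \<alpha> < \<alpha>" using \<alpha> by (simp add: real_less_lsqrt power2_eq_square)
    ultimately have "\<forall>\<^sub>F m in sequentially. lil_scale (\<alpha> * real m + 1) / lil_scale (real m) < \<alpha>"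
      by (intro order_tendstoD) auto
    then show ?thesis using eventually_gt_at_top[of 0]
    proof eventually_elim
      case (elim m)
      then show ?case using lil_scale_pos[of "real m"] by (simp add: field_simps)
    qed
  qed
  from ae have "AE \<omega> in M. \<forall>\<^sub>F m in sequentially. (\<Sum>k<m. trunc e k (X k \<omega>)) \<le> \<alpha>\<^sup>2 * lil_scale m"
  proof eventually_elim
    case (elim \<omega>)
    \<comment> \<open>The exponent of the least power of \<open>\<alpha>\<close> that is at least \<open>m\<close>; this power is smaller than \<open>\<alpha> m\<close>.\<close>
    let ?k = "\<lambda>m. nat \<lceil>log \<alpha> (real m)\<rceil>"
    have "filterlim ?k at_top sequentially"
      using \<alpha> by real_asymp
    from filterlim_iff[THEN iffD1, OF this, rule_format, OF elim] sc eventually_gt_at_top[of 0]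
    show ?case
    proof eventually_elim
      case (elim m)
      have k: "real (?k m) = \<lceil>log \<alpha> (real m)\<rceil>" using \<alpha> elim by simp
      have "real m = \<alpha> powr log \<alpha> (real m)" using \<alpha> elim by simp
      also have "\<dots> \<le> \<alpha> powr real (?k m)" using \<alpha> k by (intro powr_mono) auto
      also have "\<dots> = \<alpha> ^ ?k m" using \<alpha> by (simp add: powr_realpow)
      also have "\<dots> \<le> real (n (?k m))" by (rule n)
      finally have mle: "m \<le> n (?k m)" by simp
      have "\<alpha> ^ ?k m = \<alpha> powr real (?k m)" using \<alpha> by (simp add: powr_realpow)
      also have "\<dots> \<le> \<alpha> powr (log \<alpha> (real m) + 1)" using \<alpha> k by (intro powr_mono) linarith+
      also have "\<dots> = \<alpha> * real m" using \<alpha> elim by (simp add: powr_add)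
      finally have nle: "real (n (?k m)) \<le> \<alpha> * real m + 1" using n(2)[of "?k m"] by linarith
      have "(\<Sum>k<m. trunc e k (X k \<omega>)) < \<alpha> * lil_scale (real (n (?k m)))"
        using elim(1) mle unfolding A_def by (simp add: not_le) (meson leD)
      also have "\<dots> \<le> \<alpha> * lil_scale (\<alpha> * real m + 1)"
        using \<alpha> nle by (intro mult_left_mono lil_scale_mono) auto
      also have "\<dots> \<le> \<alpha> * (\<alpha> * lil_scale (real m))"
        using \<alpha> elim by (intro mult_left_mono) auto
      finally show ?case by (simp add: power2_eq_square mult.assoc)
    qed
  qed
  with e(1) show ?thesis by (rule that)
qed

theorem lil_upper:
  assumes "\<delta> > 0"
  shows "AE \<omega> in M. \<forall>\<^sub>F n in sequentially. (\<Sum>i<n. X i \<omega>) \<le> (1 + \<delta>) * lil_scale n"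
proof -
  define \<alpha> where "\<alpha> = sqrt (1 + \<delta> / 2)"
  have \<alpha>: "\<alpha> > 1" "\<alpha>\<^sup>2 = 1 + \<delta> / 2" using assms by (auto simp: \<alpha>_def)
  obtain e where e: "e > 0"
    and T: "AE \<omega> in M. \<forall>\<^sub>F m in sequentially. (\<Sum>k<m. trunc e k (X k \<omega>)) \<le> \<alpha>\<^sup>2 * lil_scale m"
    using trunc_sum_upper[OF \<alpha>(1)] by blast
  have lim: "(\<lambda>n. lil_scale (real n + 1) / lil_scale (real n)) \<longlonglongrightarrow> 1"
    unfolding lil_scale_def llog_def by real_asymp
  show ?thesis
    using T AE_tail_part_negligible[OF e]
  proof eventually_elim
    case (elim \<omega>)
    have "(\<lambda>n. (\<Sum>i<n. \<bar>tail_part e i (X i \<omega>)\<bar>) / lil_scale (real n + 1) *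
        (lil_scale (real n + 1) / lil_scale (real n))) \<longlonglongrightarrow> 0"
      using tendsto_mult[OF elim(2) lim] by simp
    then have "\<forall>\<^sub>F n in sequentially. (\<Sum>i<n. \<bar>tail_part e i (X i \<omega>)\<bar>) / lil_scale (real n + 1) *
        (lil_scale (real n + 1) / lil_scale (real n)) < \<delta> / 2"
      using assms by (intro order_tendstoD) auto
    then show ?case using elim(1) eventually_gt_at_top[of 0]
    proof eventually_elim
      case (elim n)
      have p: "lil_scale (real n + 1) > 0" "lil_scale (real n) > 0" using elim by (auto intro: lil_scale_pos)
      then have "(\<Sum>i<n. \<bar>tail_part e i (X i \<omega>)\<bar>) < \<delta> / 2 * lil_scale (real n)"
        using elim(1) by (simp add: field_simps)
      moreover have "(\<Sum>i<n. tail_part e i (X i \<omega>)) \<le> (\<Sum>i<n. \<bar>tail_part e i (X i \<omega>)\<bar>)"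
        by (intro sum_mono) simp
      moreover have "(\<Sum>i<n. X i \<omega>) = (\<Sum>i<n. trunc e i (X i \<omega>)) + (\<Sum>i<n. tail_part e i (X i \<omega>))"
        by (simp add: sum.distrib[symmetric] trunc_plus_tail_part)
      ultimately show ?case using elim(2) \<alpha>(2) by (simp add: algebra_simps)
    qed
  qed
qed

end

section \<open>Second Borel--Cantelli lemma and Gaussian lower bounds for block sums\<close>

text \<open>If the events from \<open>m\<close> on failed with positive probability, independence and \<open>1 - p \<le> exp (- p)\<close> would bound
  the partial sums of the probabilities.\<close>
lemma (in prob_space) borel_cantelli_2:
  assumes ind: "indep_vars N Y UNIV" and E: "\<And>k::nat. E k \<in> sets (N k)"
    and div: "\<not> summable (\<lambda>k. prob {\<omega>\<in>space M. Y k \<omega> \<in> E k})"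
  shows "AE \<omega> in M. \<exists>\<^sub>F k in sequentially. Y k \<omega> \<in> E k"
proof -
  let ?p = "\<lambda>k. prob {\<omega>\<in>space M. Y k \<omega> \<in> E k}"
  have Y[measurable]: "random_variable (N k) (Y k)" for k
    using ind unfolding indep_vars_def by auto
  note E[measurable]
  have "AE \<omega> in M. \<exists>k\<ge>m. Y k \<omega> \<in> E k" for m
  proof -
    let ?B = "{\<omega>\<in>space M. \<forall>k\<ge>m. Y k \<omega> \<notin> E k}"
    have le: "prob ?B \<le> exp (- (\<Sum>k<n. ?p (k + m)))" for n
    proof (cases "n = 0")
      case False
      let ?J = "{m..<n + m}"
      have "prob ?B \<le> prob (\<Inter>k\<in>?J. Y k -` (space (N k) - E k) \<inter> space M)"
        using False by (intro finite_measure_mono) (auto intro: measurable_space[OF Y])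
      also have "\<dots> = (\<Prod>k\<in>?J. prob (Y k -` (space (N k) - E k) \<inter> space M))"
        using False E by (intro indep_varsD[OF ind]) auto
      also have "\<dots> = (\<Prod>k\<in>?J. 1 - ?p k)"
      proof (intro prod.cong refl)
        fix k
        have "Y k -` (space (N k) - E k) \<inter> space M = space M - {\<omega>\<in>space M. Y k \<omega> \<in> E k}"
          using measurable_space[OF Y] by auto
        then show "prob (Y k -` (space (N k) - E k) \<inter> space M) = 1 - ?p k"
          by (simp add: prob_compl)
      qed
      also have "\<dots> \<le> (\<Prod>k\<in>?J. exp (- ?p k))"
        using exp_ge_add_one_self by (intro prod_mono) (auto simp: add.commute intro!: order_trans[OF _ exp_ge_add_one_self])
      also have "\<dots> = exp (- (\<Sum>k\<in>?J. ?p k))"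
        by (simp add: exp_sum sum_negf[symmetric])
      also have "(\<Sum>k\<in>?J. ?p k) = (\<Sum>k<n. ?p (k + m))"
        using sum.shift_bounds_nat_ivl[of ?p 0 m n] by (simp add: atLeast0LessThan)
      finally show ?thesis .
    qed simp
    have "prob ?B \<le> 0"
    proof (rule ccontr)
      assume "\<not> prob ?B \<le> 0"
      then have pos: "prob ?B > 0" by simp
      have "(\<Sum>k<n. ?p (k + m)) \<le> - ln (prob ?B)" for n
        using le[of n] pos by (simp add: ln_le_cancel_iff[symmetric, of "prob ?B" "exp _"] del: ln_le_cancel_iff) 
      then have "summable (\<lambda>k. ?p (k + m))"
        by (intro summableI_nonneg_bounded) auto
      then show False using div summable_iff_shift[of ?p m] by simp
    qed
    then have "prob ?B = 0" by (simp add: measure_le_0_iff)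
    then show ?thesis
      by (intro AE_I[of _ _ ?B]) (auto simp: emeasure_eq_measure)
  qed
  then have "AE \<omega> in M. \<forall>m. \<exists>k\<ge>m. Y k \<omega> \<in> E k"
    by (simp add: AE_all_countable)
  then show ?thesis
    by (rule AE_mp) (auto simp: frequently_def eventually_sequentially)
qed

lemma (in prob_space) indep_vars_block_sums:
  fixes X :: "'i \<Rightarrow> 'a \<Rightarrow> real"
  assumes ind: "indep_vars (\<lambda>_. borel) X UNIV" and B: "disjoint_family_on B L"
  shows "indep_vars (\<lambda>_. borel) (\<lambda>j \<omega>. \<Sum>i\<in>B j. X i \<omega>) L"
proof -
  have "indep_vars (\<lambda>_. borel) (\<lambda>j \<omega>. \<Sum>i\<in>B j. (\<lambda>i\<in>B j. X i \<omega>) i) L"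
    by (rule indep_vars_compose2[OF indep_vars_restrict[OF ind _ B]]) auto
  then show ?thesis by simp
qed

text \<open>The tail is at least the mass of the unit interval above \<open>x\<close>, on which the density is smallest
  at \<open>x + 1\<close>; and \<open>sqrt (2 pi) < 4\<close>.\<close>
lemma std_normal_upper_tail:
  assumes "x \<ge> 0"
  shows "exp (- (x + 1)\<^sup>2 / 2) / 4 < 1 - cdf std_normal_distribution x"
proof -
  interpret N: real_distribution std_normal_distribution by (rule real_dist_normal_dist)
  let ?c = "exp (- (x + 1)\<^sup>2 / 2) / sqrt (2 * pi)"
  have "sqrt (2 * pi) < sqrt (4 * 4)" using pi_less_4 by (intro real_sqrt_less_mono) simp
  then have "sqrt (2 * pi) < 4" by simp
  moreover have "sqrt (2 * pi) > 0" by simp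
  ultimately have "exp (- (x + 1)\<^sup>2 / 2) / 4 < ?c"
    by (intro divide_strict_left_mono) auto
  also have "?c \<le> N.prob {x<..x+1}"
  proof -
    have "ennreal ?c = (\<integral>\<^sup>+y. ennreal ?c * indicator {x<..x+1} y \<partial>lborel)"
      by (subst nn_integral_cmult_indicator) auto
    also have "\<dots> \<le> (\<integral>\<^sup>+y. ennreal (std_normal_density y) * indicator {x<..x+1} y \<partial>lborel)"
    proof (intro nn_integral_mono)
      fix y
      show "ennreal ?c * indicator {x<..x+1} y \<le> ennreal (std_normal_density y) * indicator {x<..x+1} y"
      proof (cases "y \<in> {x<..x+1}")
        case True
        then have "y\<^sup>2 \<le> (x + 1)\<^sup>2" using assms by (intro power_mono) auto
        then have "?c \<le> std_normal_density y"
          unfolding std_normal_density_def by (simp add: divide_right_mono)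
        then show ?thesis using True by (simp add: ennreal_leI)
      qed simp
    qed
    also have "\<dots> = emeasure std_normal_distribution {x<..x+1}"
      by (subst emeasure_density) auto
    finally show ?thesis by (simp add: N.emeasure_eq_measure)
  qed
  also have "\<dots> \<le> N.prob {x<..}" by (intro N.finite_measure_mono) auto
  also have "{x<..} = space std_normal_distribution - {..x}" by auto
  also have "N.prob \<dots> = 1 - cdf std_normal_distribution x"
    unfolding cdf_def by (rule N.prob_compl) auto
  finally show ?thesis .
qed

context standard_iid
begin

text \<open>Both sums have the same characteristic function, a power of that of a single step.\<close>
lemma distr_sum_card:
  assumes "finite A"
  shows "distr M borel (\<lambda>\<omega>. \<Sum>i\<in>A. X i \<omega>) = distr M borel (\<lambda>\<omega>. \<Sum>i<card A. X i \<omega>)"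
proof (rule Levy_uniqueness)
  have "char (distr M borel (\<lambda>\<omega>. \<Sum>i\<in>B. X i \<omega>)) t = char (distr M borel (X 0)) t ^ card B" for t and B :: "nat set"
  proof -
    have "(\<Prod>i\<in>B. char (distr M borel (X i)) t) = (\<Prod>i\<in>B. char (distr M borel (X 0)) t)"
      by (intro prod.cong refl) (metis ident)
    then show ?thesis using char_distr_sum[OF indep_vars_subset[OF indep, of B], of t] by simp
  qed
  then show "char (distr M borel (\<lambda>\<omega>. \<Sum>i\<in>A. X i \<omega>)) = char (distr M borel (\<lambda>\<omega>. \<Sum>i<card A. X i \<omega>))"
    by (simp add: fun_eq_iff)
qed (auto intro!: real_distribution_distr)

lemma prob_sum_gt_eventually:
  assumes "x \<ge> 0"
  shows "\<forall>\<^sub>F n in sequentially. exp (- (x + 1)\<^sup>2 / 2) / 4 < prob {\<omega>\<in>space M. x * sqrt n < (\<Sum>i<n. X i \<omega>)}"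
proof -
  interpret N: real_distribution std_normal_distribution by (rule real_dist_normal_dist)
  have "weak_conv_m (\<lambda>n. distr M borel (\<lambda>\<omega>. (\<Sum>i<n. X i \<omega>) / sqrt (real n * 1\<^sup>2))) std_normal_distribution"
  proof (rule central_limit_theorem_zero_mean[OF indep expectation_X _ integrable_X2 _ ident])
    show "variance (X n) = 1\<^sup>2" for n using expectation_X expectation_X2 by simp
  qed simp
  moreover have "isCont (cdf std_normal_distribution) x"
  proof -
    have "emeasure std_normal_distribution {x} = 0"
      by (subst emeasure_density) (auto simp: nn_integral_0_iff_AE intro!: AE_I'[of "{x}"])
    then show ?thesis by (simp add: N.isCont_cdf N.emeasure_eq_measure)
  qed
  ultimately have "(\<lambda>n. cdf (distr M borel (\<lambda>\<omega>. (\<Sum>i<n. X i \<omega>) / sqrt (real n * 1\<^sup>2))) x)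
      \<longlonglongrightarrow> cdf std_normal_distribution x"
    unfolding weak_conv_m_def weak_conv_def by blast
  then have "(\<lambda>n. 1 - cdf (distr M borel (\<lambda>\<omega>. (\<Sum>i<n. X i \<omega>) / sqrt (real n * 1\<^sup>2))) x)
      \<longlonglongrightarrow> 1 - cdf std_normal_distribution x"
    by (intro tendsto_intros)
  from order_tendstoD(1)[OF this std_normal_upper_tail[OF assms]] eventually_gt_at_top[of 0]
  show ?thesis
  proof eventually_elim
    case (elim n)
    have "cdf (distr M borel (\<lambda>\<omega>. (\<Sum>i<n. X i \<omega>) / sqrt (real n * 1\<^sup>2))) x
        = prob {\<omega>\<in>space M. (\<Sum>i<n. X i \<omega>) / sqrt (real n * 1\<^sup>2) \<le> x}"
      unfolding cdf_def by (subst measure_distr) (auto intro!: arg_cong[where f=prob])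
    also have "1 - \<dots> = prob (space M - {\<omega>\<in>space M. (\<Sum>i<n. X i \<omega>) / sqrt (real n * 1\<^sup>2) \<le> x})"
      by (rule prob_compl[symmetric]) measurable
    also have "space M - {\<omega>\<in>space M. (\<Sum>i<n. X i \<omega>) / sqrt (real n * 1\<^sup>2) \<le> x}
        = {\<omega>\<in>space M. x * sqrt n < (\<Sum>i<n. X i \<omega>)}"
      using elim(2) by (auto simp: field_simps)
    finally show ?case using elim(1) by simp
  qed
qed

lemma prob_block_sum_gt:
  assumes "finite A"
  shows "prob {\<omega>\<in>space M. a < (\<Sum>i\<in>A. X i \<omega>)} = prob {\<omega>\<in>space M. a < (\<Sum>i<card A. X i \<omega>)}"
proof -
  have "measure (distr M borel (\<lambda>\<omega>. \<Sum>i\<in>B. X i \<omega>)) {a<..} = prob {\<omega>\<in>space M. a < (\<Sum>i\<in>B. X i \<omega>)}"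
    for B :: "nat set"
    by (subst measure_distr) (auto intro!: arg_cong[where f=prob])
  from this[of A] this[of "{..<card A}"] show ?thesis
    using distr_sum_card[OF assms] by simp
qed

lemma prob_all_blocks_ge:
  assumes r: "r > 0" and p: "p > 0" "p \<le> prob {\<omega>\<in>space M. a < (\<Sum>i<q. X i \<omega>)}"
  shows "p ^ r \<le> prob {\<omega>\<in>space M. \<forall>j<r. a < (\<Sum>i\<in>{n + j * q..<n + Suc j * q}. X i \<omega>)}"
proof -
  let ?B = "\<lambda>j. {n + j * q..<n + Suc j * q}"
  have "disjoint_family_on ?B {..<r}"
  proof (unfold disjoint_family_on_def, intro ballI impI)
    fix i j :: nat assume "i \<noteq> j"
    have *: "?B i \<inter> ?B j = {}" if "i < j" for i j
    proof -
      have "Suc i * q \<le> j * q" using that by (intro mult_le_mono1) simp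
      then show ?thesis by auto
    qed
    show "?B i \<inter> ?B j = {}" using *[of i j] *[of j i] \<open>i \<noteq> j\<close> by (cases i j rule: linorder_cases) auto
  qed
  from indep_vars_block_sums[OF indep this]
  have "prob (\<Inter>j\<in>{..<r}. (\<lambda>\<omega>. \<Sum>i\<in>?B j. X i \<omega>) -` {a<..} \<inter> space M)
      = (\<Prod>j<r. prob ((\<lambda>\<omega>. \<Sum>i\<in>?B j. X i \<omega>) -` {a<..} \<inter> space M))"
    using r by (intro indep_varsD) auto
  also have "\<dots> = (\<Prod>j<r. prob {\<omega>\<in>space M. a < (\<Sum>i<q. X i \<omega>)})"
  proof (intro prod.cong refl)
    fix j
    have "(\<lambda>\<omega>. \<Sum>i\<in>?B j. X i \<omega>) -` {a<..} \<inter> space M = {\<omega>\<in>space M. a < (\<Sum>i\<in>?B j. X i \<omega>)}" by auto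
    then show "prob ((\<lambda>\<omega>. \<Sum>i\<in>?B j. X i \<omega>) -` {a<..} \<inter> space M) = prob {\<omega>\<in>space M. a < (\<Sum>i<q. X i \<omega>)}"
      using prob_block_sum_gt[of "?B j" a] by simp
  qed
  also have "\<dots> \<ge> p ^ r" using p by (simp add: power_mono)
  also have "(\<Inter>j\<in>{..<r}. (\<lambda>\<omega>. \<Sum>i\<in>?B j. X i \<omega>) -` {a<..} \<inter> space M)
      = {\<omega>\<in>space M. \<forall>j<r. a < (\<Sum>i\<in>?B j. X i \<omega>)}" using r by auto
  finally show ?thesis .
qed

end

section \<open>The lower half of the law of the iterated logarithm\<close>

lemma frequently_and_eventually:
  "frequently P F \<Longrightarrow> eventually Q F \<Longrightarrow> frequently (\<lambda>x. P x \<and> Q x) F"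
  by (subst conj_commute) (rule frequently_eventually_conj)

context standard_iid
begin

lemma sum_ge_neg_two_lil_scale:
  "AE \<omega> in M. \<forall>\<^sub>F n in sequentially. - 2 * lil_scale n \<le> (\<Sum>i<n. X i \<omega>)"
proof -
  interpret neg: standard_iid M "\<lambda>i \<omega>. - X i \<omega>" by (rule standard_iid_uminus)
  show ?thesis using neg.lil_upper[of 1] by (simp add: sum_negf minus_le_iff)
qed

text \<open>The exponent \<open>(x + 1)\<^sup>2 / 2 + ln 4\<close> of the lower bound for a Gaussian tail is asymptotic to \<open>x\<^sup>2 / 2\<close>;
  a factor \<open>\<theta> < 1\<close> therefore pays for the difference at a high level.\<close>
lemma obtain_block_height:
  fixes \<theta> :: real assumes "0 < \<theta>" "\<theta> < 1"
  obtains x :: real where "x \<ge> 1" "((x + 1)\<^sup>2 / 2 + ln 4) * \<theta> \<le> x\<^sup>2 / 2"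
proof -
  have "\<forall>\<^sub>F x::real in at_top. ((x + 1)\<^sup>2 / 2 + ln 4) * \<theta> \<le> x\<^sup>2 / 2"
    using assms by real_asymp
  then have "\<forall>\<^sub>F x::real in at_top. x \<ge> 1 \<and> ((x + 1)\<^sup>2 / 2 + ln 4) * \<theta> \<le> x\<^sup>2 / 2"
    using eventually_ge_at_top[of 1] by eventually_elim auto
  then show ?thesis using that by (auto simp: eventually_at_top_linorder)
qed

text \<open>The \<open>k\<close>-th stretch consists of \<open>r k \<approx> 2 \<theta> ln k / x\<^sup>2\<close> blocks of length \<open>(q + 1)\<^sup>k\<close>. All of them exceed
  \<open>x\<close> standard deviations with probability at least a constant times \<open>1 / k\<close>, by the choice of the height \<open>x\<close>; these probabilities are
  not summable, and the stretches are independent. If all blocks are high, the increment over the stretch of length \<open>m k\<close> is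
  at least \<open>r k * x * sqrt ((q + 1)\<^sup>k) \<ge> sqrt (2 \<theta> (m k) ln k)\<close>. The geometric block lengths make each stretch \<open>q\<close> times longer
  than all earlier ones together.\<close>
lemma frequently_block_increment:
  fixes \<theta> :: real and q :: nat
  assumes \<theta>: "0 < \<theta>" "\<theta> < 1" and q: "q \<ge> 1"
  obtains n :: "nat \<Rightarrow> nat" where "n 0 = 0" "\<And>k. n k < n (Suc k)" "\<And>k. real q * real (n k) \<le> real (n (Suc k)) - real (n k)"
    "\<And>\<eta> c::real. \<eta> > 0 \<Longrightarrow> c > 0 \<Longrightarrow> \<forall>\<^sub>F k in sequentially. llog (c * (real (n (Suc k)) - real (n k))) \<le> (1 + \<eta>) * ln (real k)"
    "AE \<omega> in M. \<exists>\<^sub>F k in sequentially.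
        sqrt (\<theta> * 2 * (real (n (Suc k)) - real (n k)) * ln (real k)) \<le> (\<Sum>i\<in>{n k..<n (Suc k)}. X i \<omega>)"
proof -
  obtain x where x: "x \<ge> 1" "((x + 1)\<^sup>2 / 2 + ln 4) * \<theta> \<le> x\<^sup>2 / 2"
    using obtain_block_height[OF \<theta>] by blast
  have x0: "x \<ge> 0" using x by simp
  define g where "g = (x + 1)\<^sup>2 / 2 + ln 4"
  have g: "exp (- g) = exp (- (x + 1)\<^sup>2 / 2) / 4" "g > 0"
  proof -
    have "- g = - (x + 1)\<^sup>2 / 2 - ln 4" by (simp add: g_def)
    then show "exp (- g) = exp (- (x + 1)\<^sup>2 / 2) / 4" by (simp only: exp_diff) simp
    show "g > 0" unfolding g_def by (intro add_nonneg_pos) auto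
  qed
  define r where "r k = nat \<lceil>2 * \<theta> * ln (real k + 1) / x\<^sup>2\<rceil> + 1" for k :: nat
  define m where "m k = r k * Suc q ^ k" for k
  define n where "n k = (\<Sum>j<k. m j)" for k
  have n_Suc: "n (Suc k) = n k + m k" for k by (simp add: n_def)
  have diff: "real (n (Suc k)) - real (n k) = real (m k)" for k by (simp add: n_Suc)
  have r_pos: "r k > 0" for k by (simp add: r_def)
  have m_pos: "m k > 0" for k by (simp add: m_def r_pos)
  have r_mono: "r j \<le> r k" if "j \<le> k" for j k
  proof -
    have "2 * \<theta> * ln (real j + 1) / x\<^sup>2 \<le> 2 * \<theta> * ln (real k + 1) / x\<^sup>2"
      using that \<theta> x by (intro divide_right_mono mult_left_mono) auto
    then show ?thesis unfolding r_def by (intro add_right_mono nat_mono ceiling_mono)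
  qed
  \<comment> \<open>The block counts increase, so the earlier lengths are dominated by a geometric series.\<close>
  have qn: "q * n k \<le> m k" for k
  proof -
    have "q * n k = q * (\<Sum>j<k. r j * Suc q ^ j)" by (simp add: n_def m_def)
    also have "\<dots> \<le> q * (\<Sum>j<k. r k * Suc q ^ j)"
      by (intro mult_left_mono sum_mono mult_right_mono r_mono) auto
    also have "\<dots> = r k * (q * (\<Sum>j<k. Suc q ^ j))" by (simp add: sum_distrib_left mult_ac)
    also have "q * (\<Sum>j<k. Suc q ^ j) = Suc q ^ k - 1"
      by (induction k) (auto simp: algebra_simps)
    also have "r k * (Suc q ^ k - 1) \<le> m k" unfolding m_def by (intro mult_left_mono) auto
    finally show ?thesis .
  qed
  have r_le: "\<forall>\<^sub>F k in sequentially. real (r k) \<le> real k"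
  proof -
    have "\<forall>\<^sub>F k in sequentially. 2 * \<theta> * ln (real k + 1) / x\<^sup>2 + 2 \<le> real k"
      using \<theta> x by real_asymp
    then show ?thesis
    proof eventually_elim
      case (elim k)
      have "2 * \<theta> * ln (real k + 1) / x\<^sup>2 \<ge> 0" using \<theta> by (intro divide_nonneg_nonneg mult_nonneg_nonneg) auto
      then show ?case using elim unfolding r_def by linarith
    qed
  qed
  have llog_m: "\<forall>\<^sub>F k in sequentially. llog (c * real (m k)) \<le> (1 + \<eta>) * ln (real k)" if "\<eta> > 0" "c > 0" for \<eta> c
  proof -
    define Q where "Q = real (Suc q)"
    have Q: "Q > 1" using q by (simp add: Q_def)
    have "\<forall>\<^sub>F k in sequentially. llog (c * (real k * Q ^ k)) \<le> (1 + \<eta>) * ln (real k)"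
      unfolding llog_def using that Q by real_asymp
    then show ?thesis using r_le
    proof eventually_elim
      case (elim k)
      have "real (m k) \<le> real k * Q ^ k"
        using elim(2) unfolding m_def Q_def by (simp add: mult_right_mono)
      then have "llog (c * real (m k)) \<le> llog (c * (real k * Q ^ k))"
        using that by (intro llog_mono mult_left_mono) auto
      then show ?case using elim by linarith
    qed
  qed
  let ?Y = "\<lambda>k \<omega>. \<lambda>i\<in>{n k..<n (Suc k)}. X i \<omega>"
  define B where "B k j = {n k + j * Suc q ^ k..<n k + Suc j * Suc q ^ k}" for k j
  have B_sub: "B k j \<subseteq> {n k..<n (Suc k)}" if "j < r k" for k j
  proof -
    have "Suc j * Suc q ^ k \<le> r k * Suc q ^ k" using that by (intro mult_le_mono1) simp
    then show ?thesis unfolding B_def n_Suc m_def by auto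
  qed
  define E where "E k = {f \<in> space (PiM {n k..<n (Suc k)} (\<lambda>_. borel)). \<forall>j<r k. x * sqrt (Suc q ^ k) < (\<Sum>i\<in>B k j. f i :: real)}" for k
  have E_sets: "E k \<in> sets (PiM {n k..<n (Suc k)} (\<lambda>_. borel))" for k
  proof -
    have 1: "{f \<in> space (PiM {n k..<n (Suc k)} (\<lambda>_. borel)). x * sqrt (Suc q ^ k) < (\<Sum>i\<in>B k j. f i :: real)}
        \<in> sets (PiM {n k..<n (Suc k)} (\<lambda>_. borel))" if "j < r k" for j
    proof -
      have "(\<lambda>f. \<Sum>i\<in>B k j. f i) \<in> borel_measurable (PiM {n k..<n (Suc k)} (\<lambda>_. borel :: real measure))"
        using B_sub[OF that] by (intro borel_measurable_sum measurable_component_singleton) auto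
      then show ?thesis by (intro borel_measurable_less) auto
    qed
    have "E k = (\<Inter>j\<in>{..<r k}. {f \<in> space (PiM {n k..<n (Suc k)} (\<lambda>_. borel)). x * sqrt (Suc q ^ k) < (\<Sum>i\<in>B k j. f i :: real)})"
      using r_pos[of k] unfolding E_def by auto
    also have "\<dots> \<in> sets (PiM {n k..<n (Suc k)} (\<lambda>_. borel))"
      using r_pos[of k] 1 by (intro sets.finite_INT) auto
    finally show ?thesis .
  qed
  have YE: "?Y k \<omega> \<in> E k \<longleftrightarrow> (\<forall>j<r k. x * sqrt (Suc q ^ k) < (\<Sum>i\<in>B k j. X i \<omega>))" for k \<omega>
  proof -
    have "(\<Sum>i\<in>B k j. ?Y k \<omega> i) = (\<Sum>i\<in>B k j. X i \<omega>)" if "j < r k" for j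
      using B_sub[OF that] by (intro sum.cong) auto
    then show ?thesis unfolding E_def by (auto simp: space_PiM)
  qed
  have n_mono: "n j \<le> n k" if "j \<le> k" for j k
    using that by (induction k rule: dec_induct) (auto simp: n_Suc)
  have "disjoint_family (\<lambda>k. {n k..<n (Suc k)})"
  proof (unfold disjoint_family_on_def, intro ballI impI)
    fix i j :: nat assume "i \<noteq> j"
    have *: "{n i..<n (Suc i)} \<inter> {n j..<n (Suc j)} = {}" if "i < j" for i j
      using n_mono[of "Suc i" j] that by auto
    show "{n i..<n (Suc i)} \<inter> {n j..<n (Suc j)} = {}"
      using *[of i j] *[of j i] \<open>i \<noteq> j\<close> by (cases i j rule: linorder_cases) auto
  qed
  then have ind: "indep_vars (\<lambda>k. PiM {n k..<n (Suc k)} (\<lambda>_. borel)) ?Y UNIV"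
    by (intro indep_vars_restrict[OF indep]) auto
  have lower: "\<forall>\<^sub>F k in sequentially. exp (- 2 * g) * (1 / (real k + 1)) \<le> prob {\<omega>\<in>space M. ?Y k \<omega> \<in> E k}"
  proof -
    have "filterlim (\<lambda>k. Suc q ^ k) at_top sequentially"
      using q by (intro filterlim_at_top_mono[OF filterlim_ident] always_eventually allI less_imp_le power_gt_expt) simp
    from filterlim_iff[THEN iffD1, OF this, rule_format, OF prob_sum_gt_eventually[OF x0]]
    have "\<forall>\<^sub>F k in sequentially. exp (- g) < prob {\<omega>\<in>space M. x * sqrt (Suc q ^ k) < (\<Sum>i<Suc q ^ k. X i \<omega>)}"
      unfolding g(1) of_nat_power .
    then show ?thesis
    proof eventually_elim
      case (elim k)
      have nn: "2 * \<theta> * ln (real k + 1) / x\<^sup>2 \<ge> 0"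
        using \<theta> by (intro divide_nonneg_nonneg mult_nonneg_nonneg) auto
      have "real (r k) \<le> 2 * \<theta> * ln (real k + 1) / x\<^sup>2 + 2"
        using nn unfolding r_def by linarith
      then have "g * real (r k) \<le> g * (2 * \<theta> * ln (real k + 1) / x\<^sup>2 + 2)"
        using g by (intro mult_left_mono) auto
      also have "\<dots> = (g * \<theta>) * (2 * ln (real k + 1) / x\<^sup>2) + 2 * g"
        by (simp add: algebra_simps)
      also have "\<dots> \<le> (x\<^sup>2 / 2) * (2 * ln (real k + 1) / x\<^sup>2) + 2 * g"
        using x(2) unfolding g_def[symmetric] by (intro add_right_mono mult_right_mono) auto
      also have "\<dots> = ln (real k + 1) + 2 * g" using x by simp
      finally have "exp (- (ln (real k + 1) + 2 * g)) \<le> exp (- (g * real (r k)))" by simp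
      also have "\<dots> = exp (- g) ^ r k" by (simp add: exp_of_nat_mult[symmetric] mult.commute)
      also have "\<dots> \<le> prob {\<omega>\<in>space M. \<forall>j<r k. x * sqrt (Suc q ^ k) < (\<Sum>i\<in>B k j. X i \<omega>)}"
        unfolding B_def using elim by (intro prob_all_blocks_ge r_pos) auto
      also have "exp (- (ln (real k + 1) + 2 * g)) = exp (- 2 * g) * (1 / (real k + 1))"
        by (simp add: exp_diff exp_minus exp_add field_simps)
      finally show ?case unfolding YE .
    qed
  qed
  have "\<not> summable (\<lambda>k. prob {\<omega>\<in>space M. ?Y k \<omega> \<in> E k})"
  proof
    assume s: "summable (\<lambda>k. prob {\<omega>\<in>space M. ?Y k \<omega> \<in> E k})"
    have "summable (\<lambda>k. exp (- 2 * g) * (1 / (real k + 1)))"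
      by (rule summable_comparison_test_ev[OF _ s]) (use lower in auto)
    then have "summable (\<lambda>k. 1 / (real k + 1))" by (subst (asm) summable_cmult_iff) auto
    then have "summable (\<lambda>k. 1 / real (Suc k))" by (simp add: add.commute)
    then have "summable (\<lambda>k. 1 / real k)" by (subst (asm) summable_Suc_iff)
    then show False using not_summable_harmonic[where 'a=real] by (simp add: inverse_eq_divide)
  qed
  from borel_cantelli_2[OF ind E_sets this]
  have AE: "AE \<omega> in M. \<exists>\<^sub>F k in sequentially.
        sqrt (\<theta> * 2 * (real (n (Suc k)) - real (n k)) * ln (real k)) \<le> (\<Sum>i\<in>{n k..<n (Suc k)}. X i \<omega>)"
  proof eventually_elim
    case (elim \<omega>)
    have "\<exists>\<^sub>F k in sequentially. ?Y k \<omega> \<in> E k \<and> k > 0"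
      using elim eventually_gt_at_top[of 0] by (rule frequently_and_eventually)
    then show ?case
    proof (rule frequently_elim1)
      fix k assume k: "?Y k \<omega> \<in> E k \<and> k > 0"
      have un: "{n k..<n (Suc k)} = (\<Union>j<r k. B k j)"
      proof
        show "(\<Union>j<r k. B k j) \<subseteq> {n k..<n (Suc k)}" using B_sub by auto
        show "{n k..<n (Suc k)} \<subseteq> (\<Union>j<r k. B k j)"
        proof
          fix i assume i: "i \<in> {n k..<n (Suc k)}"
          let ?j = "(i - n k) div Suc q ^ k"
          have "i - n k < r k * Suc q ^ k" using i by (auto simp: n_Suc m_def)
          then have "?j < r k" by (simp add: less_mult_imp_div_less)
          moreover have "i \<in> B k ?j"
          proof -
            have 1: "?j * Suc q ^ k \<le> i - n k" by (rule div_times_less_eq_dividend)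
            have 2: "i - n k < Suc ?j * Suc q ^ k"
              using dividend_less_div_times[of "Suc q ^ k" "i - n k"] by simp
            from i have "n k \<le> i" by simp
            with 1 2 show ?thesis unfolding B_def atLeastLessThan_iff by linarith
          qed
          ultimately show "i \<in> (\<Union>j<r k. B k j)" by blast
        qed
      qed
      have disj: "B k i \<inter> B k j = {}" if "i < j" for i j
      proof -
        have "Suc i * Suc q ^ k \<le> j * Suc q ^ k" using that by (intro mult_le_mono1) simp
        then show ?thesis unfolding B_def by auto
      qed
      have "(\<Sum>i\<in>{n k..<n (Suc k)}. X i \<omega>) = (\<Sum>j<r k. \<Sum>i\<in>B k j. X i \<omega>)"
        unfolding un
      proof (rule sum.UNION_disjoint)
        show "\<forall>i\<in>{..<r k}. \<forall>j\<in>{..<r k}. i \<noteq> j \<longrightarrow> B k i \<inter> B k j = {}"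
          using disj by (metis Int_commute linorder_neqE_nat)
      qed (auto simp: B_def)
      also have "\<dots> \<ge> (\<Sum>j<r k. x * sqrt (Suc q ^ k))"
        using k unfolding YE by (intro sum_mono) (auto intro: less_imp_le)
      finally have ge: "real (r k) * (x * sqrt (Suc q ^ k)) \<le> (\<Sum>i\<in>{n k..<n (Suc k)}. X i \<omega>)" by simp
      have "2 * \<theta> * ln (real k) / x\<^sup>2 \<le> 2 * \<theta> * ln (real k + 1) / x\<^sup>2"
        using \<theta> x k by (intro divide_right_mono mult_left_mono) auto
      also have "\<dots> \<le> real (r k)" unfolding r_def by linarith
      finally have "2 * \<theta> * ln (real k) \<le> real (r k) * x\<^sup>2" using x by (simp add: divide_le_eq)
      then have "\<theta> * 2 * real (m k) * ln (real k) \<le> real (r k) * x\<^sup>2 * real (m k)"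
        using mult_right_mono[of "2 * \<theta> * ln (real k)" "real (r k) * x\<^sup>2" "real (m k)"] by (simp add: mult_ac)
      also have "\<dots> = (real (r k) * (x * sqrt (Suc q ^ k)))\<^sup>2"
        by (simp add: m_def power_mult_distrib power2_eq_square[of "real (r k)"] mult_ac)
      finally have "sqrt (\<theta> * 2 * real (m k) * ln (real k)) \<le> sqrt ((real (r k) * (x * sqrt (Suc q ^ k)))\<^sup>2)"
        by (rule real_sqrt_le_mono)
      also have "\<dots> = real (r k) * (x * sqrt (Suc q ^ k))" using x by simp
      also note ge
      finally show "sqrt (\<theta> * 2 * (real (n (Suc k)) - real (n k)) * ln (real k)) \<le> (\<Sum>i\<in>{n k..<n (Suc k)}. X i \<omega>)"
        unfolding diff .
    qed
  qed
  show ?thesis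
  proof (rule that[of n])
    show "n 0 = 0" by (simp add: n_def)
    show "n k < n (Suc k)" for k using m_pos[of k] by (simp add: n_Suc)
    show "real q * real (n k) \<le> real (n (Suc k)) - real (n k)" for k
      unfolding diff using qn[of k] by (simp flip: of_nat_mult)
    show "\<forall>\<^sub>F k in sequentially. llog (c * (real (n (Suc k)) - real (n k))) \<le> (1 + \<eta>) * ln (real k)"
      if "\<eta> > 0" "c > 0" for \<eta> c :: real unfolding diff using llog_m[OF that] .
  qed (rule AE)
qed

text \<open>Infinitely often the last stretch has an increment close to the scale, and the walk before it is at
  least \<open>-2\<close> times its own scale by the upper half. As the earlier part is shorter by a factor \<open>q \<ge> 128 / s\<^sup>2\<close>, this
  costs at most \<open>s / 4\<close> of the scale.\<close>
theorem lil_lower: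
  assumes s: "0 < s" "s < 1"
  shows "AE \<omega> in M. \<exists>\<^sub>F n in sequentially. (1 - s) * lil_scale n \<le> (\<Sum>i<n. X i \<omega>)"
proof -
  \<comment> \<open>The weights \<open>s / 4\<close> and \<open>s / 8\<close> below are chosen such that \<open>(1 - s) (1 + s / 8) \<le> 1 - s / 2\<close>.\<close>
  define q where "q = nat \<lceil>128 / s\<^sup>2\<rceil>"
  have q: "real q \<ge> 128 / s\<^sup>2" unfolding q_def by linarith
  have q0: "q \<ge> 1"
  proof -
    have "128 / s\<^sup>2 > 0" using s by simp
    then show ?thesis using q by linarith
  qed
  have \<theta>: "0 < (1 - s / 4)\<^sup>2" "(1 - s / 4)\<^sup>2 < 1" using s by (auto simp: abs_square_less_1)
  obtain n :: "nat \<Rightarrow> nat" where n: "n 0 = 0" "\<And>k. n k < n (Suc k)"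
    "\<And>k. real q * real (n k) \<le> real (n (Suc k)) - real (n k)"
    "\<And>\<eta> c::real. \<eta> > 0 \<Longrightarrow> c > 0 \<Longrightarrow> \<forall>\<^sub>F k in sequentially. llog (c * (real (n (Suc k)) - real (n k))) \<le> (1 + \<eta>) * ln (real k)"
    "AE \<omega> in M. \<exists>\<^sub>F k in sequentially.
        sqrt ((1 - s / 4)\<^sup>2 * 2 * (real (n (Suc k)) - real (n k)) * ln (real k)) \<le> (\<Sum>i\<in>{n k..<n (Suc k)}. X i \<omega>)"
    using frequently_block_increment[OF \<theta> q0] by blast
  define d where "d k = real (n (Suc k)) - real (n k)" for k
  have d: "d k > 0" for k using n(2)[of k] by (simp add: d_def)
  define u where "u k = sqrt (2 * d k * ln (real k))" for k
  have sm: "strict_mono n" using n(2) by (simp add: strict_mono_Suc_iff)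
  have small: "\<forall>\<^sub>F k in sequentially. 2 * lil_scale (real (n k)) \<le> s / 4 * u k"
  proof -
    have q1: "1 / real q > 0" using q0 by simp
    show ?thesis
    using n(4)[OF zero_less_one q1] eventually_gt_at_top[of 0] unfolding d_def[symmetric]
  proof eventually_elim
    case (elim k)
    have "lil_scale (real (n k)) \<le> lil_scale (d k / real q)"
      using n(3)[of k] q0 unfolding d_def by (intro lil_scale_mono) (auto simp: field_simps)
    also have "\<dots> \<le> sqrt (2 * (d k / real q) * (2 * ln (real k)))"
      unfolding lil_scale_def using elim d[of k] by (intro real_sqrt_le_mono mult_left_mono) auto
    also have "\<dots> = sqrt (2 / real q) * u k"
      unfolding u_def real_sqrt_mult[symmetric] by (simp add: field_simps)
    also have "\<dots> \<le> s / 8 * u k"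
    proof (rule mult_right_mono)
      have "2 / real q \<le> 2 / (128 / s\<^sup>2)"
        using q q0 s by (intro divide_left_mono) (auto intro!: divide_pos_pos mult_pos_pos)
      also have "\<dots> = (s / 8)\<^sup>2" by (simp add: power_divide)
      finally show "sqrt (2 / real q) \<le> s / 8" using s by (intro real_le_lsqrt) auto
      show "0 \<le> u k" unfolding u_def using d[of k] elim by simp
    qed
    finally show ?case by simp
  qed
  qed
  have large: "\<forall>\<^sub>F k in sequentially. lil_scale (real (n (Suc k))) \<le> (1 + s / 8) * u k"
  proof -
    have s8: "s / 8 > 0" "1 + s / 8 > 0" using s by auto
    show ?thesis
    using n(4)[OF s8] eventually_gt_at_top[of 0] unfolding d_def[symmetric]
  proof eventually_elim
    case (elim k)
    have "8 / s \<le> 128 / s\<^sup>2" using s by (simp add: field_simps power2_eq_square)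
    then have "8 / s \<le> real q" using q by linarith
    then have "8 * real (n k) \<le> s * (real q * real (n k))"
      using s mult_right_mono[of 8 "s * real q" "real (n k)"] by (simp add: field_simps)
    also have "\<dots> \<le> s * d k" using n(3)[of k] s unfolding d_def by (intro mult_left_mono) auto
    finally have "real (n (Suc k)) \<le> (1 + s / 8) * d k" unfolding d_def by (simp add: algebra_simps)
    then have "lil_scale (real (n (Suc k))) \<le> lil_scale ((1 + s / 8) * d k)"
      by (intro lil_scale_mono) auto
    also have "\<dots> \<le> sqrt (2 * ((1 + s / 8) * d k) * ((1 + s / 8) * ln (real k)))"
      unfolding lil_scale_def using elim d[of k] s by (intro real_sqrt_le_mono mult_left_mono) auto
    also have "2 * ((1 + s / 8) * d k) * ((1 + s / 8) * ln (real k)) = (1 + s / 8)\<^sup>2 * (2 * d k * ln (real k))"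
      by (simp add: power2_eq_square mult_ac)
    also have "sqrt \<dots> = (1 + s / 8) * u k"
      unfolding u_def real_sqrt_mult[of "(1 + s / 8)\<^sup>2"] using s by simp
    finally show ?case .
  qed
  qed
  show ?thesis
    using n(5) sum_ge_neg_two_lil_scale unfolding d_def[symmetric]
  proof eventually_elim
    case (elim \<omega>)
    have "\<forall>\<^sub>F k in sequentially. - 2 * lil_scale (n k) \<le> (\<Sum>i<n k. X i \<omega>)"
      using filterlim_iff[THEN iffD1, OF filterlim_subseq[OF sm], rule_format, OF elim(2)] .
    with small large have "\<forall>\<^sub>F k in sequentially. 2 * lil_scale (real (n k)) \<le> s / 4 * u k \<and>
        lil_scale (real (n (Suc k))) \<le> (1 + s / 8) * u k \<and> - 2 * lil_scale (n k) \<le> (\<Sum>i<n k. X i \<omega>) \<and> k > 0"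
      using eventually_gt_at_top[of 0] by eventually_elim auto
    with elim(1) have "\<exists>\<^sub>F k in sequentially.
       sqrt ((1 - s / 4)\<^sup>2 * 2 * d k * ln (real k)) \<le> (\<Sum>i\<in>{n k..<n (Suc k)}. X i \<omega>) \<and> (2 * lil_scale (real (n k)) \<le> s / 4 * u k \<and>
        lil_scale (real (n (Suc k))) \<le> (1 + s / 8) * u k \<and> - 2 * lil_scale (n k) \<le> (\<Sum>i<n k. X i \<omega>) \<and> k > 0)"
      by (rule frequently_and_eventually)
    then have "\<exists>\<^sub>F k in sequentially. (1 - s) * lil_scale (n (Suc k)) \<le> (\<Sum>i<n (Suc k). X i \<omega>)"
    proof (rule frequently_elim1)
      fix k
      assume *: "sqrt ((1 - s / 4)\<^sup>2 * 2 * d k * ln (real k)) \<le> (\<Sum>i\<in>{n k..<n (Suc k)}. X i \<omega>) \<and> (2 * lil_scale (real (n k)) \<le> s / 4 * u k \<and>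
        lil_scale (real (n (Suc k))) \<le> (1 + s / 8) * u k \<and> - 2 * lil_scale (n k) \<le> (\<Sum>i<n k. X i \<omega>) \<and> k > 0)"
      have "sqrt ((1 - s / 4)\<^sup>2 * 2 * d k * ln (real k)) = sqrt ((1 - s / 4)\<^sup>2 * (2 * d k * ln (real k)))"
        by (simp only: mult.assoc)
      also have "\<dots> = (1 - s / 4) * u k"
        unfolding u_def real_sqrt_mult[of "(1 - s / 4)\<^sup>2"] using s by simp
      finally have D: "(1 - s / 4) * u k \<le> (\<Sum>i\<in>{n k..<n (Suc k)}. X i \<omega>)" using * by simp
      have u0: "u k \<ge> 0" unfolding u_def using d[of k] * by simp
      have "(1 - s) * lil_scale (n (Suc k)) \<le> (1 - s) * ((1 + s / 8) * u k)"
        using * s by (intro mult_left_mono) auto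
      also have "\<dots> = ((1 - s) * (1 + s / 8)) * u k" by simp
      also have "\<dots> \<le> (1 - s / 2) * u k"
        using u0 s by (intro mult_right_mono) (auto simp: algebra_simps)
      also have "\<dots> \<le> (\<Sum>i<n k. X i \<omega>) + (\<Sum>i\<in>{n k..<n (Suc k)}. X i \<omega>)"
        using D * by (simp add: algebra_simps)
      also have "\<dots> = (\<Sum>i<n (Suc k). X i \<omega>)"
        using sum.atLeastLessThan_concat[of 0 "n k" "n (Suc k)" "\<lambda>i. X i \<omega>"] n(2)[of k]
        by (simp add: atLeast0LessThan)
      finally show "(1 - s) * lil_scale (n (Suc k)) \<le> (\<Sum>i<n (Suc k). X i \<omega>)" .
    qed
    moreover have "filterlim (\<lambda>k. n (Suc k)) at_top sequentially"
      using filterlim_subseq[OF sm] by (simp add: filterlim_sequentially_Suc)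
    ultimately show ?case
      unfolding frequently_def filterlim_iff by blast
  qed
qed

theorem lil_two_sided:
  "AE \<omega> in M. (\<forall>\<delta>>0. \<forall>\<^sub>F n in sequentially. \<bar>\<Sum>i<n. X i \<omega>\<bar> \<le> (1 + \<delta>) * lil_scale n) \<and>
     (\<forall>\<delta>>0. \<exists>\<^sub>F n in sequentially. (1 - \<delta>) * lil_scale n \<le> (\<Sum>i<n. X i \<omega>)) \<and>
     (\<forall>\<delta>>0. \<exists>\<^sub>F n in sequentially. (\<Sum>i<n. X i \<omega>) \<le> - (1 - \<delta>) * lil_scale n)"
proof -
  interpret neg: standard_iid M "\<lambda>i \<omega>. - X i \<omega>" by (rule standard_iid_uminus)
  let ?e = "\<lambda>j. 1 / (real j + 2)"
  have e: "0 < ?e j" "?e j < 1" for j by auto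
  have ex: "\<exists>j. ?e j < \<delta>" if \<delta>: "\<delta> > 0" for \<delta> :: real
  proof -
    obtain j where "inverse (real (Suc j)) < \<delta>" using reals_Archimedean[OF \<delta>] by blast
    moreover have "?e j \<le> inverse (real (Suc j))" by (simp add: field_simps)
    ultimately show ?thesis by (intro exI[of _ j]) linarith
  qed
  have nn: "lil_scale (real n) \<ge> 0" for n
    unfolding lil_scale_def using llog_ge_1[of "real n"] by simp
  have "AE \<omega> in M. \<forall>j. \<forall>\<^sub>F n in sequentially. (\<Sum>i<n. X i \<omega>) \<le> (1 + ?e j) * lil_scale n"
    unfolding AE_all_countable using lil_upper e by blast
  moreover have "AE \<omega> in M. \<forall>j. \<forall>\<^sub>F n in sequentially. (\<Sum>i<n. - X i \<omega>) \<le> (1 + ?e j) * lil_scale n"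
    unfolding AE_all_countable using neg.lil_upper e by blast
  moreover have "AE \<omega> in M. \<forall>j. \<exists>\<^sub>F n in sequentially. (1 - ?e j) * lil_scale n \<le> (\<Sum>i<n. X i \<omega>)"
    unfolding AE_all_countable using lil_lower e by blast
  moreover have "AE \<omega> in M. \<forall>j. \<exists>\<^sub>F n in sequentially. (1 - ?e j) * lil_scale n \<le> (\<Sum>i<n. - X i \<omega>)"
    unfolding AE_all_countable using neg.lil_lower e by blast
  ultimately show ?thesis
  proof eventually_elim
    case (elim \<omega>)
    show ?case
    proof (intro conjI allI impI)
      fix \<delta> :: real assume "\<delta> > 0"
      then obtain j where j: "?e j < \<delta>" using ex by blast
      from elim(1)[rule_format, of j] elim(2)[rule_format, of j]
      show "\<forall>\<^sub>F n in sequentially. \<bar>\<Sum>i<n. X i \<omega>\<bar> \<le> (1 + \<delta>) * lil_scale n"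
      proof eventually_elim
        case (elim n)
        have "(1 + ?e j) * lil_scale n \<le> (1 + \<delta>) * lil_scale n"
          using j nn by (intro mult_right_mono) auto
        then show ?case using elim by (simp add: sum_negf)
      qed
      have le: "(1 - \<delta>) * lil_scale n \<le> (1 - ?e j) * lil_scale n" for n :: nat
        using j nn by (intro mult_right_mono) auto
      show "\<exists>\<^sub>F n in sequentially. (1 - \<delta>) * lil_scale n \<le> (\<Sum>i<n. X i \<omega>)"
        using elim(3)[rule_format, of j] le by (auto elim!: frequently_elim1 intro: order_trans)
      show "\<exists>\<^sub>F n in sequentially. (\<Sum>i<n. X i \<omega>) \<le> - (1 - \<delta>) * lil_scale n"
        using elim(4)[rule_format, of j]
      proof (rule frequently_elim1)
        fix n assume "(1 - ?e j) * lil_scale n \<le> (\<Sum>i<n. - X i \<omega>)"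
        then show "(\<Sum>i<n. X i \<omega>) \<le> - (1 - \<delta>) * lil_scale n"
          using le[of n] by (simp only: sum_negf mult_minus_left)
      qed
    qed
  qed
qed

end

section \<open>The cluster set of the normalised walk\<close>

text \<open>If the sequence stayed \<open>e\<close> away from \<open>c\<close>, steps smaller than \<open>2 e\<close> would keep it on one side of \<open>c\<close>.\<close>
lemma cluster_of_small_steps:
  fixes x :: "nat \<Rightarrow> real"
  assumes hi: "\<And>e. e > 0 \<Longrightarrow> \<exists>\<^sub>F n in sequentially. x n > c - e"
    and lo: "\<And>e. e > 0 \<Longrightarrow> \<exists>\<^sub>F n in sequentially. x n < c + e"
    and step: "(\<lambda>n. x (Suc n) - x n) \<longlonglongrightarrow> 0"
    and e: "e > 0"
  shows "\<exists>\<^sub>F n in sequentially. \<bar>x n - c\<bar> < e"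
proof (rule ccontr)
  assume "\<not> (\<exists>\<^sub>F n in sequentially. \<bar>x n - c\<bar> < e)"
  then have "\<forall>\<^sub>F n in sequentially. \<bar>x n - c\<bar> \<ge> e"
    by (simp add: frequently_def not_less)
  moreover have "\<forall>\<^sub>F n in sequentially. \<bar>x (Suc n) - x n\<bar> < 2 * e"
    using tendstoD[OF step, of "2 * e"] e by (simp add: dist_real_def)
  ultimately have "\<forall>\<^sub>F n in sequentially. \<bar>x n - c\<bar> \<ge> e \<and> \<bar>x (Suc n) - x n\<bar> < 2 * e"
    by eventually_elim auto
  then obtain N where N: "\<And>n. n \<ge> N \<Longrightarrow> \<bar>x n - c\<bar> \<ge> e \<and> \<bar>x (Suc n) - x n\<bar> < 2 * e"
    by (auto simp: eventually_sequentially)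
  show False
  proof (cases "x N \<ge> c + e")
    case True
    have "x n \<ge> c + e" if "n \<ge> N" for n
      using that
    proof (induction n rule: dec_induct)
      case (step n)
      then show ?case using N[of n] N[of "Suc n"] by linarith
    qed (use True in simp)
    then have "\<forall>\<^sub>F n in sequentially. \<not> x n < c + e"
      by (auto simp: eventually_sequentially not_less)
    then show False using lo[OF e] by (simp add: frequently_def)
  next
    case False
    have "x n \<le> c - e" if "n \<ge> N" for n
      using that
    proof (induction n rule: dec_induct)
      case base
      then show ?case using N[of N] False by linarith
    next
      case (step n)
      then show ?case using N[of n] N[of "Suc n"] by linarith
    qed
    then have "\<forall>\<^sub>F n in sequentially. \<not> x n > c - e"
      by (auto simp: eventually_sequentially not_less)
    then show False using hi[OF e] by (simp add: frequently_def)
  qed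
qed

lemma lil_scale_Suc_ratio: "(\<lambda>n. lil_scale (real (Suc n)) / lil_scale (real n)) \<longlonglongrightarrow> 1"
proof -
  have "(\<lambda>n. lil_scale (real n + 1) / lil_scale (real n)) \<longlonglongrightarrow> 1"
    unfolding lil_scale_def llog_def by real_asymp
  then show ?thesis by (simp add: add.commute)
qed

context standard_iid
begin

theorem lil_cluster:
  "AE \<omega> in M. (\<forall>\<delta>>0. \<forall>\<^sub>F n in sequentially. \<bar>\<Sum>i<n. X i \<omega>\<bar> \<le> (1 + \<delta>) * lil_scale n) \<and>
     (\<forall>c\<in>{-1..1}. \<forall>e>0. \<exists>\<^sub>F n in sequentially. \<bar>(\<Sum>i<n. X i \<omega>) / lil_scale n - c\<bar> < e)"
  using lil_two_sided AE_increment_negligible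
proof eventually_elim
  case (elim \<omega>)
  let ?S = "\<lambda>n. \<Sum>i<n. X i \<omega>"
  let ?x = "\<lambda>n. ?S n / lil_scale (real n)"
  have up: "\<forall>\<^sub>F n in sequentially. \<bar>?S n\<bar> \<le> (1 + \<delta>) * lil_scale n" if "\<delta> > 0" for \<delta>
    using elim(1) that by blast
  have pos: "\<forall>\<^sub>F n in sequentially. lil_scale (real n) > 0"
    using eventually_gt_at_top[of 0] by eventually_elim (simp add: lil_scale_pos)
  have bdd: "\<forall>\<^sub>F n in sequentially. \<bar>?x n\<bar> \<le> 2"
    using up[OF zero_less_one] pos by eventually_elim (auto simp: field_simps abs_if split: if_splits)
  have step: "(\<lambda>n. ?x (Suc n) - ?x n) \<longlonglongrightarrow> 0"
  proof -
    have "(\<lambda>n. inverse (lil_scale (real (Suc n)) / lil_scale (real n)) - 1) \<longlonglongrightarrow> inverse 1 - 1"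
      by (intro tendsto_intros lil_scale_Suc_ratio) simp
    then have r: "(\<lambda>n. inverse (lil_scale (real (Suc n)) / lil_scale (real n)) - 1) \<longlonglongrightarrow> 0" by simp
    have "(\<lambda>n. (inverse (lil_scale (real (Suc n)) / lil_scale (real n)) - 1) * ?x n) \<longlonglongrightarrow> 0"
    proof (rule Lim_null_comparison)
      show "\<forall>\<^sub>F n in sequentially. norm ((inverse (lil_scale (real (Suc n)) / lil_scale (real n)) - 1) * ?x n)
          \<le> \<bar>inverse (lil_scale (real (Suc n)) / lil_scale (real n)) - 1\<bar> * 2"
        using bdd by eventually_elim (simp only: real_norm_def abs_mult mult_left_mono abs_ge_zero)
      show "(\<lambda>n. \<bar>inverse (lil_scale (real (Suc n)) / lil_scale (real n)) - 1\<bar> * 2) \<longlonglongrightarrow> 0"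
        using tendsto_mult_left_zero[OF tendsto_rabs_zero[OF r], of 2] by simp
    qed
    have "(\<lambda>n. X n \<omega> / lil_scale (real n + 1) + (inverse (lil_scale (real (Suc n)) / lil_scale (real n)) - 1) * ?x n) \<longlonglongrightarrow> 0 + 0"
      by (intro tendsto_add elim(2)) fact
    then have "(\<lambda>n. X n \<omega> / lil_scale (real n + 1) + (inverse (lil_scale (real (Suc n)) / lil_scale (real n)) - 1) * ?x n) \<longlonglongrightarrow> 0" by simp
    then show ?thesis
    proof (rule Lim_transform_eventually)
      show "\<forall>\<^sub>F n in sequentially. X n \<omega> / lil_scale (real n + 1) + (inverse (lil_scale (real (Suc n)) / lil_scale (real n)) - 1) * ?x n
          = ?x (Suc n) - ?x n"
        using pos
      proof eventually_elim
        case (elim n)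
        have "lil_scale (real (Suc n)) > 0" by (rule lil_scale_pos) simp
        with elim show ?case by (simp add: field_simps add.commute)
      qed
    qed
  qed
  have hi: "\<exists>\<^sub>F n in sequentially. ?x n > 1 - e" if "e > 0" for e
  proof -
    have "\<exists>\<^sub>F n in sequentially. (1 - e / 2) * lil_scale n \<le> ?S n" using elim(1) that by simp
    from frequently_and_eventually[OF this pos] show ?thesis
    proof (rule frequently_elim1)
      fix n assume n: "(1 - e / 2) * lil_scale n \<le> ?S n \<and> lil_scale (real n) > 0"
      then have "1 - e / 2 \<le> ?x n" by (simp add: pos_le_divide_eq)
      then show "?x n > 1 - e" using that by linarith
    qed
  qed
  have lo: "\<exists>\<^sub>F n in sequentially. ?x n < -1 + e" if "e > 0" for e
  proof -
    have "\<exists>\<^sub>F n in sequentially. ?S n \<le> - (1 - e / 2) * lil_scale n" using elim(1) that by simp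
    from frequently_and_eventually[OF this pos] show ?thesis
    proof (rule frequently_elim1)
      fix n assume n: "?S n \<le> - (1 - e / 2) * lil_scale n \<and> lil_scale (real n) > 0"
      then have "?x n \<le> - (1 - e / 2)" by (simp add: pos_divide_le_eq)
      then show "?x n < -1 + e" using that by linarith
    qed
  qed
  show ?case
  proof (intro conjI ballI allI impI up)
    fix c e :: real assume c: "c \<in> {-1..1}" and e: "e > 0"
    show "\<exists>\<^sub>F n in sequentially. \<bar>?x n - c\<bar> < e"
    proof (rule cluster_of_small_steps[OF _ _ step e])
      fix e' :: real assume "e' > 0"
      show "\<exists>\<^sub>F n in sequentially. c - e' < ?x n"
        using hi[OF \<open>e' > 0\<close>] by (rule frequently_elim1) (use c in auto)
      show "\<exists>\<^sub>F n in sequentially. ?x n < c + e'"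
        using lo[OF \<open>e' > 0\<close>] by (rule frequently_elim1) (use c in auto)
    qed
  qed
qed

end

section \<open>Deterministic inversion: from the walk to its counting function\<close>

text \<open>The almost sure properties of a path of the walk that enter the asymptotics of its counting
  function.\<close>
locale renewal_path =
  fixes S :: "nat \<Rightarrow> real" and \<mu> C :: real
  assumes S_0: "S 0 = 0" and S_less: "\<And>n. S n < S (Suc n)" and \<mu>: "\<mu> > 0" and C: "C \<ge> 0"
    and deviation: "\<forall>\<^sub>F n in sequentially. \<bar>S n - real n * \<mu>\<bar> \<le> C * lil_scale n"
    and steps: "(\<lambda>n. (S (Suc n) - S n) / lil_scale (real n + 1)) \<longlonglongrightarrow> 0"
    and windows: "\<And>A. \<forall>\<^sub>F k in sequentially. S (k + nat \<lfloor>sqrt k\<rfloor>) - S k > A"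
begin

definition N :: "real \<Rightarrow> nat" where "N t = card {k. S k \<le> t}"

definition D :: "real \<Rightarrow> real" where "D t = real (N t) - max 0 t / \<mu>"

lemma S_mono: "m \<le> n \<Longrightarrow> S m \<le> S n"
  by (rule lift_Suc_mono_le[of S]) (rule less_imp_le[OF S_less])

lemma S_nonneg: "S n \<ge> 0"
  using S_mono[of 0 n] S_0 by simp

lemma S_unbounded: "\<exists>n. S n > t"
proof -
  obtain k where "S (k + nat \<lfloor>sqrt k\<rfloor>) - S k > t"
    using eventually_happens[OF windows[of t]] by auto
  then show ?thesis using S_nonneg[of k] by (intro exI[of _ "k + nat \<lfloor>sqrt k\<rfloor>"]) linarith
qed

lemma S_le_eq: "{k. S k \<le> t} = {..<N t}"
proof -
  define n where "n = (LEAST n. S n > t)"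
  have n: "S n > t" unfolding n_def using S_unbounded[of t] by (rule LeastI_ex)
  have "{k. S k \<le> t} = {..<n}"
  proof safe
    fix k assume "S k \<le> t"
    then show "k < n" using n S_mono[of n k] by (cases "k < n") auto
  next
    fix k assume "k < n"
    then show "S k \<le> t" using not_less_Least[of k "\<lambda>n. S n > t"] unfolding n_def by simp
  qed
  then show ?thesis unfolding N_def by simp
qed

lemma less_N_iff: "k < N t \<longleftrightarrow> S k \<le> t"
  using S_le_eq[of t] by blast

lemma N_mono: "s \<le> t \<Longrightarrow> N s \<le> N t"
  using less_N_iff[of "N t" s] less_N_iff[of "N t" t] by linarith

lemma N_pos: "t \<ge> 0 \<Longrightarrow> N t > 0"
  using less_N_iff[of 0 t] S_0 by simp

lemma less_S_N: "t < S (N t)"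
  using less_N_iff[of "N t" t] by simp

lemma S_N_minus_1: "t \<ge> 0 \<Longrightarrow> S (N t - 1) \<le> t"
  using less_N_iff[of "N t - 1" t] N_pos by simp

lemma N_S: "N (S k) = Suc k"
  using less_N_iff[of k "S k"] less_N_iff[of "Suc k" "S k"] S_less[of k] by simp

lemma N_at_top: "filterlim N at_top at_top"
  unfolding filterlim_at_top
proof
  fix n
  show "\<forall>\<^sub>F t in at_top. n \<le> N t"
    using eventually_ge_at_top[of "S n"]
  proof eventually_elim
    case (elim t)
    then show ?case using less_N_iff[of n t] by simp
  qed
qed

lemma overshoot: "((\<lambda>t. (S (N t) - t) / lil_scale (N t)) \<longlongrightarrow> 0) at_top"
proof (rule Lim_null_comparison)
  have "filterlim (\<lambda>t. N t - 1) at_top at_top"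
    by (rule filterlim_compose[OF filterlim_minus_const_nat_at_top N_at_top])
  from filterlim_compose[OF steps this]
  show "((\<lambda>t. (S (Suc (N t - 1)) - S (N t - 1)) / lil_scale (real (N t - 1) + 1)) \<longlongrightarrow> 0) at_top" .
  show "\<forall>\<^sub>F t in at_top. norm ((S (N t) - t) / lil_scale (N t)) \<le> (S (Suc (N t - 1)) - S (N t - 1)) / lil_scale (real (N t - 1) + 1)"
    using eventually_ge_at_top[of 0]
  proof eventually_elim
    case (elim t)
    have n: "N t > 0" by (rule N_pos[OF elim])
    then have "lil_scale (real (N t)) > 0" by (intro lil_scale_pos) simp
    then show ?case
      using n less_S_N[of t] S_N_minus_1[OF elim] by (auto simp: of_nat_diff intro!: divide_right_mono)
  qed
qed

lemma lil_scale_N_over_N: "((\<lambda>t. lil_scale (N t) / real (N t)) \<longlongrightarrow> 0) at_top"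
proof -
  have "(\<lambda>n. lil_scale (real n) / real n) \<longlonglongrightarrow> 0"
    unfolding lil_scale_def llog_def by real_asymp
  from filterlim_compose[OF this N_at_top] show ?thesis .
qed

lemma time_over_N: "((\<lambda>t. t / real (N t)) \<longlongrightarrow> \<mu>) at_top"
proof -
  have f1: "((\<lambda>t. (S (N t) - real (N t) * \<mu>) / lil_scale (N t) * (lil_scale (N t) / real (N t))) \<longlongrightarrow> 0) at_top"
  proof (rule Lim_null_comparison)
    show "\<forall>\<^sub>F t in at_top. norm ((S (N t) - real (N t) * \<mu>) / lil_scale (N t) * (lil_scale (N t) / real (N t)))
       \<le> C * (lil_scale (N t) / real (N t))"
      using filterlim_iff[THEN iffD1, OF N_at_top, rule_format, OF deviation] eventually_ge_at_top[of 0]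
    proof eventually_elim
      case (elim t)
      have n: "real (N t) > 0" using N_pos[OF elim(2)] by simp
      then have l: "lil_scale (real (N t)) > 0" by (rule lil_scale_pos)
      have "\<bar>S (N t) - real (N t) * \<mu>\<bar> / lil_scale (N t) \<le> C"
        using elim(1) l by (simp add: divide_le_eq)
      then have "\<bar>S (N t) - real (N t) * \<mu>\<bar> / lil_scale (N t) * (lil_scale (N t) / real (N t)) \<le> C * (lil_scale (N t) / real (N t))"
        using n l by (intro mult_right_mono) auto
      then show ?case using n l by (simp add: abs_mult)
    qed
    show "((\<lambda>t. C * (lil_scale (N t) / real (N t))) \<longlongrightarrow> 0) at_top"
      using tendsto_mult_right_zero[OF lil_scale_N_over_N, of C] by simp
  qed
  have f2: "((\<lambda>t. (S (N t) - t) / lil_scale (N t) * (lil_scale (N t) / real (N t))) \<longlongrightarrow> 0 * 0) at_top"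
    by (intro tendsto_mult overshoot lil_scale_N_over_N)
  have "((\<lambda>t. \<mu> + (S (N t) - real (N t) * \<mu>) / lil_scale (N t) * (lil_scale (N t) / real (N t))
     - (S (N t) - t) / lil_scale (N t) * (lil_scale (N t) / real (N t))) \<longlongrightarrow> \<mu> + 0 - 0 * 0) at_top"
    by (rule tendsto_diff[OF tendsto_add[OF tendsto_const f1] f2])
  then have "((\<lambda>t. \<mu> + (S (N t) - real (N t) * \<mu>) / lil_scale (N t) * (lil_scale (N t) / real (N t))
     - (S (N t) - t) / lil_scale (N t) * (lil_scale (N t) / real (N t))) \<longlongrightarrow> \<mu>) at_top" by simp
  then show ?thesis
  proof (rule Lim_transform_eventually)
    show "\<forall>\<^sub>F t in at_top. \<mu> + (S (N t) - real (N t) * \<mu>) / lil_scale (N t) * (lil_scale (N t) / real (N t))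
     - (S (N t) - t) / lil_scale (N t) * (lil_scale (N t) / real (N t)) = t / real (N t)"
      using eventually_ge_at_top[of 0]
    proof eventually_elim
      case (elim t)
      have n: "real (N t) > 0" using N_pos[OF elim] by simp
      then have l: "lil_scale (real (N t)) > 0" by (rule lil_scale_pos)
      have "a / s * (s / r) = a / r" if "s > 0" "r > 0" for a s r :: real using that by simp
      note * = this[OF l n]
      show ?case unfolding * using n by (simp add: field_simps)
    qed
  qed
qed

lemma N_over_time: "((\<lambda>t. real (N t) / t) \<longlongrightarrow> 1 / \<mu>) at_top"
  using tendsto_inverse[OF time_over_N] \<mu> by (simp add: inverse_eq_divide)

lemma N_le_linear: "\<forall>\<^sub>F t in at_top. real (N t) \<le> 2 / \<mu> * t"
proof -
  have "1 / \<mu> < 2 / \<mu>" using \<mu> by (simp add: divide_strict_right_mono)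
  from order_tendstoD(2)[OF N_over_time this] eventually_gt_at_top[of 0]
  show ?thesis by eventually_elim (simp add: field_simps)
qed

lemma N_ge_linear: "\<forall>\<^sub>F t in at_top. 1 / (2 * \<mu>) * t \<le> real (N t)"
proof -
  have "1 / (2 * \<mu>) < 1 / \<mu>" using \<mu> by (simp add: field_simps)
  from order_tendstoD(1)[OF N_over_time this] eventually_gt_at_top[of 0]
  show ?thesis by eventually_elim (simp add: field_simps)
qed

lemma llog_N_ratio: "((\<lambda>t. llog (N t) / llog t) \<longlongrightarrow> 1) at_top"
proof (rule tendsto_sandwich)
  show "((\<lambda>t. llog (1 / (2 * \<mu>) * t) / llog t) \<longlongrightarrow> 1) at_top"
    unfolding llog_def using \<mu> by real_asymp
  show "((\<lambda>t. llog (2 / \<mu> * t) / llog t) \<longlongrightarrow> 1) at_top"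
    unfolding llog_def using \<mu> by real_asymp
  show "\<forall>\<^sub>F t in at_top. llog (1 / (2 * \<mu>) * t) / llog t \<le> llog (N t) / llog t"
    using N_ge_linear eventually_gt_at_top[of 0]
  proof eventually_elim
    case (elim t)
    then show ?case using \<mu> llog_ge_1[of t] by (intro divide_right_mono llog_mono) auto
  qed
  show "\<forall>\<^sub>F t in at_top. llog (N t) / llog t \<le> llog (2 / \<mu> * t) / llog t"
    using N_le_linear eventually_gt_at_top[of 0]
  proof eventually_elim
    case (elim t)
    then show ?case using \<mu> llog_ge_1[of t] by (intro divide_right_mono llog_mono) auto
  qed
qed

lemma lil_scale_N_ratio: "((\<lambda>t. lil_scale (N t) / lil_scale t) \<longlongrightarrow> sqrt (1 / \<mu>)) at_top"
proof -
  have "((\<lambda>t. sqrt (real (N t) / t * (llog (N t) / llog t))) \<longlongrightarrow> sqrt (1 / \<mu> * 1)) at_top"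
    by (intro tendsto_intros N_over_time llog_N_ratio)
  then have "((\<lambda>t. sqrt (real (N t) / t * (llog (N t) / llog t))) \<longlongrightarrow> sqrt (1 / \<mu>)) at_top" by simp
  then show ?thesis
  proof (rule Lim_transform_eventually)
    show "\<forall>\<^sub>F t in at_top. sqrt (real (N t) / t * (llog (N t) / llog t)) = lil_scale (N t) / lil_scale t"
      using eventually_gt_at_top[of 0]
      by eventually_elim (simp add: lil_scale_def real_sqrt_divide[symmetric])
  qed
qed

text \<open>Multiplied by \<open>\<mu>\<close>, the numerator is the overshoot \<open>S (N t) - t\<close>.\<close>
lemma D_approx: "((\<lambda>t. (D t + (S (N t) - real (N t) * \<mu>) / \<mu>) / lil_scale t) \<longlongrightarrow> 0) at_top"
proof -
  have "((\<lambda>t. (1 / \<mu>) * ((S (N t) - t) / lil_scale (N t)) * (lil_scale (N t) / lil_scale t)) \<longlongrightarrow> (1 / \<mu>) * 0 * sqrt (1 / \<mu>)) at_top"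
    by (intro tendsto_intros overshoot lil_scale_N_ratio)
  then have "((\<lambda>t. (1 / \<mu>) * ((S (N t) - t) / lil_scale (N t)) * (lil_scale (N t) / lil_scale t)) \<longlongrightarrow> 0) at_top" by simp
  then show ?thesis
  proof (rule Lim_transform_eventually)
    show "\<forall>\<^sub>F t in at_top. (1 / \<mu>) * ((S (N t) - t) / lil_scale (N t)) * (lil_scale (N t) / lil_scale t)
      = (D t + (S (N t) - real (N t) * \<mu>) / \<mu>) / lil_scale t"
      using eventually_gt_at_top[of 0]
    proof eventually_elim
      case (elim t)
      have n: "real (N t) > 0" using N_pos[of t] elim by simp
      then have l: "lil_scale (real (N t)) > 0" "lil_scale t > 0" using elim by (auto intro: lil_scale_pos)
      have "D t + (S (N t) - real (N t) * \<mu>) / \<mu> = (1 / \<mu>) * (S (N t) - t)"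
        using elim \<mu> by (simp add: D_def field_simps)
      moreover have "c * (a / s) * (s / r) = c * a / r" if "s > 0" for a c s r :: real using that by simp
      ultimately show ?case using l by simp
    qed
  qed
qed

text \<open>The bound is uniform over all \<open>s \<le> t\<close>: small \<open>s\<close> contribute a constant, and the scale is increasing.\<close>
lemma D_bound:
  obtains K where "K > 0" "\<forall>\<^sub>F t in at_top. \<forall>s\<le>t. \<bar>D s\<bar> \<le> K * lil_scale t"
proof -
  define K where "K = 1 + C * (sqrt (1 / \<mu>) + 1) / \<mu>"
  have "\<forall>\<^sub>F t in at_top. \<bar>(D t + (S (N t) - real (N t) * \<mu>) / \<mu>) / lil_scale t\<bar> < 1"
    using tendstoD[OF D_approx, of 1] by (simp add: dist_real_def)
  moreover have "\<forall>\<^sub>F t in at_top. lil_scale (N t) / lil_scale t < sqrt (1 / \<mu>) + 1"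
    by (rule order_tendstoD[OF lil_scale_N_ratio]) simp
  moreover have "\<forall>\<^sub>F t in at_top. \<bar>S (N t) - real (N t) * \<mu>\<bar> \<le> C * lil_scale (N t)"
    using filterlim_iff[THEN iffD1, OF N_at_top, rule_format, OF deviation] .
  ultimately have ev: "\<forall>\<^sub>F t in at_top. \<bar>D t\<bar> \<le> K * lil_scale t"
    using eventually_gt_at_top[of 0]
  proof eventually_elim
    case (elim t)
    have l: "lil_scale t > 0" using elim by (auto intro: lil_scale_pos)
    have tri: "\<bar>a\<bar> \<le> c + d" if "\<bar>a + b\<bar> \<le> c" "\<bar>b\<bar> \<le> d" for a b c d :: real
      using that by linarith
    have "\<bar>D t + (S (N t) - real (N t) * \<mu>) / \<mu>\<bar> \<le> lil_scale t"
      using elim(1) l by (simp add: abs_divide)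
    moreover have "\<bar>(S (N t) - real (N t) * \<mu>) / \<mu>\<bar> \<le> C * ((sqrt (1 / \<mu>) + 1) * lil_scale t) / \<mu>"
    proof -
      have "\<bar>(S (N t) - real (N t) * \<mu>) / \<mu>\<bar> \<le> C * lil_scale (N t) / \<mu>"
        using elim(3) \<mu> by (simp add: abs_divide divide_right_mono)
      also have "\<dots> \<le> C * ((sqrt (1 / \<mu>) + 1) * lil_scale t) / \<mu>"
        using elim(2) l \<mu> C by (intro divide_right_mono mult_left_mono) (auto simp: field_simps)
      finally show ?thesis .
    qed
    ultimately have "\<bar>D t\<bar> \<le> lil_scale t + C * ((sqrt (1 / \<mu>) + 1) * lil_scale t) / \<mu>"
      by (rule tri)
    also have "\<dots> = K * lil_scale t" by (simp add: K_def algebra_simps)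
    finally show ?case .
  qed
  have K: "K > 0" unfolding K_def using C \<mu> by (intro add_pos_nonneg divide_nonneg_pos mult_nonneg_nonneg) auto
  obtain t0 where t0: "\<And>t. t \<ge> t0 \<Longrightarrow> \<bar>D t\<bar> \<le> K * lil_scale t"
    using ev by (auto simp: eventually_at_top_linorder)
  define t1 where "t1 = max t0 0"
  define b where "b = real (N t1) + t1 / \<mu>"
  have small: "\<bar>D s\<bar> \<le> b" if "s \<le> t1" for s
  proof -
    have "real (N s) \<le> real (N t1)" using N_mono[OF that] by simp
    moreover have "max 0 s / \<mu> \<le> t1 / \<mu>" using that \<mu> by (intro divide_right_mono) (auto simp: t1_def)
    moreover have "max 0 s / \<mu> \<ge> 0" "t1 / \<mu> \<ge> 0" using \<mu> by (auto simp: t1_def)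
    ultimately show ?thesis unfolding D_def b_def by linarith
  qed
  have "\<forall>\<^sub>F t in at_top. b / K \<le> lil_scale t"
    using lil_scale_at_top by (simp add: filterlim_at_top)
  then have "\<forall>\<^sub>F t in at_top. \<forall>s\<le>t. \<bar>D s\<bar> \<le> K * lil_scale t"
    using eventually_ge_at_top[of t1]
  proof eventually_elim
    case (elim t)
    show ?case
    proof (intro allI impI)
      fix s assume "s \<le> t"
      show "\<bar>D s\<bar> \<le> K * lil_scale t"
      proof (cases "s \<le> t1")
        case True
        then show ?thesis using small[OF True] elim(1) K by (simp add: field_simps)
      next
        case False
        then have "\<bar>D s\<bar> \<le> K * lil_scale s" by (intro t0) (simp add: t1_def)
        also have "\<dots> \<le> K * lil_scale t"
          using False \<open>s \<le> t\<close> K by (intro mult_left_mono lil_scale_mono) (auto simp: t1_def)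
        finally show ?thesis .
      qed
    qed
  qed
  with K show ?thesis by (rule that)
qed

text \<open>Starting from index \<open>n = N (t - A)\<close>, the walk has left the window after \<open>sqrt n\<close> further steps, so the window
  holds at most \<open>sqrt (N t)\<close> renewals, which is small on the scale.\<close>
lemma window_count:
  assumes e: "e > 0"
  shows "\<forall>\<^sub>F t in at_top. \<forall>s\<le>t. real (N s) - real (N (s - A)) \<le> e * lil_scale t"
proof -
  have k: "\<forall>\<^sub>F k in sequentially. S (k + nat \<lfloor>sqrt k\<rfloor>) - S k > A" by (rule windows)
  have "filterlim (\<lambda>t. N (t - A)) at_top at_top"
    by (rule filterlim_compose[OF N_at_top]) real_asymp
  from filterlim_iff[THEN iffD1, OF this, rule_format, OF k]
  have 1: "\<forall>\<^sub>F t in at_top. S (N (t - A) + nat \<lfloor>sqrt (N (t - A))\<rfloor>) - S (N (t - A)) > A" .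
  have 2: "\<forall>\<^sub>F t in at_top. sqrt (N t) \<le> (e / 2) * lil_scale t"
  proof -
    have "\<forall>\<^sub>F t in at_top. sqrt (2 / \<mu> * t) \<le> (e / 2) * lil_scale t"
      unfolding lil_scale_def llog_def using e \<mu> by real_asymp
    then show ?thesis using N_le_linear
    proof eventually_elim
      case (elim t)
      then show ?case using real_sqrt_le_mono[OF elim(2)] by linarith
    qed
  qed
  have "\<forall>\<^sub>F t in at_top. N t - N (t - A) \<le> (e / 2) * lil_scale t"
  proof (cases "A \<ge> 0")
    case True
    show ?thesis
      using 1 2
    proof eventually_elim
      case (elim t)
      let ?n = "N (t - A)"
      have "S (?n + nat \<lfloor>sqrt ?n\<rfloor>) > t" using elim(1) less_S_N[of "t - A"] by linarith
      then have "N t \<le> ?n + nat \<lfloor>sqrt ?n\<rfloor>" using less_N_iff[of "?n + nat \<lfloor>sqrt ?n\<rfloor>" t] by simp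
      then have "N t - ?n \<le> nat \<lfloor>sqrt ?n\<rfloor>" by linarith
      then have "real (N t - ?n) \<le> real (nat \<lfloor>sqrt ?n\<rfloor>)" by (simp only: of_nat_le_iff)
      also have "\<dots> \<le> sqrt ?n" by simp
      also have "\<dots> \<le> sqrt (N t)" using N_mono[of "t - A" t] True by simp
      finally show ?case using elim(2) by linarith
    qed
  next
    case False
    have nn: "\<forall>\<^sub>F t in at_top. (0::real) \<le> (e / 2) * lil_scale t"
      using eventually_gt_at_top[of 0] by eventually_elim (use e in \<open>simp add: lil_scale_pos less_imp_le\<close>)
    show ?thesis using nn
    proof eventually_elim
      case (elim t)
      have "N t - N (t - A) = 0" using N_mono[of t "t - A"] False by simp
      then show ?case using elim by simp
    qed
  qed
  then obtain t0 where t0: "\<And>t. t \<ge> t0 \<Longrightarrow> N t - N (t - A) \<le> (e / 2) * lil_scale t"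
    by (auto simp: eventually_at_top_linorder)
  define t1 where "t1 = max t0 0"
  have "\<forall>\<^sub>F t in at_top. real (N t1) / e \<le> lil_scale t"
    using lil_scale_at_top by (simp add: filterlim_at_top)
  then show ?thesis
    using eventually_ge_at_top[of t1]
  proof eventually_elim
    case (elim t)
    show ?case
    proof (intro allI impI)
      fix s assume "s \<le> t"
      show "real (N s) - real (N (s - A)) \<le> e * lil_scale t"
      proof (cases "s \<le> t1")
        case True
        then have "real (N s) - real (N (s - A)) \<le> real (N t1)" using N_mono[OF True] by simp
        then show ?thesis using elim(1) e by (simp add: field_simps)
      next
        case False
        then have p: "s > 0" "s \<ge> t0" by (auto simp: t1_def)
        have "real (N s) - real (N (s - A)) \<le> (e / 2) * lil_scale s" using t0[OF p(2)] by linarith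
        also have "\<dots> \<le> e * lil_scale s" using e lil_scale_pos[OF p(1)] by simp
        also have "\<dots> \<le> e * lil_scale t"
          using p \<open>s \<le> t\<close> e by (intro mult_left_mono lil_scale_mono) auto
        finally show ?thesis .
      qed
    qed
  qed
qed

lemma N_increment_le:
  assumes "\<forall>s\<le>t. \<bar>D s\<bar> \<le> K" "h \<ge> 0" "s + h \<le> t"
  shows "real (N (s + h)) - real (N s) \<le> h / \<mu> + 2 * K"
proof -
  have "\<bar>D (s + h)\<bar> \<le> K" "\<bar>D s\<bar> \<le> K" using assms by auto
  moreover have "max 0 (s + h) / \<mu> - max 0 s / \<mu> \<le> h / \<mu>"
    using \<mu> assms(2) by (simp add: diff_divide_distrib[symmetric] divide_right_mono)
  ultimately show ?thesis unfolding D_def by linarith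
qed

end

section \<open>Walks with positive perturbed steps\<close>

lemma fst_borel: "fst \<in> borel_measurable (borel :: (real \<times> real) measure)"
  by (intro borel_measurable_continuous_onI continuous_intros)

lemma snd_borel: "snd \<in> borel_measurable (borel :: (real \<times> real) measure)"
  by (intro borel_measurable_continuous_onI continuous_intros)

text \<open>Indices start at \<open>0\<close>: the pair \<open>(X k, H k)\<close> is the pair with index \<open>k + 1\<close> in the usual notation, so that the
  perturbed walk is \<open>walk_X k + H k\<close>.\<close>
locale perturbed_iid = prob_space M for M :: "'a measure" +
  fixes X H :: "nat \<Rightarrow> 'a \<Rightarrow> real" and \<mu> \<sigma> :: real
  assumes pair_indep: "indep_vars (\<lambda>_. borel) (\<lambda>k \<omega>. (X k \<omega>, H k \<omega>)) UNIV"
    and pair_ident: "\<And>k. distr M borel (\<lambda>\<omega>. (X k \<omega>, H k \<omega>)) = distr M borel (\<lambda>\<omega>. (X 0 \<omega>, H 0 \<omega>))"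
    and positive: "AE \<omega> in M. X 0 \<omega> > 0 \<and> H 0 \<omega> > 0"
    and integrable_X: "integrable M (X 0)" and mean: "\<mu> = expectation (X 0)"
    and integrable_square: "integrable M (\<lambda>\<omega>. (X 0 \<omega> - \<mu>)\<^sup>2)"
    and var: "\<sigma>\<^sup>2 = variance (X 0)" and \<sigma>: "\<sigma> > 0"
begin

abbreviation walk_X :: "nat \<Rightarrow> 'a \<Rightarrow> real" where
  "walk_X k \<omega> \<equiv> \<Sum>i<k. X i \<omega>"

lemma pair_meas[measurable]: "(\<lambda>\<omega>. (X k \<omega>, H k \<omega>)) \<in> borel_measurable M"
  using pair_indep unfolding indep_vars_def by auto

lemma X_meas[measurable]: "X k \<in> borel_measurable M"
  using measurable_compose[OF pair_meas fst_borel, of k] by simp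

lemma H_meas[measurable]: "H k \<in> borel_measurable M"
  using measurable_compose[OF pair_meas snd_borel, of k] by simp

lemma indep_X: "indep_vars (\<lambda>_. borel) X UNIV"
  using indep_vars_compose2[OF pair_indep fst_borel] by simp

lemma ident_X: "distr M borel (X k) = distr M borel (X 0)"
proof -
  have "distr (distr M borel (\<lambda>\<omega>. (X k \<omega>, H k \<omega>))) borel fst = distr M borel (X k)" for k
    by (subst distr_distr[OF fst_borel pair_meas]) (simp add: comp_def)
  from this[of k] this[of 0] show ?thesis using pair_ident[of k] by simp
qed

lemma ident_H: "distr M borel (H k) = distr M borel (H 0)"
proof -
  have "distr (distr M borel (\<lambda>\<omega>. (X k \<omega>, H k \<omega>))) borel snd = distr M borel (H k)" for k
    by (subst distr_distr[OF snd_borel pair_meas]) (simp add: comp_def)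
  from this[of k] this[of 0] show ?thesis using pair_ident[of k] by simp
qed

lemma AE_positive: "AE \<omega> in M. \<forall>k. X k \<omega> > 0 \<and> H k \<omega> > 0"
  unfolding AE_all_countable
proof
  fix k
  have A: "{x \<in> space borel. fst x > (0::real) \<and> snd x > (0::real)} \<in> sets borel"
    using fst_borel snd_borel by measurable
  have "(AE p in distr M borel (\<lambda>\<omega>. (X k \<omega>, H k \<omega>)). fst p > 0 \<and> snd p > 0) \<longleftrightarrow>
      (AE \<omega> in M. X k \<omega> > 0 \<and> H k \<omega> > 0)" for k
    by (subst AE_distr_iff[OF pair_meas A]) simp
  from this[of k] this[of 0] show "AE \<omega> in M. X k \<omega> > 0 \<and> H k \<omega> > 0"
    using positive unfolding pair_ident[of k] by blast
qed

lemma expectation_pos: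
  assumes "integrable M f" "AE \<omega> in M. f \<omega> > (0::real)"
  shows "expectation f > 0"
proof -
  have nn: "AE \<omega> in M. 0 \<le> f \<omega>" using assms(2) by eventually_elim simp
  have "expectation f \<noteq> 0"
  proof
    assume "expectation f = 0"
    then have "AE \<omega> in M. f \<omega> = 0"
      using integral_nonneg_eq_0_iff_AE[OF assms(1) nn] by simp
    with assms(2) have "AE \<omega> in M. False" by eventually_elim simp
    then show False by simp
  qed
  then show ?thesis using integral_nonneg_AE[OF nn] by simp
qed

lemma \<mu>_pos: "\<mu> > 0"
  unfolding mean using positive by (intro expectation_pos integrable_X) auto

sublocale std: standard_iid M "\<lambda>i \<omega>. (X i \<omega> - \<mu>) / \<sigma>"
proof
  show "indep_vars (\<lambda>_. borel) (\<lambda>i \<omega>. (X i \<omega> - \<mu>) / \<sigma>) UNIV"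
    by (rule indep_vars_compose2[OF indep_X]) auto
  show "distr M borel (\<lambda>\<omega>. (X i \<omega> - \<mu>) / \<sigma>) = distr M borel (\<lambda>\<omega>. (X 0 \<omega> - \<mu>) / \<sigma>)" for i
    using distr_distr[of "\<lambda>x. (x - \<mu>) / \<sigma>" borel borel "X i" M]
      distr_distr[of "\<lambda>x. (x - \<mu>) / \<sigma>" borel borel "X 0" M] ident_X[of i]
    by (simp add: comp_def)
  show "integrable M (\<lambda>\<omega>. ((X 0 \<omega> - \<mu>) / \<sigma>)\<^sup>2)"
    using integrable_square by (simp add: power_divide)
  show "expectation (\<lambda>\<omega>. (X 0 \<omega> - \<mu>) / \<sigma>) = 0"
    using integrable_X by (simp add: mean prob_space)
  show "expectation (\<lambda>\<omega>. ((X 0 \<omega> - \<mu>) / \<sigma>)\<^sup>2) = 1"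
  proof -
    have "expectation (\<lambda>\<omega>. (X 0 \<omega> - \<mu>)\<^sup>2) = \<sigma>\<^sup>2" using var by (simp add: mean)
    then show ?thesis using \<sigma> by (simp add: power_divide)
  qed
qed

lemma walk_standardised: "(\<Sum>i<n. (X i \<omega> - \<mu>) / \<sigma>) = (walk_X n \<omega> - real n * \<mu>) / \<sigma>"
  by (simp add: sum_divide_distrib[symmetric] sum_subtractf)

text \<open>Chernoff's bound with parameter \<open>1\<close>: the Laplace transform of a positive step at \<open>1\<close> is some \<open>q < 1\<close>, and
  \<open>a = - ln q\<close>.\<close>
lemma short_window_bound:
  obtains a where "a > 0" "\<And>k m A. prob {\<omega>\<in>space M. walk_X (k + m) \<omega> - walk_X k \<omega> \<le> A} \<le> exp (A - real m * a)"
proof -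
  define q where "q = expectation (\<lambda>\<omega>. exp (- X 0 \<omega>))"
  have pos0: "AE \<omega> in M. X 0 \<omega> > 0" using positive by eventually_elim simp
  have int: "integrable M (\<lambda>\<omega>. exp (- X 0 \<omega>))"
    by (rule integrable_const_bound[of _ 1]) (use pos0 in \<open>auto elim!: eventually_mono\<close>)
  have q: "q > 0" unfolding q_def using int by (intro expectation_pos) auto
  have "expectation (\<lambda>\<omega>. 1 - exp (- X 0 \<omega>)) > 0"
    using int pos0 by (intro expectation_pos) (auto elim!: eventually_mono)
  then have q1: "q < 1" using int by (simp add: q_def prob_space)
  have q_nn: "(\<integral>\<^sup>+\<omega>. ennreal (exp (- X i \<omega>)) \<partial>M) = ennreal q" for i
  proof -
    have "(\<integral>\<^sup>+\<omega>. ennreal (exp (- X i \<omega>)) \<partial>M) = (\<integral>\<^sup>+x. ennreal (exp (- x)) \<partial>distr M borel (X i))" for i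
      by (subst nn_integral_distr) auto
    from this[of i] this[of 0] have "(\<integral>\<^sup>+\<omega>. ennreal (exp (- X i \<omega>)) \<partial>M) = (\<integral>\<^sup>+\<omega>. ennreal (exp (- X 0 \<omega>)) \<partial>M)"
      using ident_X[of i] by simp
    then show ?thesis using int by (simp add: nn_integral_eq_integral q_def)
  qed
  have "prob {\<omega>\<in>space M. walk_X (k + m) \<omega> - walk_X k \<omega> \<le> A} \<le> exp (A - real m * (- ln q))" for k m A
  proof -
    let ?B = "{k..<k + m}"
    let ?Z = "\<lambda>\<omega>. - (\<Sum>i\<in>?B. X i \<omega>) - real m * ln q"
    have "(\<integral>\<^sup>+\<omega>. ennreal (exp (?Z \<omega>)) \<partial>M) = (\<integral>\<^sup>+\<omega>. ennreal (exp (- real m * ln q)) * (\<Prod>i\<in>?B. ennreal (exp (- X i \<omega>))) \<partial>M)"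
    proof (intro nn_integral_cong)
      fix \<omega>
      have "exp (?Z \<omega>) = exp (- real m * ln q) * (\<Prod>i\<in>?B. exp (- X i \<omega>))"
        by (simp add: exp_sum[symmetric] sum_negf exp_add[symmetric])
      then show "ennreal (exp (?Z \<omega>)) = ennreal (exp (- real m * ln q)) * (\<Prod>i\<in>?B. ennreal (exp (- X i \<omega>)))"
        by (simp add: ennreal_mult' prod_ennreal prod_nonneg)
    qed
    also have "\<dots> = ennreal (exp (- real m * ln q)) * (\<integral>\<^sup>+\<omega>. (\<Prod>i\<in>?B. ennreal (exp (- X i \<omega>))) \<partial>M)"
      by (rule nn_integral_cmult) measurable
    also have "(\<integral>\<^sup>+\<omega>. (\<Prod>i\<in>?B. ennreal (exp (- X i \<omega>))) \<partial>M) = (\<Prod>i\<in>?B. \<integral>\<^sup>+\<omega>. ennreal (exp (- X i \<omega>)) \<partial>M)"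
      by (rule indep_vars_nn_integral)
         (auto intro!: indep_vars_compose2[OF indep_vars_subset[OF indep_X]])
    also have "\<dots> = ennreal (q ^ m)" using q by (simp add: q_nn ennreal_power)
    also have "ennreal (exp (- real m * ln q)) * ennreal (q ^ m) = 1"
      using q by (simp add: ennreal_mult'[symmetric] exp_minus exp_of_nat_mult)
    finally have "prob {\<omega>\<in>space M. ?Z \<omega> \<ge> - A - real m * ln q} \<le> exp (- (- A - real m * ln q))"
      by (intro prob_le_of_exp_moment) auto
    moreover have "walk_X (k + m) \<omega> - walk_X k \<omega> = (\<Sum>i\<in>?B. X i \<omega>)" for \<omega>
      using sum.atLeastLessThan_concat[of 0 k "k + m" "\<lambda>i. X i \<omega>"] by (simp add: atLeast0LessThan)
    ultimately show ?thesis by (simp add: le_diff_eq add.commute)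
  qed
  then show ?thesis using that[of "- ln q"] q q1 by simp
qed

text \<open>The probability that \<open>sqrt k\<close> steps stay in a window of length \<open>A\<close> is at most \<open>exp (A + a - a sqrt k)\<close>, which is summable.\<close>
lemma AE_windows: "AE \<omega> in M. \<forall>A. \<forall>\<^sub>F k in sequentially. A < walk_X (k + nat \<lfloor>sqrt k\<rfloor>) \<omega> - walk_X k \<omega>"
proof -
  obtain a where a: "a > 0" "\<And>k m A. prob {\<omega>\<in>space M. walk_X (k + m) \<omega> - walk_X k \<omega> \<le> A} \<le> exp (A - real m * a)"
    using short_window_bound by blast
  have "AE \<omega> in M. \<forall>\<^sub>F k in sequentially. real A < walk_X (k + nat \<lfloor>sqrt k\<rfloor>) \<omega> - walk_X k \<omega>" for A :: nat
  proof -
    define G where "G k = {\<omega>\<in>space M. walk_X (k + nat \<lfloor>sqrt k\<rfloor>) \<omega> - walk_X k \<omega> \<le> real A}" for k :: nat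
    have G: "G k \<in> sets M" for k unfolding G_def by measurable
    have ev: "\<forall>\<^sub>F k in sequentially. norm (prob (G k)) \<le> real k powr (- 2)"
    proof -
      have "\<forall>\<^sub>F k in sequentially. exp (real A - (sqrt (real k) - 1) * a) \<le> real k powr (- 2)"
        using a(1) by real_asymp
      then show ?thesis
      proof eventually_elim
        case (elim k)
        have "prob (G k) \<le> exp (real A - real (nat \<lfloor>sqrt k\<rfloor>) * a)" unfolding G_def by (rule a(2))
        also have "\<dots> \<le> exp (real A - (sqrt (real k) - 1) * a)"
        proof -
          have "sqrt (real k) \<ge> 0" by simp
          then have "sqrt (real k) - 1 \<le> real (nat \<lfloor>sqrt k\<rfloor>)" by linarith
          then show ?thesis using a(1) by (simp add: mult_right_mono)
        qed
        finally show ?case using elim by simp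
      qed
    qed
    have "summable (\<lambda>k. real k powr (- 2))" by (simp add: summable_real_powr_iff)
    then have "summable (\<lambda>k. prob (G k))" by (rule summable_comparison_test_ev[OF ev])
    then have "AE \<omega> in M. \<forall>\<^sub>F k in sequentially. \<omega> \<in> space M - G k"
      using G by (intro borel_cantelli_AE1) (auto simp: emeasure_eq_measure)
    then show ?thesis
      by eventually_elim (auto elim!: eventually_mono simp: G_def not_le)
  qed
  then have "AE \<omega> in M. \<forall>A::nat. \<forall>\<^sub>F k in sequentially. real A < walk_X (k + nat \<lfloor>sqrt k\<rfloor>) \<omega> - walk_X k \<omega>"
    unfolding AE_all_countable by blast
  then show ?thesis
  proof eventually_elim
    case (elim \<omega>)
    show ?case
    proof
      fix A :: real
      obtain A' :: nat where "A \<le> real A'" using real_arch_simple by blast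
      with elim[rule_format, of A'] show "\<forall>\<^sub>F k in sequentially. A < walk_X (k + nat \<lfloor>sqrt k\<rfloor>) \<omega> - walk_X k \<omega>"
        by (auto elim!: eventually_mono)
    qed
  qed
qed

lemma AE_renewal_path: "AE \<omega> in M. renewal_path (\<lambda>n. walk_X n \<omega>) \<mu> (2 * \<sigma>)"
  using AE_positive AE_windows std.lil_cluster std.AE_increment_negligible
proof eventually_elim
  case (elim \<omega>)
  show ?case
  proof
    have "\<forall>\<^sub>F n in sequentially. \<bar>\<Sum>i<n. (X i \<omega> - \<mu>) / \<sigma>\<bar> \<le> (1 + 1) * lil_scale n"
      using elim(3) zero_less_one by blast
    then show "\<forall>\<^sub>F n in sequentially. \<bar>walk_X n \<omega> - real n * \<mu>\<bar> \<le> 2 * \<sigma> * lil_scale n"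
      unfolding walk_standardised using \<sigma> by (auto elim!: eventually_mono simp: abs_divide field_simps)
    have "(\<lambda>n. \<mu> / lil_scale (real n + 1)) \<longlonglongrightarrow> 0"
      unfolding lil_scale_def llog_def by real_asymp
    from tendsto_add[OF tendsto_mult_right_zero[OF elim(4), of \<sigma>] this]
    show "(\<lambda>n. (walk_X (Suc n) \<omega> - walk_X n \<omega>) / lil_scale (real n + 1)) \<longlonglongrightarrow> 0"
      using \<sigma> by (simp add: add_divide_distrib[symmetric])
  qed (use elim \<mu>_pos \<sigma> in auto)
qed

end

section \<open>A Bernstein inequality for the centred number of hits\<close>

lemma exp_le_quadratic_unit:
  assumes "\<bar>y\<bar> \<le> (1::real)"
  shows "exp y \<le> 1 + y + 2 * y\<^sup>2"
proof -
  have "exp \<bar>y\<bar> \<le> exp 1" using assms by (simp only: exp_le_cancel_iff)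
  also have "\<dots> \<le> 4" using exp_le by linarith
  finally have "y\<^sup>2 / 2 * exp \<bar>y\<bar> \<le> y\<^sup>2 / 2 * 4" by (rule mult_left_mono) simp
  then show ?thesis using exp_le_quadratic[of y] by linarith
qed

context perturbed_iid
begin

definition F :: "real \<Rightarrow> real" where
  "F y = prob {\<omega>\<in>space M. H 0 \<omega> \<le> y}"

lemma prob_H_le: "prob {\<omega>\<in>space M. H k \<omega> \<le> y} = F y"
proof -
  have "measure (distr M borel (H k)) {..y} = prob {\<omega>\<in>space M. H k \<omega> \<le> y}" for k
    by (subst measure_distr) (auto intro!: arg_cong[where f=prob])
  from this[of k] this[of 0] show ?thesis using ident_H[of k] by (simp add: F_def)
qed

lemma F_mono: "y \<le> z \<Longrightarrow> F y \<le> F z"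
  unfolding F_def by (intro finite_measure_mono) auto

lemma F_bounds: "0 \<le> F y" "F y \<le> 1"
  unfolding F_def by auto

lemma F_nonpos: "y \<le> 0 \<Longrightarrow> F y = 0"
  unfolding F_def using AE_positive
  by (subst prob_eq_0) (auto elim!: eventually_mono simp: not_le intro: le_less_trans)

lemma F_meas[measurable]: "F \<in> borel_measurable borel"
  by (intro borel_measurable_mono monoI F_mono)

lemma F_tendsto_1: "(F \<longlongrightarrow> 1) at_top"
proof -
  interpret d: real_distribution "distr M borel (H 0)" by (rule real_distribution_distr) simp
  have "F = cdf (distr M borel (H 0))"
    unfolding cdf_def F_def by (auto simp: fun_eq_iff measure_distr intro!: arg_cong[where f=prob])
  then show ?thesis using d.cdf_lim_at_top_prob by simp
qed

text \<open>Given that the walk is at \<open>s\<close>, this is the probability that the next perturbed point falls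
  into the interval \<open>(a, b]\<close>.\<close>
definition hit_prob :: "real \<Rightarrow> real \<Rightarrow> real \<Rightarrow> real" where
  "hit_prob a b s = F (b - s) - F (a - s)"

definition centred_hits :: "nat \<Rightarrow> real \<Rightarrow> real \<Rightarrow> 'a \<Rightarrow> real" where
  "centred_hits n a b \<omega> = (\<Sum>k<n. of_bool (a < walk_X k \<omega> + H k \<omega> \<and> walk_X k \<omega> + H k \<omega> \<le> b) - hit_prob a b (walk_X k \<omega>))"

definition hit_variance :: "nat \<Rightarrow> real \<Rightarrow> real \<Rightarrow> 'a \<Rightarrow> real" where
  "hit_variance n a b \<omega> = (\<Sum>k<n. hit_prob a b (walk_X k \<omega>) * (1 - hit_prob a b (walk_X k \<omega>)))"

lemma hit_prob_meas[measurable]: "hit_prob a b \<in> borel_measurable borel"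
  unfolding hit_prob_def[abs_def] by measurable

lemma hit_prob_bounds: "a \<le> b \<Longrightarrow> 0 \<le> hit_prob a b s" "hit_prob a b s \<le> 1"
  using F_mono[of "a - s" "b - s"] F_bounds[of "a - s"] F_bounds[of "b - s"]
  unfolding hit_prob_def by auto

lemma centred_hits_meas[measurable]: "centred_hits n a b \<in> borel_measurable M"
  unfolding centred_hits_def[abs_def] by measurable

lemma hit_variance_meas[measurable]: "hit_variance n a b \<in> borel_measurable M"
  unfolding hit_variance_def[abs_def] by measurable

text \<open>The centred indicator is at most \<open>1\<close> in absolute value and has variance \<open>p (1 - p)\<close>, so the quadratic bound for the
  exponential applies.\<close>
lemma exp_moment_hit:
  assumes ab: "a \<le> b" and l: "\<bar>l\<bar> \<le> 1"
  shows "(\<integral>\<^sup>+\<omega>. ennreal (exp (l * (of_bool (a < s + H k \<omega> \<and> s + H k \<omega> \<le> b) - hit_prob a b s)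
           - 2 * l\<^sup>2 * (hit_prob a b s * (1 - hit_prob a b s)))) \<partial>M) \<le> 1"
proof -
  let ?p = "hit_prob a b s" and ?B = "\<lambda>\<omega>. of_bool (a < s + H k \<omega> \<and> s + H k \<omega> \<le> b) :: real"
  let ?v = "?p * (1 - ?p)"
  have p: "0 \<le> ?p" "?p \<le> 1" using hit_prob_bounds(1)[OF ab] hit_prob_bounds(2) by auto
  have v: "?v \<ge> 0" using p by simp
  have Bb: "\<bar>?B \<omega> - ?p\<bar> \<le> 1" for \<omega> using p by auto
  have iB: "integrable M ?B" by (rule integrable_const_bound[of _ 1]) auto
  have EB: "expectation ?B = ?p"
  proof -
    have "expectation ?B = expectation (indicator {\<omega>\<in>space M. a < s + H k \<omega> \<and> s + H k \<omega> \<le> b})"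
      by (intro Bochner_Integration.integral_cong) (auto simp: indicator_def)
    also have "\<dots> = prob {\<omega>\<in>space M. a < s + H k \<omega> \<and> s + H k \<omega> \<le> b}" by simp
    also have "{\<omega>\<in>space M. a < s + H k \<omega> \<and> s + H k \<omega> \<le> b}
       = {\<omega>\<in>space M. H k \<omega> \<le> b - s} - {\<omega>\<in>space M. H k \<omega> \<le> a - s}" by auto
    also have "prob \<dots> = prob {\<omega>\<in>space M. H k \<omega> \<le> b - s} - prob {\<omega>\<in>space M. H k \<omega> \<le> a - s}"
      using ab by (intro finite_measure_Diff) auto
    finally show ?thesis by (simp add: prob_H_le hit_prob_def)
  qed
  have iE: "integrable M (\<lambda>\<omega>. exp (l * (?B \<omega> - ?p)))"
  proof (rule integrable_const_bound[of _ "exp 1"])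
    have "l * (?B \<omega> - ?p) \<le> 1" for \<omega>
    proof -
      have "\<bar>l * (?B \<omega> - ?p)\<bar> \<le> 1 * 1" unfolding abs_mult using l Bb[of \<omega>] by (intro mult_mono) auto
      then show ?thesis by linarith
    qed
    then show "AE \<omega> in M. norm (exp (l * (?B \<omega> - ?p))) \<le> exp 1" by simp
  qed simp
  have "expectation (\<lambda>\<omega>. exp (l * (?B \<omega> - ?p)))
      \<le> expectation (\<lambda>\<omega>. 1 + l * (?B \<omega> - ?p) + 2 * l\<^sup>2 * (?B \<omega> * (1 - 2 * ?p) + ?p\<^sup>2))"
  proof (intro integral_mono iE)
    show "integrable M (\<lambda>\<omega>. 1 + l * (?B \<omega> - ?p) + 2 * l\<^sup>2 * (?B \<omega> * (1 - 2 * ?p) + ?p\<^sup>2))"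
      using iB by simp
    fix \<omega>
    let ?y = "l * (?B \<omega> - ?p)"
    have y1: "\<bar>?y\<bar> \<le> 1 * 1" unfolding abs_mult using l Bb[of \<omega>] by (intro mult_mono) auto
    then have "exp ?y \<le> 1 + ?y + 2 * ?y\<^sup>2" unfolding mult_1 by (rule exp_le_quadratic_unit)
    also have "?y\<^sup>2 = l\<^sup>2 * (?B \<omega> * (1 - 2 * ?p) + ?p\<^sup>2)"
      by (cases "a < s + H k \<omega> \<and> s + H k \<omega> \<le> b") (auto simp: power2_eq_square algebra_simps)
    finally show "exp ?y \<le> 1 + ?y + 2 * l\<^sup>2 * (?B \<omega> * (1 - 2 * ?p) + ?p\<^sup>2)" by simp
  qed
  also have "\<dots> = 1 + 2 * l\<^sup>2 * (?p * (1 - 2 * ?p) + ?p\<^sup>2)"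
    using iB by (simp add: EB prob_space)
  also have "?p * (1 - 2 * ?p) + ?p\<^sup>2 = ?v" by (simp add: power2_eq_square algebra_simps)
  also have "1 + 2 * l\<^sup>2 * ?v \<le> exp (2 * l\<^sup>2 * ?v)" by (rule exp_ge_add_one_self)
  finally have le: "expectation (\<lambda>\<omega>. exp (l * (?B \<omega> - ?p))) \<le> exp (2 * l\<^sup>2 * ?v)" .
  have "(\<integral>\<^sup>+\<omega>. ennreal (exp (l * (?B \<omega> - ?p) - 2 * l\<^sup>2 * ?v)) \<partial>M)
      = (\<integral>\<^sup>+\<omega>. ennreal (exp (l * (?B \<omega> - ?p))) * ennreal (exp (- (2 * l\<^sup>2 * ?v))) \<partial>M)"
    by (intro nn_integral_cong) (simp only: ennreal_mult'[symmetric] exp_ge_zero exp_add[symmetric] diff_conv_add_uminus)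
  also have "\<dots> = ennreal (expectation (\<lambda>\<omega>. exp (l * (?B \<omega> - ?p)))) * ennreal (exp (- (2 * l\<^sup>2 * ?v)))"
    using iE by (simp add: nn_integral_multc nn_integral_eq_integral)
  also have "\<dots> \<le> ennreal (exp (2 * l\<^sup>2 * ?v)) * ennreal (exp (- (2 * l\<^sup>2 * ?v)))"
    using le by (intro mult_right_mono ennreal_leI) auto
  also have "\<dots> = 1" by (simp add: ennreal_mult'[symmetric] exp_add[symmetric])
  finally show ?thesis .
qed

text \<open>The position of the walk before step \<open>k\<close> is a function of the earlier pairs, and the pair with index \<open>k\<close> is independent of
  them, although its two components may depend on each other. Therefore the sum minus its compensator is an exponential supermartingale. The random
  conditional variance is controlled by the event itself.\<close>
lemma prob_signed_centred_hits:
  assumes ab: "a \<le> b" and l: "\<bar>l\<bar> \<le> 1"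
  shows "prob {\<omega>\<in>space M. l * centred_hits n a b \<omega> \<ge> x \<and> hit_variance n a b \<omega> \<le> v} \<le> exp (- x + 2 * l\<^sup>2 * v)"
proof -
  let ?V = "\<lambda>k \<omega>. (X k \<omega>, H k \<omega>)"
  define f where "f k w v = l * (of_bool (a < (\<Sum>i<k. fst (w i)) + snd v \<and> (\<Sum>i<k. fst (w i)) + snd v \<le> b)
      - hit_prob a b (\<Sum>i<k. fst (w i)))
      - 2 * l\<^sup>2 * (hit_prob a b (\<Sum>i<k. fst (w i)) * (1 - hit_prob a b (\<Sum>i<k. fst (w i))))"
    for k and w :: "nat \<Rightarrow> real \<times> real" and v :: "real \<times> real"
  have fm: "(\<lambda>(w, v). f k w v) \<in> borel_measurable (PiM {..<k} (\<lambda>_. borel) \<Otimes>\<^sub>M borel)" for k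
  proof -
    have "(\<lambda>w. \<Sum>i<k. fst (w i)) \<in> borel_measurable (PiM {..<k} (\<lambda>_. borel :: (real \<times> real) measure))"
    proof (rule borel_measurable_sum)
      fix i assume "i \<in> {..<k}"
      then have "(\<lambda>w. w i) \<in> measurable (PiM {..<k} (\<lambda>_. borel :: (real \<times> real) measure)) borel"
        by (rule measurable_component_singleton)
      from measurable_compose[OF this fst_borel]
      show "(\<lambda>w. fst (w i)) \<in> borel_measurable (PiM {..<k} (\<lambda>_. borel :: (real \<times> real) measure))" .
    qed
    from measurable_compose[OF measurable_fst this]
    have [measurable]: "(\<lambda>p. \<Sum>i<k. fst (fst p i)) \<in> borel_measurable (PiM {..<k} (\<lambda>_. borel :: (real \<times> real) measure) \<Otimes>\<^sub>M (borel :: (real \<times> real) measure))" .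
    have [measurable]: "(\<lambda>p. snd (snd p)) \<in> borel_measurable (PiM {..<k} (\<lambda>_. borel :: (real \<times> real) measure) \<Otimes>\<^sub>M (borel :: (real \<times> real) measure))"
      by (rule measurable_compose[OF measurable_snd snd_borel])
    show ?thesis unfolding f_def case_prod_beta' by measurable
  qed
  have fle: "(\<integral>\<^sup>+\<omega>. ennreal (exp (f k w (?V k \<omega>))) \<partial>M) \<le> 1" for k w
    unfolding f_def using exp_moment_hit[OF ab l, of "\<Sum>i<k. fst (w i)" k] by simp
  let ?W = "\<lambda>k \<omega>. \<lambda>i\<in>{..<k}. ?V i \<omega>"
  have W: "(\<Sum>i<k. fst (?W k \<omega> i)) = walk_X k \<omega>" for k \<omega> by simp
  have eq: "(\<Sum>k<n. f k (?W k \<omega>) (?V k \<omega>)) = l * centred_hits n a b \<omega> - 2 * l\<^sup>2 * hit_variance n a b \<omega>" for \<omega>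
    unfolding f_def W centred_hits_def hit_variance_def fst_conv snd_conv
    by (simp only: sum_distrib_left sum_subtractf[symmetric])
  have "prob {\<omega>\<in>space M. l * centred_hits n a b \<omega> \<ge> x \<and> hit_variance n a b \<omega> \<le> v}
     \<le> prob {\<omega>\<in>space M. l * centred_hits n a b \<omega> - 2 * l\<^sup>2 * hit_variance n a b \<omega> \<ge> x - 2 * l\<^sup>2 * v}"
  proof (intro finite_measure_mono subsetI)
    fix \<omega> assume "\<omega> \<in> {\<omega>\<in>space M. l * centred_hits n a b \<omega> \<ge> x \<and> hit_variance n a b \<omega> \<le> v}"
    moreover from this have "2 * l\<^sup>2 * hit_variance n a b \<omega> \<le> 2 * l\<^sup>2 * v"
      by (intro mult_left_mono) auto
    ultimately show "\<omega> \<in> {\<omega>\<in>space M. l * centred_hits n a b \<omega> - 2 * l\<^sup>2 * hit_variance n a b \<omega> \<ge> x - 2 * l\<^sup>2 * v}"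
      by auto
  qed simp
  also have "\<dots> \<le> exp (- (x - 2 * l\<^sup>2 * v))"
  proof (rule prob_le_of_exp_moment)
    show "(\<integral>\<^sup>+\<omega>. ennreal (exp (l * centred_hits n a b \<omega> - 2 * l\<^sup>2 * hit_variance n a b \<omega>)) \<partial>M) \<le> 1"
      using exp_supermartingale[OF pair_indep fm fle, of n] unfolding eq .
  qed simp
  finally show ?thesis by simp
qed

end

section \<open>Almost sure bounds on two time scales\<close>

context perturbed_iid
begin

lemma bernstein_centred_hits:
  assumes ab: "a \<le> b" and l: "0 < l" "l \<le> 1"
  shows "prob {\<omega>\<in>space M. \<bar>centred_hits n a b \<omega>\<bar> \<ge> x \<and> hit_variance n a b \<omega> \<le> v} \<le> 2 * exp (- l * x + 2 * l\<^sup>2 * v)"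
proof -
  let ?P = "\<lambda>l. {\<omega>\<in>space M. l * centred_hits n a b \<omega> \<ge> \<bar>l\<bar> * x \<and> hit_variance n a b \<omega> \<le> v}"
  have "prob {\<omega>\<in>space M. \<bar>centred_hits n a b \<omega>\<bar> \<ge> x \<and> hit_variance n a b \<omega> \<le> v} \<le> prob (?P l \<union> ?P (- l))"
  proof (intro finite_measure_mono subsetI)
    fix \<omega> assume \<omega>: "\<omega> \<in> {\<omega>\<in>space M. \<bar>centred_hits n a b \<omega>\<bar> \<ge> x \<and> hit_variance n a b \<omega> \<le> v}"
    then have "l * x \<le> l * \<bar>centred_hits n a b \<omega>\<bar>" using l by (intro mult_left_mono) auto
    moreover have "l * \<bar>c\<bar> = l * c \<or> l * \<bar>c\<bar> = - l * c" for c :: real by (simp add: abs_if)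
    ultimately have "l * x \<le> l * centred_hits n a b \<omega> \<or> l * x \<le> - l * centred_hits n a b \<omega>" by metis
    moreover have "\<bar>l\<bar> = l" "\<bar>- l\<bar> = l" using l by auto
    ultimately show "\<omega> \<in> ?P l \<union> ?P (- l)" using \<omega> by (simp only: Un_iff mem_Collect_eq) blast
  qed simp
  also have "\<dots> \<le> prob (?P l) + prob (?P (- l))" by (rule measure_Un_le; measurable)
  also have "prob (?P l) \<le> exp (- (l * x) + 2 * l\<^sup>2 * v)"
    using prob_signed_centred_hits[OF ab, of l "\<bar>l\<bar> * x" n v] l by simp
  also have "prob (?P (- l)) \<le> exp (- (l * x) + 2 * l\<^sup>2 * v)"
    using prob_signed_centred_hits[OF ab, of "- l" "\<bar>- l\<bar> * x" n v] l by simp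
  finally show ?thesis by simp
qed

text \<open>The form in which Bernstein's inequality is applied: deviations can occur only finitely often, unless the
  conditional variance exceeds its bound infinitely often.\<close>
lemma borel_cantelli_centred_hits:
  fixes a b x v l :: "nat \<Rightarrow> real" and n :: "nat \<Rightarrow> nat"
  assumes ab: "\<And>j. a j \<le> b j" and l: "\<forall>\<^sub>F j in sequentially. 0 < l j \<and> l j \<le> 1"
    and s: "1 < s" and bd: "\<forall>\<^sub>F j in sequentially. - l j * x j + 2 * (l j)\<^sup>2 * v j \<le> - s * ln (real j)"
  shows "AE \<omega> in M. \<forall>\<^sub>F j in sequentially. hit_variance (n j) (a j) (b j) \<omega> \<le> v j \<longrightarrow> \<bar>centred_hits (n j) (a j) (b j) \<omega>\<bar> < x j"
proof -
  define G where "G j = {\<omega>\<in>space M. \<bar>centred_hits (n j) (a j) (b j) \<omega>\<bar> \<ge> x j \<and> hit_variance (n j) (a j) (b j) \<omega> \<le> v j}" for j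
  have G: "G j \<in> sets M" for j unfolding G_def by measurable
  have ev: "\<forall>\<^sub>F j in sequentially. norm (prob (G j)) \<le> 2 * real j powr (- s)"
    using l bd eventually_gt_at_top[of 0]
  proof eventually_elim
    case (elim j)
    have "prob (G j) \<le> 2 * exp (- l j * x j + 2 * (l j)\<^sup>2 * v j)"
      unfolding G_def using elim ab by (intro bernstein_centred_hits) auto
    also have "\<dots> \<le> 2 * exp (- s * ln (real j))" using elim by simp
    also have "exp (- s * ln (real j)) = real j powr (- s)" using elim by (simp add: powr_def)
    finally show ?case by simp
  qed
  have "summable (\<lambda>j. 2 * real j powr (- s))"
    using s by (intro summable_mult) (simp add: summable_real_powr_iff)
  then have "summable (\<lambda>j. prob (G j))" by (rule summable_comparison_test_ev[OF ev])
  then have "AE \<omega> in M. \<forall>\<^sub>F j in sequentially. \<omega> \<in> space M - G j"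
    using G by (intro borel_cantelli_AE1) (auto simp: emeasure_eq_measure)
  then show ?thesis
    by eventually_elim (auto elim!: eventually_mono simp: G_def not_le)
qed

text \<open>The sparse times \<open>exp (sqrt m)\<close>. At them \<open>ln t = sqrt m\<close>, so a bound \<open>(ln t) powr (- 3)\<close> is summable in \<open>m\<close>, and
  the gap after \<open>t\<close> is of order \<open>t / ln t\<close>.\<close>
definition coarse :: "nat \<Rightarrow> real" where "coarse m = exp (sqrt (real m))"

definition coarse_index :: "real \<Rightarrow> nat" where "coarse_index t = nat \<lfloor>(ln t)\<^sup>2\<rfloor>"

definition index_bound :: "real \<Rightarrow> nat" where "index_bound t = nat \<lceil>2 / \<mu> * t\<rceil>"

definition coarse_dev :: "real \<Rightarrow> 'a \<Rightarrow> bool" where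
  "coarse_dev e \<omega> \<longleftrightarrow> (\<forall>\<^sub>F m in sequentially.
     hit_variance (index_bound (coarse m)) 0 (coarse m) \<omega> \<le> e\<^sup>2 / 16 * coarse m \<longrightarrow>
     \<bar>centred_hits (index_bound (coarse m)) 0 (coarse m) \<omega>\<bar> < e * lil_scale (coarse m))"

definition fine_dev :: "real \<Rightarrow> 'a \<Rightarrow> bool" where
  "fine_dev e \<omega> \<longleftrightarrow> (\<forall>\<^sub>F j in sequentially.
     hit_variance (index_bound (real (Suc j))) (coarse (coarse_index (real (Suc j)))) (real (Suc j)) \<omega>
       \<le> e\<^sup>2 / 9 * (real (Suc j) * llog (real (Suc j)) / ln (real (Suc j))) \<longrightarrow>
     \<bar>centred_hits (index_bound (real (Suc j))) (coarse (coarse_index (real (Suc j)))) (real (Suc j)) \<omega>\<bar>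
       < e * lil_scale (real (Suc j)))"

text \<open>The parameter is \<open>4 llog t / (e lil_scale t)\<close>. With variance at most \<open>e\<^sup>2 t / 16\<close> the exponent becomes
  \<open>- 4 llog t + llog t = - 3 llog t\<close>.\<close>
lemma coarse_deviation:
  assumes e: "e > 0"
  shows "AE \<omega> in M. coarse_dev e \<omega>"
  unfolding coarse_dev_def
proof (rule borel_cantelli_centred_hits)
  let ?l = "\<lambda>m. 4 / e * (llog (coarse m) / lil_scale (coarse m))"
  have c: "coarse m > 0" for m by (simp add: coarse_def)
  have pos: "lil_scale (coarse m) > 0" "llog (coarse m) \<ge> 1" for m
    using c[of m] by (auto intro: lil_scale_pos llog_ge_1)
  have sq: "(lil_scale (coarse m))\<^sup>2 = 2 * coarse m * llog (coarse m)" for m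
    unfolding lil_scale_def using c[of m] pos(2)[of m] by (intro real_sqrt_pow2 mult_nonneg_nonneg) auto
  show "0 \<le> coarse m" for m using c[of m] by simp
  show "(1::real) < 5 / 4" by simp
  have "\<forall>\<^sub>F m in sequentially. ?l m \<le> 1"
    unfolding coarse_def lil_scale_def llog_def using e by real_asymp
  then show "\<forall>\<^sub>F m in sequentially. 0 < ?l m \<and> ?l m \<le> 1"
  proof eventually_elim
    case (elim m)
    then show ?case using e pos[of m] by (auto intro!: mult_pos_pos divide_pos_pos less_le_trans[OF zero_less_one])
  qed
  have "- ?l m * (e * lil_scale (coarse m)) + 2 * (?l m)\<^sup>2 * (e\<^sup>2 / 16 * coarse m) = - 3 * llog (coarse m)" for m
  proof -
    have "?l m * (e * lil_scale (coarse m)) = 4 * llog (coarse m)" using e pos(1)[of m] by simp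
    moreover have "2 * (?l m)\<^sup>2 * (e\<^sup>2 / 16 * coarse m) = 2 * coarse m * (llog (coarse m))\<^sup>2 / (lil_scale (coarse m))\<^sup>2"
      using e by (simp add: power_mult_distrib power_divide)
    moreover have "2 * coarse m * (llog (coarse m))\<^sup>2 / (lil_scale (coarse m))\<^sup>2 = llog (coarse m)"
      unfolding sq using c[of m] pos(2)[of m] by (simp add: power2_eq_square)
    ultimately show ?thesis by simp
  qed
  moreover have "\<forall>\<^sub>F m in sequentially. - 3 * llog (coarse m) \<le> - (5 / 4) * ln (real m)"
    unfolding coarse_def llog_def by real_asymp
  ultimately show "\<forall>\<^sub>F m in sequentially. - ?l m * (e * lil_scale (coarse m)) + 2 * (?l m)\<^sup>2 * (e\<^sup>2 / 16 * coarse m)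
     \<le> - (5 / 4) * ln (real m)" by simp
qed

text \<open>The square root of the integer part of \<open>(ln t)\<^sup>2\<close> differs from \<open>ln t\<close> by at most \<open>1 / ln t\<close>.\<close>
lemma coarse_index_bounds:
  assumes "t \<ge> 1"
  shows "coarse (coarse_index t) \<le> t" "ln t > 0 \<Longrightarrow> t - coarse (coarse_index t) \<le> t / ln t"
proof -
  let ?m = "real (coarse_index t)"
  have l: "ln t \<ge> 0" using assms by simp
  have m: "?m \<le> (ln t)\<^sup>2" "(ln t)\<^sup>2 < ?m + 1" 
    using zero_le_power2[of "ln t"] unfolding coarse_index_def by linarith+
  have "sqrt ?m \<le> ln t" using m(1) l by (intro real_le_lsqrt) auto
  then have "exp (sqrt ?m) \<le> exp (ln t)" by simp
  then show "coarse (coarse_index t) \<le> t" using assms by (simp add: coarse_def)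
  assume pos: "ln t > 0"
  have "(ln t - sqrt ?m) * (ln t + sqrt ?m) = (ln t)\<^sup>2 - ?m"
    by (simp add: power2_eq_square algebra_simps)
  also have "\<dots> \<le> 1" using m by simp
  finally have "(ln t - sqrt ?m) * (ln t + sqrt ?m) \<le> 1" .
  moreover have "(ln t - sqrt ?m) * ln t \<le> (ln t - sqrt ?m) * (ln t + sqrt ?m)"
    using \<open>sqrt ?m \<le> ln t\<close> by (intro mult_left_mono) auto
  ultimately have "(ln t - sqrt ?m) * ln t \<le> 1" by linarith
  then have gap: "ln t - sqrt ?m \<le> 1 / ln t" using pos by (simp add: field_simps)
  have "1 + (sqrt ?m - ln t) \<le> exp (sqrt ?m - ln t)" by (rule exp_ge_add_one_self)
  also have "\<dots> = coarse (coarse_index t) / t" using assms by (simp add: exp_diff coarse_def)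
  finally have "1 - 1 / ln t \<le> coarse (coarse_index t) / t" using gap by linarith
  then have "(1 - 1 / ln t) * t \<le> coarse (coarse_index t)" using assms by (simp add: le_divide_eq)
  then show "t - coarse (coarse_index t) \<le> t / ln t" by (simp add: algebra_simps)
qed

text \<open>Here the parameter is \<open>3 ln t / (e lil_scale t)\<close>, and the exponent is \<open>- 3 ln t + ln t = - 2 ln t\<close>. The permitted variance
  exceeds the order \<open>t / ln t\<close> of the true one by a factor \<open>llog t\<close>, so a random constant in the latter does not matter.\<close>
lemma fine_deviation:
  assumes e: "e > 0"
  shows "AE \<omega> in M. fine_dev e \<omega>"
  unfolding fine_dev_def
proof (rule borel_cantelli_centred_hits)
  define r where "r j = real j + 1" for j :: nat
  have r: "real (Suc j) = r j" for j by (simp add: r_def)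
  let ?l = "\<lambda>j. 3 / e * (ln (real (Suc j)) / lil_scale (real (Suc j)))"
  have pos: "lil_scale (r j) > 0" "llog (r j) \<ge> 1" for j
    unfolding r_def by (auto intro: lil_scale_pos llog_ge_1)
  have sq: "(lil_scale (r j))\<^sup>2 = 2 * r j * llog (r j)" for j
    unfolding lil_scale_def using pos(2)[of j] by (intro real_sqrt_pow2 mult_nonneg_nonneg) (auto simp: r_def)
  show "coarse (coarse_index (real (Suc j))) \<le> real (Suc j)" for j by (rule coarse_index_bounds) simp
  show "(1::real) < 5 / 4" by simp
  have "\<forall>\<^sub>F j in sequentially. ln (r j) / lil_scale (r j) \<le> e / 3"
    unfolding r_def lil_scale_def llog_def using e by real_asymp
  then have "\<forall>\<^sub>F j in sequentially. 0 < 3 / e * (ln (r j) / lil_scale (r j)) \<and> 3 / e * (ln (r j) / lil_scale (r j)) \<le> 1"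
    using eventually_gt_at_top[of 0]
  proof eventually_elim
    case (elim j)
    have "ln (r j) > 0" using elim by (simp add: r_def)
    then show ?case using e elim(1) pos(1)[of j] by (simp add: field_simps)
  qed
  then show "\<forall>\<^sub>F j in sequentially. 0 < ?l j \<and> ?l j \<le> 1" unfolding r .
  have "\<forall>\<^sub>F j in sequentially. - 2 * ln (r j) \<le> - (5 / 4) * ln (real j)"
    unfolding r_def by real_asymp
  then show "\<forall>\<^sub>F j in sequentially. - ?l j * (e * lil_scale (real (Suc j))) + 2 * (?l j)\<^sup>2 * (e\<^sup>2 / 9 * (real (Suc j) * llog (real (Suc j)) / ln (real (Suc j))))
     \<le> - (5 / 4) * ln (real j)"
    unfolding r using eventually_gt_at_top[of 0]
  proof eventually_elim
    case (elim j)
    let ?L = "3 / e * (ln (r j) / lil_scale (r j))"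
    have ln: "ln (r j) > 0" using elim by (simp add: r_def)
    have rp: "r j > 0" by (simp add: r_def)
    have "?L * (e * lil_scale (r j)) = 3 * ln (r j)" using e pos(1)[of j] by simp
    moreover have "2 * ?L\<^sup>2 * (e\<^sup>2 / 9 * (r j * llog (r j) / ln (r j)))
        = 2 * r j * llog (r j) * ((ln (r j))\<^sup>2 / ln (r j)) / (lil_scale (r j))\<^sup>2"
      using e by (simp add: power_mult_distrib power_divide)
    moreover have "2 * r j * llog (r j) * ((ln (r j))\<^sup>2 / ln (r j)) / (lil_scale (r j))\<^sup>2 = ln (r j)"
      unfolding sq using rp pos(2)[of j] ln by (simp add: power2_eq_square)
    ultimately show ?case using elim by simp
  qed
qed

end

section \<open>Means and variances along a fixed path\<close>

context perturbed_iid
begin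

text \<open>Fubini's theorem on the region \<open>H 0 \<le> y \<le> t\<close>.\<close>
lemma integral_F:
  assumes "t \<ge> 0"
  shows "(LBINT y:{0..t}. F y) = expectation (\<lambda>\<omega>. max 0 (t - H 0 \<omega>))"
proof -
  have H0: "AE \<omega> in M. H 0 \<omega> > 0" using AE_positive by eventually_elim auto
  interpret P: pair_sigma_finite lborel M ..
  let ?g = "\<lambda>y \<omega>. indicator {0..t} y * of_bool (H 0 \<omega> \<le> y) :: real"
  have gm[measurable]: "(\<lambda>(y, \<omega>). ?g y \<omega>) \<in> borel_measurable (lborel \<Otimes>\<^sub>M M)"
    by measurable
  have gm2[measurable]: "(\<lambda>(\<omega>, y). ?g y \<omega>) \<in> borel_measurable (M \<Otimes>\<^sub>M lborel)"
    by measurable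
  have inner1: "(\<integral>\<^sup>+\<omega>. ennreal (?g y \<omega>) \<partial>M) = ennreal (indicator {0..t} y * F y)" for y
  proof -
    have "(\<integral>\<^sup>+\<omega>. ennreal (?g y \<omega>) \<partial>M) = (\<integral>\<^sup>+\<omega>. ennreal (indicator {0..t} y) * indicator {\<omega>\<in>space M. H 0 \<omega> \<le> y} \<omega> \<partial>M)"
      by (intro nn_integral_cong) (auto simp: indicator_def)
    also have "\<dots> = ennreal (indicator {0..t} y) * emeasure M {\<omega>\<in>space M. H 0 \<omega> \<le> y}"
      by (intro nn_integral_cmult_indicator) auto
    finally show ?thesis by (simp add: emeasure_eq_measure F_def ennreal_mult'[symmetric])
  qed
  have inner2: "(\<integral>\<^sup>+y. ennreal (?g y \<omega>) \<partial>lborel) = ennreal (max 0 (t - H 0 \<omega>))" if "H 0 \<omega> > 0" for \<omega>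
  proof -
    have "(\<integral>\<^sup>+y. ennreal (?g y \<omega>) \<partial>lborel) = (\<integral>\<^sup>+y. indicator {H 0 \<omega>..t} y \<partial>lborel)"
      using that by (intro nn_integral_cong) (auto simp: indicator_def)
    also have "\<dots> = emeasure lborel {H 0 \<omega>..t}" by simp
    also have "\<dots> = ennreal (max 0 (t - H 0 \<omega>))" by (cases "H 0 \<omega> \<le> t") (auto simp: max_def)
    finally show ?thesis .
  qed
  have "(\<integral>\<^sup>+y. ennreal (indicator {0..t} y * F y) \<partial>lborel) = (\<integral>\<^sup>+y. (\<integral>\<^sup>+\<omega>. ennreal (?g y \<omega>) \<partial>M) \<partial>lborel)"
    by (simp only: inner1)
  also have "\<dots> = (\<integral>\<^sup>+\<omega>. (\<integral>\<^sup>+y. ennreal (?g y \<omega>) \<partial>lborel) \<partial>M)"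
    by (rule P.Fubini'[symmetric]) measurable
  also have "\<dots> = (\<integral>\<^sup>+\<omega>. ennreal (max 0 (t - H 0 \<omega>)) \<partial>M)"
    using H0 by (intro nn_integral_cong_AE) (auto elim!: eventually_mono simp: inner2)
  finally have eq: "(\<integral>\<^sup>+y. ennreal (indicator {0..t} y * F y) \<partial>lborel) = (\<integral>\<^sup>+\<omega>. ennreal (max 0 (t - H 0 \<omega>)) \<partial>M)" .
  have "(LBINT y:{0..t}. F y) = enn2real (\<integral>\<^sup>+y. ennreal (indicator {0..t} y * F y) \<partial>lborel)"
    unfolding set_lebesgue_integral_def real_scaleR_def
    by (rule integral_eq_nn_integral) (auto simp: F_bounds)
  also have "\<dots> = expectation (\<lambda>\<omega>. max 0 (t - H 0 \<omega>))"
    unfolding eq by (rule integral_eq_nn_integral[symmetric]) auto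
  finally show ?thesis .
qed

end

text \<open>A fixed outcome \<open>\<omega>\<close> with a regular path of the walk. Expectations over \<open>\<omega>'\<close> below integrate the perturbation
  \<open>H 0\<close> alone, with the path held fixed.\<close>
locale sample_path = perturbed_iid +
  fixes \<omega> :: 'a
  assumes sample_positive: "\<And>k. X k \<omega> > 0 \<and> H k \<omega> > 0"
    and sample_renewal: "renewal_path (\<lambda>n. walk_X n \<omega>) \<mu> (2 * \<sigma>)"
begin

sublocale path: renewal_path "\<lambda>n. walk_X n \<omega>" \<mu> "2 * \<sigma>"
  by (rule sample_renewal)

lemma N_meas[measurable]: "(\<lambda>s. real (path.N s)) \<in> borel_measurable borel"
  by (intro borel_measurable_mono monoI) (simp add: path.N_mono)

lemma AE_H_pos: "AE \<omega>' in M. H 0 \<omega>' > 0"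
  using AE_positive by eventually_elim auto

lemma integrable_H_gt: "integrable M (indicator {\<omega>'\<in>space M. \<not> H 0 \<omega>' \<le> A} :: 'a \<Rightarrow> real)"
  by (rule integrable_const_bound[of _ 1]) (auto intro: borel_measurable_indicator)

lemma expectation_H_gt:
  "expectation (\<lambda>\<omega>'. c + d * indicator {\<omega>'\<in>space M. \<not> H 0 \<omega>' \<le> A} \<omega>') = c + d * (1 - F A)"
proof -
  let ?E = "{\<omega>'\<in>space M. \<not> H 0 \<omega>' \<le> A}"
  have "expectation (\<lambda>\<omega>'. c + d * indicator ?E \<omega>') = expectation (\<lambda>\<omega>'. c) + expectation (\<lambda>\<omega>'. d * indicator ?E \<omega>')"
    by (intro Bochner_Integration.integral_add integrable_mult_right integrable_H_gt) simp
  also have "expectation (\<lambda>\<omega>'. d * indicator ?E \<omega>') = d * expectation (indicator ?E)"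
    by (rule Bochner_Integration.integral_mult_right_zero)
  also have "expectation (indicator ?E) = prob (?E \<inter> space M)" by (rule Bochner_Integration.integral_indicator)
  also have "?E \<inter> space M = ?E" by auto
  also have "prob ?E = 1 - F A" unfolding F_def by (rule prob_neg) simp
  finally show ?thesis by (simp add: prob_space)
qed

lemma integrable_N: "integrable M (\<lambda>\<omega>'. real (path.N (t - H 0 \<omega>')))"
  using AE_H_pos by (intro integrable_const_bound[of _ "real (path.N t)"]) (auto elim!: eventually_mono intro: path.N_mono)

text \<open>\<open>F (t - S\<^sub>k)\<close> is the probability that the \<open>k\<close>-th renewal lies below \<open>t - H 0\<close>; summation over \<open>k\<close> and
  integration over the perturbation are interchanged.\<close>
lemma mean_count:
  assumes n: "n \<ge> path.N t"
  shows "(\<Sum>k<n. F (t - walk_X k \<omega>)) = expectation (\<lambda>\<omega>'. real (path.N (t - H 0 \<omega>')))"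
proof -
  let ?B = "\<lambda>k \<omega>'. of_bool (walk_X k \<omega> \<le> t - H 0 \<omega>') :: real"
  have iB: "integrable M (?B k)" for k by (rule integrable_const_bound[of _ 1]) auto
  have EB: "expectation (?B k) = F (t - walk_X k \<omega>)" for k
  proof -
    have "expectation (?B k) = expectation (indicator {\<omega>'\<in>space M. H 0 \<omega>' \<le> t - walk_X k \<omega>})"
      by (intro Bochner_Integration.integral_cong) (auto simp: indicator_def)
    then show ?thesis by (simp add: F_def)
  qed
  have "(\<Sum>k<n. F (t - walk_X k \<omega>)) = expectation (\<lambda>\<omega>'. \<Sum>k<n. ?B k \<omega>')"
    unfolding Bochner_Integration.integral_sum[OF iB] EB ..
  also have "\<dots> = expectation (\<lambda>\<omega>'. real (path.N (t - H 0 \<omega>')))"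
  proof (rule integral_cong_AE)
    show "AE \<omega>' in M. (\<Sum>k<n. ?B k \<omega>') = real (path.N (t - H 0 \<omega>'))"
      using AE_H_pos
    proof eventually_elim
      case (elim \<omega>')
      have "path.N (t - H 0 \<omega>') \<le> n" using path.N_mono[of "t - H 0 \<omega>'" t] elim n by simp
      then have "{..<n} \<inter> {k. walk_X k \<omega> \<le> t - H 0 \<omega>'} = {..<path.N (t - H 0 \<omega>')}"
        unfolding path.S_le_eq by auto
      then show ?case by (simp add: sum.If_cases of_bool_def)
    qed
  qed auto
  finally show ?thesis .
qed

text \<open>Perturbations up to \<open>A\<close> move \<open>D\<close> by at most the number of renewals in a window of length \<open>A\<close> plus the drift;
  larger ones move it by at most \<open>2 K\<close> but are rare.\<close>
lemma mean_shift_bound: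
  assumes K: "\<forall>s\<le>t. \<bar>path.D s\<bar> \<le> K" and A: "A \<ge> 0"
  shows "\<bar>expectation (\<lambda>\<omega>'. path.D (t - H 0 \<omega>')) - path.D t\<bar>
    \<le> (real (path.N t) - real (path.N (t - A))) + A / \<mu> + 2 * K * (1 - F A)"
proof -
  let ?w = "real (path.N t) - real (path.N (t - A))"
  have K0: "K \<ge> 0" using K by (meson abs_ge_zero order.trans order_refl)
  have w0: "?w \<ge> 0" using path.N_mono[of "t - A" t] A by simp
  have Dm: "(\<lambda>\<omega>'. path.D (t - H 0 \<omega>')) \<in> borel_measurable M"
    unfolding path.D_def by measurable
  have iD: "integrable M (\<lambda>\<omega>'. path.D (t - H 0 \<omega>'))"
    using AE_H_pos K by (intro integrable_const_bound[of _ K] Dm) (auto elim!: eventually_mono)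
  let ?I = "indicator {\<omega>'\<in>space M. \<not> H 0 \<omega>' \<le> A} :: 'a \<Rightarrow> real"
  have pt: "AE \<omega>' in M. \<bar>path.D (t - H 0 \<omega>') - path.D t\<bar> \<le> ?w + A / \<mu> + 2 * K * ?I \<omega>'"
    using AE_H_pos AE_space
  proof eventually_elim
    case (elim \<omega>')
    let ?h = "H 0 \<omega>'"
    show ?case
    proof (cases "?h \<le> A")
      case True
      have "real (path.N (t - A)) \<le> real (path.N (t - ?h))" "real (path.N (t - ?h)) \<le> real (path.N t)"
        using True elim path.N_mono[of "t - A" "t - ?h"] path.N_mono[of "t - ?h" t] by auto
      moreover have "\<bar>max 0 (t - ?h) / \<mu> - max 0 t / \<mu>\<bar> \<le> A / \<mu>"
        using True elim path.\<mu> by (simp add: diff_divide_distrib[symmetric] abs_divide divide_right_mono)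
      ultimately have "\<bar>path.D (t - ?h) - path.D t\<bar> \<le> ?w + A / \<mu>" unfolding path.D_def by linarith
      then show ?thesis using True by simp
    next
      case False
      have "\<bar>path.D (t - ?h)\<bar> \<le> K" "\<bar>path.D t\<bar> \<le> K" using K elim by auto
      then have "\<bar>path.D (t - ?h) - path.D t\<bar> \<le> 2 * K" by linarith
      moreover have "A / \<mu> \<ge> 0" using A path.\<mu> by simp
      ultimately show ?thesis using False elim w0 by simp
    qed
  qed
  have "\<bar>expectation (\<lambda>\<omega>'. path.D (t - H 0 \<omega>')) - path.D t\<bar> = \<bar>expectation (\<lambda>\<omega>'. path.D (t - H 0 \<omega>') - path.D t)\<bar>"
    using iD by (simp add: prob_space)
  also have "\<dots> \<le> expectation (\<lambda>\<omega>'. \<bar>path.D (t - H 0 \<omega>') - path.D t\<bar>)"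
    by (rule integral_abs_bound)
  also have "\<dots> \<le> expectation (\<lambda>\<omega>'. ?w + A / \<mu> + 2 * K * ?I \<omega>')"
    using iD pt by (intro integral_mono_AE Bochner_Integration.integrable_add integrable_mult_right integrable_H_gt) auto
  also have "\<dots> = ?w + A / \<mu> + 2 * K * (1 - F A)" by (rule expectation_H_gt)
  finally show ?thesis .
qed

lemma obtain_tail:
  assumes "e > 0" obtains A where "A \<ge> 0" "1 - F A < e"
proof -
  have "\<forall>\<^sub>F A in at_top. F A > 1 - e \<and> A \<ge> 0"
    using order_tendstoD(1)[OF F_tendsto_1, of "1 - e"] assms eventually_ge_at_top[of 0]
    by (auto intro: eventually_conj)
  then obtain A where "F A > 1 - e" "A \<ge> 0" by (auto dest: eventually_happens)
  then show ?thesis using that[of A] by auto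
qed

lemma mean_shift_negligible: "((\<lambda>t. (expectation (\<lambda>\<omega>'. path.D (t - H 0 \<omega>')) - path.D t) / lil_scale t) \<longlongrightarrow> 0) at_top"
proof (rule tendstoI)
  fix e :: real assume e: "e > 0"
  obtain K where K: "K > 0" "\<forall>\<^sub>F t in at_top. \<forall>s\<le>t. \<bar>path.D s\<bar> \<le> K * lil_scale t"
    using path.D_bound by blast
  obtain A where A: "A \<ge> 0" "1 - F A < e / (8 * K)" using obtain_tail[of "e / (8 * K)"] e K by auto
  have w: "\<forall>\<^sub>F t in at_top. \<forall>s\<le>t. real (path.N s) - real (path.N (s - A)) \<le> e / 4 * lil_scale t"
    using e by (intro path.window_count) simp
  have a: "\<forall>\<^sub>F t in at_top. A / \<mu> \<le> e / 4 * lil_scale t"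
    unfolding lil_scale_def llog_def using e by real_asymp
  show "\<forall>\<^sub>F t in at_top. dist ((expectation (\<lambda>\<omega>'. path.D (t - H 0 \<omega>')) - path.D t) / lil_scale t) 0 < e"
    using K(2) w a eventually_gt_at_top[of 0]
  proof eventually_elim
    case (elim t)
    have l: "lil_scale t > 0" using elim by (simp add: lil_scale_pos)
    have "2 * (K * lil_scale t) * (1 - F A) \<le> 2 * (K * lil_scale t) * (e / (8 * K))"
      using A l K by (intro mult_left_mono) auto
    also have "\<dots> = e / 4 * lil_scale t" using K by simp
    finally have "\<bar>expectation (\<lambda>\<omega>'. path.D (t - H 0 \<omega>')) - path.D t\<bar> \<le> 3 * (e / 4 * lil_scale t)"
      using mean_shift_bound[OF elim(1) A(1)] elim(2)[rule_format, of t] elim(3) by linarith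
    also have "\<dots> < e * lil_scale t" using e l by simp
    finally show ?case using l by (simp add: dist_real_def abs_divide pos_divide_less_eq)
  qed
qed

lemma mean_D:
  assumes "t \<ge> 0" "n \<ge> path.N t"
  shows "expectation (\<lambda>\<omega>'. path.D (t - H 0 \<omega>')) = (\<Sum>k<n. F (t - walk_X k \<omega>)) - (LBINT y:{0..t}. F y) / \<mu>"
proof -
  have "integrable M (\<lambda>\<omega>'. max 0 (t - H 0 \<omega>'))"
    using AE_H_pos assms(1) by (intro integrable_const_bound[of _ t]) (auto elim!: eventually_mono)
  then show ?thesis
    unfolding path.D_def mean_count[OF assms(2)] integral_F[OF assms(1)]
    using integrable_N[of t] by simp
qed

text \<open>Indices from \<open>N t\<close> on contribute \<open>0\<close>, as positive perturbations cannot bring the walk back below \<open>t\<close>;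
  so every larger number of summands gives the same value.\<close>
definition fluctuation :: "real \<Rightarrow> real" where
  "fluctuation t = centred_hits (path.N t) 0 t \<omega>"

lemma walk_nonneg: "walk_X k \<omega> \<ge> 0"
  by (rule path.S_nonneg)

lemma centred_hits_from_0:
  "centred_hits n 0 t \<omega> = (\<Sum>k<n. of_bool (walk_X k \<omega> + H k \<omega> \<le> t) - F (t - walk_X k \<omega>))"
proof -
  have "0 < walk_X k \<omega> + H k \<omega>" "hit_prob 0 t (walk_X k \<omega>) = F (t - walk_X k \<omega>)" for k
    using walk_nonneg[of k] sample_positive[of k] F_nonpos[of "- walk_X k \<omega>"] by (auto simp: hit_prob_def)
  then show ?thesis unfolding centred_hits_def by simp
qed

lemma not_yet:
  assumes "path.N t \<le> k"
  shows "\<not> walk_X k \<omega> + H k \<omega> \<le> t" "F (t - walk_X k \<omega>) = 0"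
proof -
  have "walk_X k \<omega> > t" using assms path.less_N_iff[of k t] by simp
  then show "\<not> walk_X k \<omega> + H k \<omega> \<le> t" "F (t - walk_X k \<omega>) = 0"
    using sample_positive[of k] F_nonpos[of "t - walk_X k \<omega>"] by auto
qed

lemma fluctuation_eq:
  assumes "n \<ge> path.N t"
  shows "fluctuation t = (\<Sum>k<n. of_bool (walk_X k \<omega> + H k \<omega> \<le> t)) - (\<Sum>k<n. F (t - walk_X k \<omega>))"
proof -
  have "fluctuation t = (\<Sum>k<n. of_bool (walk_X k \<omega> + H k \<omega> \<le> t) - F (t - walk_X k \<omega>))"
    unfolding fluctuation_def centred_hits_from_0
    using assms not_yet by (intro sum.mono_neutral_left) auto
  then show ?thesis by (simp only: sum_subtractf)
qed

lemma centred_hits_eq: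
  assumes "0 \<le> a" "a \<le> b" "n \<ge> path.N b"
  shows "centred_hits n a b \<omega> = fluctuation b - fluctuation a"
proof -
  have n: "n \<ge> path.N a" using assms path.N_mono[of a b] by simp
  have "of_bool (a < walk_X k \<omega> + H k \<omega> \<and> walk_X k \<omega> + H k \<omega> \<le> b) - hit_prob a b (walk_X k \<omega>)
     = (of_bool (walk_X k \<omega> + H k \<omega> \<le> b) - F (b - walk_X k \<omega>)) - (of_bool (walk_X k \<omega> + H k \<omega> \<le> a) - F (a - walk_X k \<omega>) :: real)" for k
    using assms(2) by (auto simp: hit_prob_def)
  then show ?thesis
    unfolding centred_hits_def fluctuation_eq[OF n] fluctuation_eq[OF assms(3)] by (simp only: sum_subtractf)
qed

text \<open>Each summand is at most \<open>1 - F (t - S\<^sub>k)\<close>, and these add up to the mean number of renewals in \<open>(t - H 0, t]\<close>. For bounded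
  perturbations this is a window count, and large perturbations have small probability.\<close>
lemma coarse_variance:
  assumes d: "\<delta> > 0"
  shows "\<forall>\<^sub>F t in at_top. \<forall>n\<ge>path.N t. hit_variance n 0 t \<omega> \<le> \<delta> * t"
proof -
  obtain A where A: "A \<ge> 0" "1 - F A < \<delta> * \<mu> / 4" using obtain_tail[of "\<delta> * \<mu> / 4"] d path.\<mu> by auto
  have w: "\<forall>\<^sub>F t in at_top. \<forall>s\<le>t. real (path.N s) - real (path.N (s - A)) \<le> 1 * lil_scale t"
    by (intro path.window_count) simp
  have l: "\<forall>\<^sub>F t in at_top. lil_scale t \<le> \<delta> / 2 * t"
    unfolding lil_scale_def llog_def using d by real_asymp
  show ?thesis
    using w l path.N_le_linear eventually_ge_at_top[of 0]
  proof eventually_elim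
    case (elim t)
    show ?case
    proof (intro allI impI)
      fix n assume n: "n \<ge> path.N t"
      have hp: "hit_prob 0 t (walk_X k \<omega>) = F (t - walk_X k \<omega>)" for k
        using walk_nonneg[of k] F_nonpos[of "- walk_X k \<omega>"] by (simp add: hit_prob_def)
      have "hit_variance n 0 t \<omega> = (\<Sum>k<path.N t. F (t - walk_X k \<omega>) * (1 - F (t - walk_X k \<omega>)))"
        unfolding hit_variance_def hp using n not_yet by (intro sum.mono_neutral_right) auto
      also have "\<dots> \<le> (\<Sum>k<path.N t. 1 - F (t - walk_X k \<omega>))"
        using F_bounds by (intro sum_mono mult_left_le_one_le) auto
      also have "\<dots> = real (path.N t) - (\<Sum>k<path.N t. F (t - walk_X k \<omega>))"
        by (simp add: sum_subtractf)
      also have "\<dots> = expectation (\<lambda>\<omega>'. real (path.N t) - real (path.N (t - H 0 \<omega>')))"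
        using integrable_N[of t] by (simp add: mean_count prob_space)
      also have "\<dots> \<le> expectation (\<lambda>\<omega>'. (real (path.N t) - real (path.N (t - A)))
            + real (path.N t) * indicator {\<omega>'\<in>space M. \<not> H 0 \<omega>' \<le> A} \<omega>')"
      proof (rule integral_mono_AE)
        show "AE \<omega>' in M. real (path.N t) - real (path.N (t - H 0 \<omega>')) \<le> (real (path.N t) - real (path.N (t - A)))
            + real (path.N t) * indicator {\<omega>'\<in>space M. \<not> H 0 \<omega>' \<le> A} \<omega>'"
          using AE_space
        proof eventually_elim
          case (elim \<omega>')
          show ?case
            using elim path.N_mono[of "t - A" "t - H 0 \<omega>'"] path.N_mono[of "t - A" t] A(1)
            by (cases "H 0 \<omega>' \<le> A") auto
        qed
      qed (auto intro!: Bochner_Integration.integrable_add Bochner_Integration.integrable_diff integrable_mult_right integrable_H_gt integrable_N)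
      also have "\<dots> = (real (path.N t) - real (path.N (t - A))) + real (path.N t) * (1 - F A)"
        by (rule expectation_H_gt)
      also have "real (path.N t) * (1 - F A) \<le> (2 / \<mu> * t) * (\<delta> * \<mu> / 4)"
        using A elim F_bounds[of A] by (intro mult_mono) auto
      also have "\<dots> = \<delta> / 2 * t" using path.\<mu> by simp
      finally show "hit_variance n 0 t \<omega> \<le> \<delta> * t"
        using elim(1)[rule_format, of t] elim(2) by simp
    qed
  qed
qed

lemma mean_increment_le:
  assumes K: "\<forall>s\<le>t. real (path.N s) - real (path.N (s - (t - a))) \<le> K" and n: "n \<ge> path.N t" and a: "a \<le> t"
  shows "(\<Sum>k<n. F (t - walk_X k \<omega>)) - (\<Sum>k<n. F (a - walk_X k \<omega>)) \<le> K"
proof -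
  have na: "n \<ge> path.N a" using path.N_mono[OF a] n by simp
  have "(\<Sum>k<n. F (t - walk_X k \<omega>)) - (\<Sum>k<n. F (a - walk_X k \<omega>))
     = expectation (\<lambda>\<omega>'. real (path.N (t - H 0 \<omega>')) - real (path.N (a - H 0 \<omega>')))"
    unfolding mean_count[OF n] mean_count[OF na] using integrable_N by simp
  also have "\<dots> \<le> expectation (\<lambda>\<omega>'. K)"
  proof (rule integral_mono_AE)
    show "AE \<omega>' in M. real (path.N (t - H 0 \<omega>')) - real (path.N (a - H 0 \<omega>')) \<le> K"
      using AE_H_pos
    proof eventually_elim
      case (elim \<omega>')
      have eq: "t - H 0 \<omega>' - (t - a) = a - H 0 \<omega>'" by simp
      show ?case using K[rule_format, of "t - H 0 \<omega>'"] elim unfolding eq by simp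
    qed
  qed (use integrable_N in auto)
  also have "\<dots> = K" by (simp add: prob_space)
  finally show ?thesis .
qed

text \<open>Each summand is at most the hitting probability, and these add up to the mean number of renewals in a
  window of length \<open>t - a\<close> that is shifted by the perturbation.\<close>
lemma increment_variance:
  assumes K: "\<forall>s\<le>t. \<bar>path.D s\<bar> \<le> K" and n: "n \<ge> path.N t" and a: "a \<le> t"
  shows "hit_variance n a t \<omega> \<le> (t - a) / \<mu> + 2 * K"
proof -
  have "hit_variance n a t \<omega> \<le> (\<Sum>k<n. hit_prob a t (walk_X k \<omega>))"
    unfolding hit_variance_def using hit_prob_bounds(1)[OF a] hit_prob_bounds(2)
    by (intro sum_mono mult_right_le_one_le) auto
  also have "\<dots> = (\<Sum>k<n. F (t - walk_X k \<omega>)) - (\<Sum>k<n. F (a - walk_X k \<omega>))"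
    by (simp add: hit_prob_def sum_subtractf)
  also have "\<dots> \<le> (t - a) / \<mu> + 2 * K"
  proof (rule mean_increment_le[OF _ n a], intro allI impI)
    fix s assume "s \<le> t"
    then show "real (path.N s) - real (path.N (s - (t - a))) \<le> (t - a) / \<mu> + 2 * K"
      using path.N_increment_le[OF K, of "t - a" "s - (t - a)"] a by simp
  qed
  finally show ?thesis .
qed

end

section \<open>Negligible fluctuations and the expansion of the counting process\<close>

context sample_path
begin

lemma fluctuation_0: "fluctuation 0 = 0"
proof -
  have "\<not> walk_X k \<omega> + H k \<omega> \<le> 0" "F (0 - walk_X k \<omega>) = 0" for k
    using walk_nonneg[of k] sample_positive[of k] F_nonpos[of "0 - walk_X k \<omega>"] by auto
  then show ?thesis unfolding fluctuation_eq[OF order_refl] by simp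
qed

lemma N_le_index_bound: "\<forall>\<^sub>F t in at_top. path.N t \<le> index_bound t"
  using path.N_le_linear
proof eventually_elim
  case (elim t)
  then have "int (path.N t) \<le> \<lceil>2 / \<mu> * t\<rceil>" by linarith
  then show ?case unfolding index_bound_def by linarith
qed

text \<open>The value at an integer is the value at the preceding sparse time plus an increment. Both are small,
  since the variance bounds required by the two deviation estimates hold eventually on a regular path.\<close>
lemma fluctuation_grid:
  assumes e: "e > 0"
    and coarse_dev: "coarse_dev e \<omega>" and fine_dev: "fine_dev e \<omega>"
  shows "\<forall>\<^sub>F j in sequentially. \<bar>fluctuation (real j)\<bar> \<le> 2 * e * lil_scale (real j)"
proof -
  have coarse_lim: "filterlim coarse at_top sequentially"
    unfolding coarse_def[abs_def] by real_asymp
  have "e\<^sup>2 / 16 > 0" using e by simp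
  note cv = filterlim_iff[THEN iffD1, OF coarse_lim, rule_format, OF coarse_variance[OF this]]
  note cs = filterlim_iff[THEN iffD1, OF coarse_lim, rule_format, OF N_le_index_bound]
  have at_coarse: "\<forall>\<^sub>F m in sequentially. \<bar>fluctuation (coarse m)\<bar> < e * lil_scale (coarse m)"
    using coarse_dev[unfolded coarse_dev_def] cv cs
  proof eventually_elim
    case (elim m)
    have "coarse m \<ge> 0" by (simp add: coarse_def)
    from centred_hits_eq[OF order_refl this elim(3)] elim show ?case by (simp add: fluctuation_0)
  qed
  have ci: "filterlim (\<lambda>j. coarse_index (real (Suc j))) at_top sequentially"
  proof -
    have "filterlim (\<lambda>j. nat \<lfloor>(ln (real j + 1))\<^sup>2\<rfloor>) at_top sequentially" by real_asymp
    then show ?thesis unfolding coarse_index_def by (simp add: add.commute)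
  qed
  obtain K where K: "K > 0" "\<forall>\<^sub>F t in at_top. \<forall>s\<le>t. \<bar>path.D s\<bar> \<le> K * lil_scale t"
    using path.D_bound by blast
  have small: "\<forall>\<^sub>F t in at_top. (t / ln t) / \<mu> + 2 * (K * lil_scale t) \<le> e\<^sup>2 / 9 * (t * llog t / ln t)"
    unfolding lil_scale_def llog_def using e K(1) path.\<mu> by real_asymp
  have Suc_lim: "filterlim (\<lambda>j. real (Suc j)) at_top sequentially"
    by (rule filterlim_compose[OF filterlim_real_sequentially filterlim_Suc])
  have "\<forall>\<^sub>F t in at_top. (\<forall>s\<le>t. \<bar>path.D s\<bar> \<le> K * lil_scale t) \<and>
      (t / ln t) / \<mu> + 2 * (K * lil_scale t) \<le> e\<^sup>2 / 9 * (t * llog t / ln t) \<and> path.N t \<le> index_bound t \<and> t > 1"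
    using K(2) small N_le_index_bound eventually_gt_at_top[of 1] by eventually_elim simp
  note t = filterlim_iff[THEN iffD1, OF Suc_lim, rule_format, OF this]
  have "\<forall>\<^sub>F j in sequentially. \<bar>fluctuation (real (Suc j))\<bar> \<le> 2 * e * lil_scale (real (Suc j))"
    using t fine_dev[unfolded fine_dev_def] filterlim_iff[THEN iffD1, OF ci, rule_format, OF at_coarse]
  proof eventually_elim
    case (elim j)
    define t where "t = real (Suc j)"
    define a where "a = coarse (coarse_index t)"
    note el = elim[folded t_def, folded a_def]
    have t1: "t > 1" "ln t > 0" using el(1) by auto
    have a: "0 \<le> a" "a \<le> t" "t - a \<le> t / ln t"
      using coarse_index_bounds[of t] t1 unfolding a_def by (auto simp: coarse_def)
    have "hit_variance (index_bound t) a t \<omega> \<le> (t - a) / \<mu> + 2 * (K * lil_scale t)"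
      using el(1) a by (intro increment_variance) auto
    also have "\<dots> \<le> (t / ln t) / \<mu> + 2 * (K * lil_scale t)"
      using a path.\<mu> by (intro add_right_mono divide_right_mono) auto
    also have "\<dots> \<le> e\<^sup>2 / 9 * (t * llog t / ln t)" using el(1) by simp
    finally have "\<bar>centred_hits (index_bound t) a t \<omega>\<bar> < e * lil_scale t" using el(2) by simp
    moreover have "centred_hits (index_bound t) a t \<omega> = fluctuation t - fluctuation a"
      using a el(1) by (intro centred_hits_eq) auto
    moreover have "\<bar>fluctuation a\<bar> < e * lil_scale a" using el(3) .
    moreover have "e * lil_scale a \<le> e * lil_scale t" using a e by (intro mult_left_mono lil_scale_mono) auto
    ultimately have "\<bar>fluctuation t\<bar> \<le> 2 * (e * lil_scale t)" by linarith
    then show ?case unfolding t_def by simp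
  qed
  then show ?thesis by (subst (asm) eventually_sequentially_Suc)
qed

text \<open>Both the count and its compensator increase in time, so the fluctuation varies between grid points
  by no more than the increment of the compensator.\<close>
lemma fluctuation_between:
  assumes "0 \<le> a" "a \<le> t" "t \<le> b" "n \<ge> path.N b"
    and inc: "(\<Sum>k<n. F (b - walk_X k \<omega>)) - (\<Sum>k<n. F (a - walk_X k \<omega>)) \<le> K"
  shows "\<bar>fluctuation t\<bar> \<le> max \<bar>fluctuation a\<bar> \<bar>fluctuation b\<bar> + K"
proof -
  have n: "n \<ge> path.N a" "n \<ge> path.N t" using assms path.N_mono[of a b] path.N_mono[of t b] by auto
  have B: "(\<Sum>k<n. of_bool (walk_X k \<omega> + H k \<omega> \<le> x) :: real) \<le> (\<Sum>k<n. of_bool (walk_X k \<omega> + H k \<omega> \<le> y))" if "x \<le> y" for x y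
    using that by (intro sum_mono) auto
  have A: "(\<Sum>k<n. F (x - walk_X k \<omega>)) \<le> (\<Sum>k<n. F (y - walk_X k \<omega>))" if "x \<le> y" for x y
    using that by (intro sum_mono F_mono) auto
  have "fluctuation t \<le> fluctuation b + K" "fluctuation a - K \<le> fluctuation t"
    unfolding fluctuation_eq[OF n(1)] fluctuation_eq[OF n(2)] fluctuation_eq[OF assms(4)]
    using B[OF assms(2)] B[OF assms(3)] A[OF assms(2)] A[OF assms(3)] inc by linarith+
  then show ?thesis by linarith
qed

lemma fluctuation_negligible:
  assumes coarse_dev: "\<And>i::nat. coarse_dev (1 / (real i + 1)) \<omega>"
    and fine_dev: "\<And>i::nat. fine_dev (1 / (real i + 1)) \<omega>"
  shows "((\<lambda>t. fluctuation t / lil_scale t) \<longlongrightarrow> 0) at_top"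
proof (rule tendstoI)
  fix \<epsilon> :: real assume \<epsilon>: "\<epsilon> > 0"
  then have "\<epsilon> / 8 > 0" by simp
  then obtain i where "inverse (real (Suc i)) < \<epsilon> / 8" using reals_Archimedean by blast
  then have i: "1 / (real i + 1) < \<epsilon> / 8" by (simp add: inverse_eq_divide add.commute)
  define e where "e = 1 / (real i + 1)"
  have e: "e > 0" "e < \<epsilon> / 8" using i by (auto simp: e_def)
  have grid: "\<forall>\<^sub>F j in sequentially. \<bar>fluctuation (real j)\<bar> \<le> 2 * e * lil_scale (real j)"
    using fluctuation_grid[OF e(1)] coarse_dev[of i] fine_dev[of i] unfolding e_def by blast
  have J: "filterlim (\<lambda>t::real. nat \<lfloor>t\<rfloor>) at_top at_top" by real_asymp
  have SJ: "filterlim (\<lambda>t::real. Suc (nat \<lfloor>t\<rfloor>)) at_top at_top"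
    by (rule filterlim_compose[OF filterlim_Suc J])
  have rSJ: "filterlim (\<lambda>t::real. real (Suc (nat \<lfloor>t\<rfloor>))) at_top at_top"
    by (rule filterlim_compose[OF filterlim_real_sequentially SJ])
  have w: "\<forall>\<^sub>F t in at_top. \<forall>s\<le>t. real (path.N s) - real (path.N (s - 1)) \<le> e * lil_scale t"
    by (rule path.window_count[OF e(1)])
  have sc: "\<forall>\<^sub>F t::real in at_top. lil_scale (t + 1) \<le> 2 * lil_scale t"
    unfolding lil_scale_def llog_def by real_asymp
  show "\<forall>\<^sub>F t in at_top. dist (fluctuation t / lil_scale t) 0 < \<epsilon>"
    using filterlim_iff[THEN iffD1, OF J, rule_format, OF grid]
      filterlim_iff[THEN iffD1, OF SJ, rule_format, OF grid]
      filterlim_iff[THEN iffD1, OF rSJ, rule_format, OF w] sc eventually_gt_at_top[of 1]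
  proof eventually_elim
    case (elim t)
    define j where "j = nat \<lfloor>t\<rfloor>"
    have j: "real j \<le> t" "t \<le> real (Suc j)" "real (Suc j) \<le> t + 1" unfolding j_def using elim by linarith+
    note el = elim[folded j_def]
    have l: "lil_scale t > 0" using elim by (simp add: lil_scale_pos)
    have mono: "lil_scale (real j) \<le> lil_scale (real (Suc j))" "lil_scale (real (Suc j)) \<le> lil_scale (t + 1)"
      using j by (auto intro!: lil_scale_mono)
    have "\<bar>fluctuation t\<bar> \<le> max \<bar>fluctuation (real j)\<bar> \<bar>fluctuation (real (Suc j))\<bar> + e * lil_scale (real (Suc j))"
    proof (rule fluctuation_between[OF _ j(1,2) order_refl])
      have "real (Suc j) - real j = 1" by simp
      then show "(\<Sum>k<path.N (real (Suc j)). F (real (Suc j) - walk_X k \<omega>)) - (\<Sum>k<path.N (real (Suc j)). F (real j - walk_X k \<omega>))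
          \<le> e * lil_scale (real (Suc j))"
        using el(3) by (intro mean_increment_le) auto
    qed simp
    also have "max \<bar>fluctuation (real j)\<bar> \<bar>fluctuation (real (Suc j))\<bar> \<le> 2 * e * lil_scale (real (Suc j))"
    proof -
      have "2 * e * lil_scale (real j) \<le> 2 * e * lil_scale (real (Suc j))"
        using mono e by (intro mult_left_mono) auto
      then show ?thesis using el(1,2) by simp
    qed
    also have "2 * e * lil_scale (real (Suc j)) + e * lil_scale (real (Suc j)) = 3 * e * lil_scale (real (Suc j))" by simp
    also have "\<dots> \<le> 3 * e * (2 * lil_scale t)"
      using mono el(4) e by (intro mult_left_mono) auto
    also have "\<dots> = 6 * e * lil_scale t" by simp
    also have "\<dots> < \<epsilon> * lil_scale t" using e l by (intro mult_strict_right_mono) auto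
    finally show ?case using l by (simp add: dist_real_def abs_divide pos_divide_less_eq)
  qed
qed

text \<open>The three errors in \<open>Y - \<mu>\<^sup>-\<^sup>1 \<integral> F = fluctuation + (E D(t - \<eta>) - D(t)) + D(t)\<close> and in the approximation of
  \<open>D\<close> by the centred walk at \<open>N t\<close> are added up.\<close>
theorem hits_expansion:
  assumes fl: "((\<lambda>t. fluctuation t / lil_scale t) \<longlongrightarrow> 0) at_top"
  shows "((\<lambda>t. ((\<Sum>k<path.N t. of_bool (walk_X k \<omega> + H k \<omega> \<le> t)) - inverse \<mu> * (LBINT y:{0..t}. F y)
      + (walk_X (path.N t) \<omega> - real (path.N t) * \<mu>) / \<mu>) / lil_scale t) \<longlongrightarrow> 0) at_top"
proof -
  have "((\<lambda>t. fluctuation t / lil_scale t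
      + (expectation (\<lambda>\<omega>'. path.D (t - H 0 \<omega>')) - path.D t) / lil_scale t
      + (path.D t + (walk_X (path.N t) \<omega> - real (path.N t) * \<mu>) / \<mu>) / lil_scale t) \<longlongrightarrow> 0 + 0 + 0) at_top"
    by (intro tendsto_add fl mean_shift_negligible path.D_approx)
  then have "((\<lambda>t. fluctuation t / lil_scale t
      + (expectation (\<lambda>\<omega>'. path.D (t - H 0 \<omega>')) - path.D t) / lil_scale t
      + (path.D t + (walk_X (path.N t) \<omega> - real (path.N t) * \<mu>) / \<mu>) / lil_scale t) \<longlongrightarrow> 0) at_top" by simp
  then show ?thesis
  proof (rule Lim_transform_eventually)
    show "\<forall>\<^sub>F t in at_top. fluctuation t / lil_scale t
      + (expectation (\<lambda>\<omega>'. path.D (t - H 0 \<omega>')) - path.D t) / lil_scale t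
      + (path.D t + (walk_X (path.N t) \<omega> - real (path.N t) * \<mu>) / \<mu>) / lil_scale t
      = ((\<Sum>k<path.N t. of_bool (walk_X k \<omega> + H k \<omega> \<le> t)) - inverse \<mu> * (LBINT y:{0..t}. F y)
      + (walk_X (path.N t) \<omega> - real (path.N t) * \<mu>) / \<mu>) / lil_scale t"
      using eventually_ge_at_top[of 0]
    proof eventually_elim
      case (elim t)
      show ?case
        unfolding fluctuation_eq[OF order_refl] mean_D[OF elim order_refl] add_divide_distrib[symmetric]
        by (simp add: field_simps)
    qed
  qed
qed

end

text \<open>As \<open>N\<close> takes all positive integer values at the times \<open>\<tau>\<close>, which tend to infinity, no limit point of \<open>w\<close> is lost
  in the change of time. The sign change does not affect the symmetric interval.\<close>
lemma limit_points_via_renewal: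
  fixes Q :: "real \<Rightarrow> real" and w :: "nat \<Rightarrow> real" and N :: "real \<Rightarrow> nat" and \<tau> :: "nat \<Rightarrow> real"
  assumes Q: "((\<lambda>t. Q t + w (N t)) \<longlongrightarrow> 0) at_top" and N: "filterlim N at_top at_top"
    and \<tau>: "filterlim \<tau> at_top sequentially" "\<And>k. N (\<tau> k) = Suc k"
    and bound: "\<And>\<delta>. \<delta> > 0 \<Longrightarrow> \<forall>\<^sub>F n in sequentially. \<bar>w n\<bar> \<le> 1 + \<delta>"
    and cluster: "\<And>c e. c \<in> {-1..1} \<Longrightarrow> e > 0 \<Longrightarrow> \<exists>\<^sub>F n in sequentially. \<bar>w n - c\<bar> < e"
  shows "limit_points a Q = {-1..1}"
proof (intro equalityI subsetI)
  fix c assume "c \<in> limit_points a Q"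
  then obtain s :: "nat \<Rightarrow> real" where s: "filterlim s at_top sequentially" "(\<lambda>n. Q (s n)) \<longlonglongrightarrow> c"
    unfolding limit_points_def by auto
  have "(\<lambda>n. (Q (s n) + w (N (s n))) - Q (s n)) \<longlonglongrightarrow> 0 - c"
    by (intro tendsto_diff filterlim_compose[OF Q s(1)] s(2))
  then have w: "(\<lambda>n. \<bar>w (N (s n))\<bar>) \<longlonglongrightarrow> \<bar>- c\<bar>" by (intro tendsto_rabs) simp
  have "\<bar>c\<bar> \<le> 1 + \<delta>" if "\<delta> > 0" for \<delta>
  proof -
    have "\<forall>\<^sub>F n in sequentially. \<bar>w (N (s n))\<bar> \<le> 1 + \<delta>"
      using filterlim_iff[THEN iffD1, OF filterlim_compose[OF N s(1)], rule_format, OF bound[OF that]] .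
    from tendsto_upperbound[OF w this] show ?thesis by simp
  qed
  then have "\<bar>c\<bar> \<le> 1" by (rule field_le_epsilon)
  then show "c \<in> {-1..1}" by auto
next
  fix c :: real assume "c \<in> {-1..1}"
  then have c: "- c \<in> {-1..1}" by auto
  have "\<exists>k. \<tau> k > a \<and> \<tau> k > real i \<and> \<bar>w (Suc k) + c\<bar> < 1 / real (Suc i)" for i :: nat
  proof -
    have "\<forall>\<^sub>F k in sequentially. max a (real i) < \<tau> k" using \<tau>(1) unfolding filterlim_at_top_dense by blast
    then obtain k0 where k0: "\<And>k. k \<ge> k0 \<Longrightarrow> max a (real i) < \<tau> k" by (auto simp: eventually_sequentially)
    have "\<exists>\<^sub>F n in sequentially. \<bar>w n - - c\<bar> < 1 / real (Suc i)" by (rule cluster[OF c]) simp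
    then obtain n where n: "n \<ge> Suc k0" "\<bar>w n - - c\<bar> < 1 / real (Suc i)"
      unfolding frequently_sequentially by blast
    then show ?thesis using k0[of "n - 1"] by (intro exI[of _ "n - 1"]) auto
  qed
  then obtain k where k: "\<And>i. \<tau> (k i) > a" "\<And>i. \<tau> (k i) > real i" "\<And>i. \<bar>w (Suc (k i)) + c\<bar> < 1 / real (Suc i)"
    by metis
  have lim: "filterlim (\<lambda>i. \<tau> (k i)) at_top sequentially"
    by (rule filterlim_at_top_mono[OF filterlim_real_sequentially]) (intro always_eventually allI less_imp_le k(2))
  have "(\<lambda>i. w (Suc (k i)) + c) \<longlonglongrightarrow> 0"
  proof (rule Lim_null_comparison)
    show "\<forall>\<^sub>F i in sequentially. norm (w (Suc (k i)) + c) \<le> 1 / real (Suc i)"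
      using k(3) by (auto intro!: always_eventually less_imp_le)
    show "(\<lambda>i. 1 / real (Suc i)) \<longlonglongrightarrow> 0" using LIMSEQ_inverse_real_of_nat by (simp add: inverse_eq_divide)
  qed
  from tendsto_diff[OF filterlim_compose[OF Q lim] this]
  have "(\<lambda>i. Q (\<tau> (k i)) - c) \<longlonglongrightarrow> 0" by (simp add: \<tau>(2))
  then have "(\<lambda>i. Q (\<tau> (k i))) \<longlonglongrightarrow> c" by (simp add: LIM_zero_iff)
  then show "c \<in> limit_points a Q"
    unfolding limit_points_def using k(1) lim by (intro CollectI exI[of _ "\<lambda>i. \<tau> (k i)"]) auto
qed

section \<open>The law of the iterated logarithm for the perturbed walk\<close>

context sample_path
begin

text \<open>The normalisation in \<open>t\<close> and the scale at \<open>N t\<close> match: the constants \<open>\<sigma> / \<mu>\<close> from the inversion of the walk,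
  \<open>sqrt (1 / \<mu>)\<close> from \<open>N t \<sim> t / \<mu>\<close>, and \<open>sqrt (\<mu>\<^sup>3 / \<sigma>\<^sup>2)\<close> from the normalisation multiply to \<open>1\<close>.\<close>
lemma normalised_hits_vs_walk:
  fixes w :: "nat \<Rightarrow> real"
  defines "w \<equiv> \<lambda>n. (\<Sum>i<n. (X i \<omega> - \<mu>) / \<sigma>) / lil_scale (real n)"
  assumes fl: "((\<lambda>t. fluctuation t / lil_scale t) \<longlongrightarrow> 0) at_top"
    and bounded: "\<forall>\<^sub>F n in sequentially. \<bar>w n\<bar> \<le> 2"
  shows "((\<lambda>t. ((\<Sum>k<path.N t. of_bool (walk_X k \<omega> + H k \<omega> \<le> t)) - inverse \<mu> * (LBINT y:{0..t}. F y))
       / sqrt (2 * \<sigma>\<^sup>2 * (1 / \<mu> ^ 3) * t * ln (ln t)) + w (path.N t)) \<longlongrightarrow> 0) at_top"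
proof -
  let ?Z = "\<lambda>t. (\<Sum>k<path.N t. of_bool (walk_X k \<omega> + H k \<omega> \<le> t)) - inverse \<mu> * (LBINT y:{0..t}. F y)"
  \<comment> \<open>The part of the expansion that is negligible on the scale.\<close>
  let ?E = "\<lambda>t. ?Z t + (walk_X (path.N t) \<omega> - real (path.N t) * \<mu>) / \<mu>"
  let ?den = "\<lambda>t. sqrt (2 * \<sigma>\<^sup>2 * (1 / \<mu> ^ 3) * t * ln (ln t))"
  define c where "c = sqrt (\<sigma>\<^sup>2 / \<mu> ^ 3)"
  have \<mu>0: "\<mu> > 0" by (rule path.\<mu>)
  have c: "c > 0" unfolding c_def using \<mu>0 \<sigma> by simp
  have den: "?den t = c * sqrt (2 * t * ln (ln t))" for t
    unfolding c_def real_sqrt_mult[symmetric] by (simp add: mult_ac)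
  have ratio: "((\<lambda>t. lil_scale t / ?den t) \<longlongrightarrow> 1 / c) at_top"
  proof -
    have "((\<lambda>t. lil_scale t / sqrt (2 * t * ln (ln t))) \<longlongrightarrow> 1) at_top"
      unfolding lil_scale_def llog_def by real_asymp
    from tendsto_mult[OF tendsto_const[of "1 / c"] this] show ?thesis unfolding den by simp
  qed
  define r where "r t = (\<sigma> / \<mu>) * ((lil_scale (path.N t) / lil_scale t) * (lil_scale t / ?den t))" for t
  have one: "(\<sigma> / \<mu>) * (sqrt (1 / \<mu>) * (1 / c)) = 1"
  proof -
    have "c = sqrt ((\<sigma> / \<mu>)\<^sup>2 * (1 / \<mu>))"
      unfolding c_def by (simp add: power_divide power2_eq_square power3_eq_cube)
    also have "\<dots> = (\<sigma> / \<mu>) * sqrt (1 / \<mu>)"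
      unfolding real_sqrt_mult using \<mu>0 \<sigma> by simp
    finally have "(\<sigma> / \<mu>) * sqrt (1 / \<mu>) = c" by simp
    then have "(\<sigma> / \<mu>) * (sqrt (1 / \<mu>) * (1 / c)) = c * (1 / c)" by (simp only: mult.assoc[symmetric])
    then show ?thesis using c \<sigma> by simp
  qed
  have "(r \<longlongrightarrow> (\<sigma> / \<mu>) * (sqrt (1 / \<mu>) * (1 / c))) at_top"
    unfolding r_def[abs_def] by (intro tendsto_mult tendsto_const path.lil_scale_N_ratio ratio)
  then have r: "(r \<longlongrightarrow> 1) at_top" unfolding one .
  have rw: "((\<lambda>t. (1 - r t) * w (path.N t)) \<longlongrightarrow> 0) at_top"
  proof (rule Lim_null_comparison)
    show "\<forall>\<^sub>F t in at_top. norm ((1 - r t) * w (path.N t)) \<le> \<bar>1 - r t\<bar> * 2"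
      using filterlim_iff[THEN iffD1, OF path.N_at_top, rule_format, OF bounded]
      by eventually_elim (simp only: real_norm_def abs_mult mult_left_mono abs_ge_zero)
    have "((\<lambda>t. \<bar>1 - r t\<bar> * 2) \<longlongrightarrow> \<bar>1 - 1\<bar> * 2) at_top" by (intro tendsto_intros r)
    then show "((\<lambda>t. \<bar>1 - r t\<bar> * 2) \<longlongrightarrow> 0) at_top" by simp
  qed
  have "((\<lambda>t. ?E t / lil_scale t * (lil_scale t / ?den t) + (1 - r t) * w (path.N t)) \<longlongrightarrow> 0 * (1 / c) + 0) at_top"
    by (intro tendsto_add tendsto_mult hits_expansion[OF fl] ratio rw)
  then have "((\<lambda>t. ?E t / lil_scale t * (lil_scale t / ?den t) + (1 - r t) * w (path.N t)) \<longlongrightarrow> 0) at_top"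
    by simp
  then show ?thesis
  proof (rule Lim_transform_eventually)
    show "\<forall>\<^sub>F t in at_top. ?E t / lil_scale t * (lil_scale t / ?den t) + (1 - r t) * w (path.N t)
        = ?Z t / ?den t + w (path.N t)"
      using eventually_gt_at_top[of 0]
    proof eventually_elim
      case (elim t)
      have l: "lil_scale t > 0" "lil_scale (path.N t) > 0"
        using elim path.N_pos[of t] by (auto intro!: lil_scale_pos)
      have combine: "(z + d) / s * (s / D) + (1 - q) * y = z / D + y"
        if "d = a * (y * m)" "q = a * (m / D)" "s > 0" for z d s D q y a m :: real
        using that by (simp add: add_divide_distrib algebra_simps)
      show ?case
      proof (rule combine[OF _ _ l(1)])
        show "(walk_X (path.N t) \<omega> - real (path.N t) * \<mu>) / \<mu> = (\<sigma> / \<mu>) * (w (path.N t) * lil_scale (path.N t))"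
          unfolding w_def walk_standardised using l \<sigma> by simp
        show "r t = (\<sigma> / \<mu>) * (lil_scale (path.N t) / ?den t)" unfolding r_def using l by simp
      qed
    qed
  qed
qed

end

context perturbed_iid
begin

text \<open>The counting process enters only through its finite sums: \<open>Y t\<close> may be any quantity that equals the number of hits among
  the first \<open>n\<close> points whenever the walk has passed \<open>t\<close> by time \<open>n\<close>.\<close>
theorem AE_limit_points:
  "AE \<omega> in M. \<forall>Y. (\<forall>n t. (\<forall>k. walk_X k \<omega> \<le> t \<longrightarrow> k < n) \<longrightarrow> Y t = (\<Sum>k<n. of_bool (walk_X k \<omega> + H k \<omega> \<le> t))) \<longrightarrow>
     limit_points (exp 1) (\<lambda>t. (Y t - inverse \<mu> * (LBINT y:{0..t}. F y))
       / sqrt (2 * \<sigma>\<^sup>2 * (1 / \<mu> ^ 3) * t * ln (ln t))) = {-1..1}"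
proof -
  have pos: "1 / (real i + 1) > 0" for i by simp
  have coarse: "AE \<omega> in M. \<forall>i::nat. coarse_dev (1 / (real i + 1)) \<omega>"
    unfolding AE_all_countable using coarse_deviation[OF pos] by blast
  have fine: "AE \<omega> in M. \<forall>i::nat. fine_dev (1 / (real i + 1)) \<omega>"
    unfolding AE_all_countable using fine_deviation[OF pos] by blast
  show ?thesis
    using AE_positive AE_renewal_path std.lil_cluster coarse fine
  proof eventually_elim
    case (elim \<omega>)
    interpret S: sample_path M X H \<mu> \<sigma> \<omega>
    proof (rule sample_path.intro[OF perturbed_iid_axioms sample_path_axioms.intro])
      show "X k \<omega> > 0 \<and> H k \<omega> > 0" for k using elim(1) by (rule spec)
    qed (rule elim(2))
    let ?w = "\<lambda>n. (\<Sum>i<n. (X i \<omega> - \<mu>) / \<sigma>) / lil_scale (real n)"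
    have bound: "\<forall>\<^sub>F n in sequentially. \<bar>?w n\<bar> \<le> 1 + \<delta>" if \<delta>: "\<delta> > 0" for \<delta>
    proof -
      have "\<forall>\<^sub>F n in sequentially. \<bar>\<Sum>i<n. (X i \<omega> - \<mu>) / \<sigma>\<bar> \<le> (1 + \<delta>) * lil_scale n"
        using elim(3) \<delta> by blast
      then show ?thesis using eventually_gt_at_top[of 0]
      proof eventually_elim
        case (elim n)
        then have "lil_scale (real n) > 0" by (intro lil_scale_pos) simp
        then show ?case using elim(1) by (simp add: abs_divide pos_divide_le_eq)
      qed
    qed
    have fl: "((\<lambda>t. S.fluctuation t / lil_scale t) \<longlongrightarrow> 0) at_top"
      by (rule S.fluctuation_negligible) (use elim(4,5) in blast)+
    have b2: "\<forall>\<^sub>F n in sequentially. \<bar>?w n\<bar> \<le> 2" using bound[OF zero_less_one] by simp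
    show ?case
    proof (intro allI impI)
      fix Y :: "real \<Rightarrow> real"
      assume Y: "\<forall>n t. (\<forall>k. walk_X k \<omega> \<le> t \<longrightarrow> k < n) \<longrightarrow> Y t = (\<Sum>k<n. of_bool (walk_X k \<omega> + H k \<omega> \<le> t))"
      have "\<forall>k. walk_X k \<omega> \<le> t \<longrightarrow> k < S.path.N t" for t using S.path.less_N_iff by simp
      then have Y': "Y t = (\<Sum>k<S.path.N t. of_bool (walk_X k \<omega> + H k \<omega> \<le> t))" for t using Y by blast
      show "limit_points (exp 1) (\<lambda>t. (Y t - inverse \<mu> * (LBINT y:{0..t}. F y))
       / sqrt (2 * \<sigma>\<^sup>2 * (1 / \<mu> ^ 3) * t * ln (ln t))) = {-1..1}"
        unfolding Y'
      proof (rule limit_points_via_renewal[OF S.normalised_hits_vs_walk[OF fl b2] S.path.N_at_top])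
        show "S.path.N (walk_X k \<omega>) = Suc k" for k by (rule S.path.N_S)
        show "filterlim (\<lambda>k. walk_X k \<omega>) at_top sequentially"
          unfolding filterlim_at_top
        proof
          fix Z
          show "\<forall>\<^sub>F k in sequentially. Z \<le> walk_X k \<omega>"
            using eventually_ge_at_top[of "S.path.N Z"]
          proof eventually_elim
            case (elim k)
            then show ?case using S.path.less_N_iff[of k Z] by simp
          qed
        qed
        show "\<exists>\<^sub>F n in sequentially. \<bar>?w n - c\<bar> < e" if "c \<in> {-1..1}" "e > 0" for c e
          using elim(3) that by blast
      qed (rule bound)
    qed
  qed
qed

end

lemma (in prob_space) indep_vars_Suc:
  assumes "indep_vars (\<lambda>_. N) V {1..}"
  shows "indep_vars (\<lambda>_. N) (\<lambda>k. V (Suc k)) UNIV"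
proof -
  have "indep_vars (\<lambda>k. PiM {Suc k} (\<lambda>_. N)) (\<lambda>k \<omega>. \<lambda>i\<in>{Suc k}. V i \<omega>) UNIV"
    by (rule indep_vars_restrict[OF assms]) (auto simp: disjoint_family_on_def)
  from indep_vars_compose2[OF this, of "\<lambda>k f. f (Suc k)" "\<lambda>_. N"] show ?thesis by simp
qed

theorem theorem1:
  fixes M :: "'a measure"
    and \<xi> \<eta> :: "'a \<Rightarrow> real"
    and X H :: "nat \<Rightarrow> 'a \<Rightarrow> real"
    and \<mu> \<sigma> :: real
  assumes "prob_space M"
    and "\<xi> \<in> borel_measurable M" "\<eta> \<in> borel_measurable M"
    and "AE \<omega> in M. \<xi> \<omega> > 0 \<and> \<eta> \<omega> > 0"
    and "prob_space.indep_vars M (\<lambda>_. borel) (\<lambda>k \<omega>. (X k \<omega>, H k \<omega>)) {1..}"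
    and "\<And>k. k \<ge> 1 \<Longrightarrow>
           distr M borel (\<lambda>\<omega>. (X k \<omega>, H k \<omega>)) = distr M borel (\<lambda>\<omega>. (\<xi> \<omega>, \<eta> \<omega>))"
    and "integrable M \<xi>" "\<mu> = prob_space.expectation M \<xi>"
    and "integrable M (\<lambda>\<omega>. (\<xi> \<omega> - \<mu>)\<^sup>2)" "\<sigma>\<^sup>2 = prob_space.variance M \<xi>" "\<sigma> > 0"
  shows "AE \<omega> in M.
    limit_points (exp 1)
      (\<lambda>t. (counting_process X H t \<omega> - inverse \<mu> * (LBINT y:{0..t}. \<P>(\<omega>' in M. \<eta> \<omega>' \<le> y)))
            / sqrt (2 * \<sigma>\<^sup>2 * (1 / \<mu> ^ 3) * t * ln (ln t)))
    = {-1..1}"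
proof -
  interpret prob_space M by fact
  note [measurable] = assms(2,3)
  have ind: "indep_vars (\<lambda>_. borel) (\<lambda>k \<omega>. (X (Suc k) \<omega>, H (Suc k) \<omega>)) UNIV"
    by (rule indep_vars_Suc[OF assms(5)])
  have pm: "(\<lambda>\<omega>. (X (Suc 0) \<omega>, H (Suc 0) \<omega>)) \<in> borel_measurable M"
    using ind unfolding indep_vars_def by auto
  have xm: "(\<lambda>\<omega>. (\<xi> \<omega>, \<eta> \<omega>)) \<in> borel_measurable M" by measurable
  have deq: "distr M borel (\<lambda>\<omega>. (X (Suc 0) \<omega>, H (Suc 0) \<omega>)) = distr M borel (\<lambda>\<omega>. (\<xi> \<omega>, \<eta> \<omega>))"
    by (rule assms(6)) simp
  have transfer_E: "expectation (\<lambda>\<omega>. g (X (Suc 0) \<omega>)) = expectation (\<lambda>\<omega>. g (\<xi> \<omega>))"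
    and transfer_I: "integrable M (\<lambda>\<omega>. g (X (Suc 0) \<omega>)) \<longleftrightarrow> integrable M (\<lambda>\<omega>. g (\<xi> \<omega>))"
    if g: "g \<in> borel_measurable borel" for g :: "real \<Rightarrow> real"
  proof -
    have gf: "(\<lambda>p :: real \<times> real. g (fst p)) \<in> borel_measurable borel" by (rule measurable_compose[OF fst_borel g])
    show "expectation (\<lambda>\<omega>. g (X (Suc 0) \<omega>)) = expectation (\<lambda>\<omega>. g (\<xi> \<omega>))"
      using integral_distr[OF pm gf] integral_distr[OF xm gf] deq by simp
    show "integrable M (\<lambda>\<omega>. g (X (Suc 0) \<omega>)) \<longleftrightarrow> integrable M (\<lambda>\<omega>. g (\<xi> \<omega>))"
      using integrable_distr_eq[OF pm gf] integrable_distr_eq[OF xm gf] deq by simp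
  qed
  have pos: "AE \<omega> in M. X (Suc 0) \<omega> > 0 \<and> H (Suc 0) \<omega> > 0"
  proof -
    have A: "{x \<in> space borel. fst x > (0::real) \<and> snd x > (0::real)} \<in> sets borel"
      using fst_borel snd_borel by measurable
    have "(AE p in distr M borel (\<lambda>\<omega>. (\<xi> \<omega>, \<eta> \<omega>)). fst p > 0 \<and> snd p > 0)"
      by (subst AE_distr_iff[OF xm A]) (use assms(4) in simp)
    then have "(AE p in distr M borel (\<lambda>\<omega>. (X (Suc 0) \<omega>, H (Suc 0) \<omega>)). fst p > 0 \<and> snd p > 0)"
      unfolding deq .
    then show ?thesis by (subst (asm) AE_distr_iff[OF pm A]) simp
  qed
  interpret P: perturbed_iid M "\<lambda>k. X (Suc k)" "\<lambda>k. H (Suc k)" \<mu> \<sigma>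
  proof
    show "distr M borel (\<lambda>\<omega>. (X (Suc k) \<omega>, H (Suc k) \<omega>)) = distr M borel (\<lambda>\<omega>. (X (Suc 0) \<omega>, H (Suc 0) \<omega>))" for k
      using assms(6)[of "Suc k"] deq by simp
    show "integrable M (X (Suc 0))" using transfer_I[of "\<lambda>x. x"] assms(7) by simp
    show mean: "\<mu> = expectation (X (Suc 0))" using transfer_E[of "\<lambda>x. x"] assms(8) by simp
    show "integrable M (\<lambda>\<omega>. (X (Suc 0) \<omega> - \<mu>)\<^sup>2)" using transfer_I[of "\<lambda>x. (x - \<mu>)\<^sup>2"] assms(9) by simp
    show "\<sigma>\<^sup>2 = variance (X (Suc 0))"
      using transfer_E[of "\<lambda>x. (x - \<mu>)\<^sup>2"] assms(10) unfolding mean[symmetric] assms(8)[symmetric] by simp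
  qed (fact ind pos assms(11))+
  have F: "P.F y = \<P>(\<omega>' in M. \<eta> \<omega>' \<le> y)" for y
  proof -
    have A: "{p :: real \<times> real. snd p \<le> y} \<in> sets borel"
      using measurable_sets[OF snd_borel, of "{..y}"] by (simp add: vimage_def)
    have "measure (distr M borel (\<lambda>\<omega>. (X (Suc 0) \<omega>, H (Suc 0) \<omega>))) {p. snd p \<le> y} = P.F y"
      unfolding P.F_def by (subst measure_distr[OF pm A]) (auto intro!: arg_cong[where f=prob])
    moreover have "measure (distr M borel (\<lambda>\<omega>. (\<xi> \<omega>, \<eta> \<omega>))) {p. snd p \<le> y} = \<P>(\<omega>' in M. \<eta> \<omega>' \<le> y)"
      by (subst measure_distr[OF xm A]) (auto intro!: arg_cong[where f=prob])
    ultimately show ?thesis unfolding deq by simp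
  qed
  show ?thesis
    using P.AE_limit_points P.AE_positive
  proof eventually_elim
    case (elim \<omega>)
    let ?S = "\<lambda>k. \<Sum>i<k. X (Suc i) \<omega>"
    have T: "perturbed_walk X H (Suc k) \<omega> = ?S k + H (Suc k) \<omega>" for k
      by (simp add: perturbed_walk_def walk_def sum.atLeast1_atMost_eq)
    have "counting_process X H t \<omega> = (\<Sum>k<n. of_bool (?S k + H (Suc k) \<omega> \<le> t))"
      if n: "\<forall>k. ?S k \<le> t \<longrightarrow> k < n" for n t
    proof -
      \<comment> \<open>A perturbed point lies above the walk, hence above \<open>t\<close> once the walk has passed \<open>t\<close>.\<close>
      have late: "\<not> perturbed_walk X H k \<omega> \<le> t" if k: "k \<in> {1..} - {1..n}" for k
      proof -
        obtain j where j: "k = Suc j" "j \<ge> n" using k by (cases k) auto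
        then have "?S j > t" using n by (meson not_le)
        then show ?thesis using elim(2)[rule_format, of j] unfolding j T by simp
      qed
      have "counting_process X H t \<omega> = (\<Sum>\<^sub>\<infinity>k\<in>{1..n}. of_bool (perturbed_walk X H k \<omega> \<le> t))"
        unfolding counting_process_def by (rule infsum_cong_neutral) (use late in auto)
      also have "\<dots> = (\<Sum>k=1..n. of_bool (perturbed_walk X H k \<omega> \<le> t))" by simp
      also have "\<dots> = (\<Sum>k<n. of_bool (perturbed_walk X H (Suc k) \<omega> \<le> t))"
        by (simp only: One_nat_def sum.atLeast1_atMost_eq)
      finally show ?thesis unfolding T .
    qed
    then show ?case
      using elim(1)[rule_format, of "\<lambda>t. counting_process X H t \<omega>"] unfolding F by blast
  qed
qed

end
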